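(* Let $\Omega\subset\mathbb{R}^n$ be a bounded domain with smooth boundary, let $\rho,a,b,c,d>0$ and $\eta\in\mathbb{R}\setminus\{0\}$. Let $\mathcal{H}=(H_0^1(\Omega)\cap H^2(\Omega))\times L^2(\Omega)\times L^2(\Omega)$, with the norm $\|(u,v,\theta)\|_{\mathcal{H}}^2=c\|\Delta u\|^2+\rho\|v\|^2+a\|\theta\|^2$, and let $\mathcal{A}:D(\mathcal{A})\subset\mathcal{H}\to\mathcal{H}$ be the operator $$\mathcal{A}(u,v,\theta)=\Big(v,\ \tfrac{1}{\rho}(-c\Delta^2u+\eta\Delta\theta),\ \tfrac1a(b\Delta\theta-d\Delta^2\theta-\eta\Delta v)\Big)$$ with domain $D(\mathcal{A})=H_*^4(\Omega)\times[H^2(\Omega)\cap H_0^1(\Omega)]\times H_*^4(\Omega)$. Then the $C_0$-semigroup $S=(S(t))_{t\ge0}$ on $\mathcal{H}$ generated by $\mathcal{A}$ is not (immediately) differentiable.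
   Context: $\|\cdot\|$ denotes the norm of $L^2(\Omega)$ (complex-valued functions). $H_*^4(\Omega)=\{u\in H^4(\Omega): u=\Delta u=0 \text{ on }\partial\Omega\}$. The norm $\|\cdot\|_{\mathcal{H}}$ comes from the obvious inner product and is equivalent to the usual norm, so $\mathcal{H}$ is a Hilbert space. The operator $\mathcal{A}$ generates a $C_0$-semigroup of contractions $S(t)$ on $\mathcal{H}$; it is the semigroup associated with the system $\rho u_{tt}=-c\Delta^2u+\eta\Delta\theta$, $a\theta_t=b\Delta\theta-d\Delta^2\theta-\eta\Delta u_t$ with boundary conditions $u=\Delta u=\theta=\Delta\theta=0$ on $\partial\Omega$. A $C_0$-semigroup $(S(t))_{t\ge0}$ on a Banach space $X$ is (immediately) differentiable if for every $x\in X$ the map $t\mapsto S(t)x$ is differentiable on $(0,\infty)$. *)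

theory Defs
  imports "HOL-Analysis.Analysis"
begin

section \<open>Complex vector spaces\<close>

class complex_vector = real_vector +
  fixes scaleC :: "complex \<Rightarrow> 'a \<Rightarrow> 'a"  (infixr \<open>*\<^sub>C\<close> 75)
  assumes scaleC_add_right: "z *\<^sub>C (x + y) = z *\<^sub>C x + z *\<^sub>C y"
    and scaleC_add_left: "(z + w) *\<^sub>C x = z *\<^sub>C x + w *\<^sub>C x"
    and scaleC_scaleC: "z *\<^sub>C w *\<^sub>C x = (z * w) *\<^sub>C x"
    and scaleC_of_real: "complex_of_real r *\<^sub>C x = r *\<^sub>R x"

instantiation prod :: (complex_vector, complex_vector) complex_vector
begin

definition scaleC_prod :: "complex \<Rightarrow> 'a \<times> 'b \<Rightarrow> 'a \<times> 'b"
  where "scaleC_prod z p = (z *\<^sub>C fst p, z *\<^sub>C snd p)"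

instance
  by standard
    (simp_all add: scaleC_prod_def prod_eq_iff scaleC_add_right scaleC_add_left
      scaleC_scaleC scaleC_of_real)

end


section \<open>The space of square-integrable complex functions\<close>

definition square_integrable :: "('a::euclidean_space \<Rightarrow> complex) \<Rightarrow> bool"
  where "square_integrable f \<longleftrightarrow>
    f \<in> borel_measurable lborel \<and> integrable lborel (\<lambda>x. (cmod (f x))\<^sup>2)"

definition L2_rel :: "('a::euclidean_space \<Rightarrow> complex) \<Rightarrow> ('a \<Rightarrow> complex) \<Rightarrow> bool"
  where "L2_rel f g \<longleftrightarrow>
    square_integrable f \<and> square_integrable g \<and> (AE x in lborel. f x = g x)"

lemma square_integrable_0: "square_integrable (\<lambda>_. 0)"
  by (simp add: square_integrable_def)

lemma square_integrable_add:
  assumes "square_integrable f" "square_integrable g"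
  shows "square_integrable (\<lambda>x. f x + g x)"
proof -
  have m [measurable]: "f \<in> borel_measurable lborel" "g \<in> borel_measurable lborel"
    using assms by (auto simp: square_integrable_def)
  have "integrable lborel (\<lambda>x. (cmod (f x + g x))\<^sup>2)"
  proof (rule Bochner_Integration.integrable_bound)
    show "integrable lborel (\<lambda>x. 2 * (cmod (f x))\<^sup>2 + 2 * (cmod (g x))\<^sup>2)"
      using assms by (auto simp: square_integrable_def)
    have "(cmod (f x + g x))\<^sup>2 \<le> 2 * (cmod (f x))\<^sup>2 + 2 * (cmod (g x))\<^sup>2" for x
    proof -
      have "(cmod (f x + g x))\<^sup>2 \<le> (cmod (f x) + cmod (g x))\<^sup>2"
        by (intro power_mono norm_triangle_ineq) auto
      also have "\<dots> \<le> 2 * (cmod (f x))\<^sup>2 + 2 * (cmod (g x))\<^sup>2"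
        using sum_squares_bound[of "cmod (f x)" "cmod (g x)"] by (simp add: power2_sum)
      finally show ?thesis .
    qed
    then show "AE x in lborel. norm ((cmod (f x + g x))\<^sup>2)
        \<le> norm (2 * (cmod (f x))\<^sup>2 + 2 * (cmod (g x))\<^sup>2)"
      by (intro AE_I2) simp
  qed simp
  then show ?thesis by (simp add: square_integrable_def)
qed

lemma square_integrable_scale:
  assumes "square_integrable f"
  shows "square_integrable (\<lambda>x. z * f x)"
  using assms by (auto simp: square_integrable_def norm_mult power_mult_distrib)

lemma square_integrable_uminus:
  "square_integrable f \<Longrightarrow> square_integrable (\<lambda>x. - f x)"
  by (auto simp: square_integrable_def)

lemma integrable_inner_square_integrable:
  assumes "square_integrable f" "square_integrable g"
  shows "integrable lborel (\<lambda>x. f x \<bullet> g x)"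
proof -
  have [measurable]: "f \<in> borel_measurable lborel" "g \<in> borel_measurable lborel"
    using assms by (auto simp: square_integrable_def)
  show ?thesis
  proof (rule Bochner_Integration.integrable_bound)
    show "integrable lborel (\<lambda>x. (cmod (f x))\<^sup>2 + (cmod (g x))\<^sup>2)"
      using assms by (auto simp: square_integrable_def)
    have "\<bar>f x \<bullet> g x\<bar> \<le> (cmod (f x))\<^sup>2 + (cmod (g x))\<^sup>2" for x
    proof -
      have "\<bar>f x \<bullet> g x\<bar> \<le> cmod (f x) * cmod (g x)"
        by (rule Cauchy_Schwarz_ineq2)
      also have "\<dots> \<le> (cmod (f x))\<^sup>2 + (cmod (g x))\<^sup>2"
        using sum_squares_bound[of "cmod (f x)" "cmod (g x)"]
          mult_nonneg_nonneg[OF norm_ge_zero[of "f x"] norm_ge_zero[of "g x"]]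
        by linarith
      finally show ?thesis .
    qed
    then show "AE x in lborel. norm (f x \<bullet> g x) \<le> norm ((cmod (f x))\<^sup>2 + (cmod (g x))\<^sup>2)"
      by (intro AE_I2) simp
  qed simp
qed

quotient_type (overloaded) 'a L2 = "'a::euclidean_space \<Rightarrow> complex" / partial: L2_rel
proof (rule part_equivpI)
  show "\<exists>f. L2_rel f f"
    using square_integrable_0 by (auto simp: L2_rel_def)
  show "symp L2_rel"
    by (auto simp: symp_def L2_rel_def elim: AE_mp)
  show "transp L2_rel"
    unfolding transp_def L2_rel_def by (auto elim: AE_mp)
qed

instantiation L2 :: (euclidean_space) complex_vector
begin

lift_definition zero_L2 :: "'a L2" is "\<lambda>_. 0"
  by (simp add: L2_rel_def square_integrable_0)

lift_definition plus_L2 :: "'a L2 \<Rightarrow> 'a L2 \<Rightarrow> 'a L2" is "\<lambda>f g x. f x + g x"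
  unfolding L2_rel_def by (auto intro: square_integrable_add elim: AE_mp)

lift_definition uminus_L2 :: "'a L2 \<Rightarrow> 'a L2" is "\<lambda>f x. - f x"
  unfolding L2_rel_def by (auto intro: square_integrable_uminus elim: AE_mp)

lift_definition minus_L2 :: "'a L2 \<Rightarrow> 'a L2 \<Rightarrow> 'a L2" is "\<lambda>f g x. f x + - g x"
  unfolding L2_rel_def
  by (auto intro!: square_integrable_add square_integrable_uminus elim: AE_mp
      simp del: add_uminus_conv_diff)

lift_definition scaleC_L2 :: "complex \<Rightarrow> 'a L2 \<Rightarrow> 'a L2" is "\<lambda>z f x. z * f x"
  unfolding L2_rel_def by (auto intro: square_integrable_scale elim: AE_mp)

lift_definition scaleR_L2 :: "real \<Rightarrow> 'a L2 \<Rightarrow> 'a L2" is "\<lambda>r f x. complex_of_real r * f x"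
  unfolding L2_rel_def by (auto intro: square_integrable_scale elim: AE_mp)

instance
proof
  fix f g h :: "'a L2" and r s :: real and z w :: complex
  show "f + g + h = f + (g + h)"
    by transfer (auto simp: L2_rel_def add.assoc intro!: square_integrable_add)
  show "f + g = g + f"
    by transfer (auto simp: L2_rel_def add.commute intro!: square_integrable_add)
  show "0 + f = f"
    by transfer (auto simp: L2_rel_def)
  show "- f + f = 0"
    by transfer (auto simp: L2_rel_def square_integrable_0)
  show "f - g = f + - g"
    by transfer (auto simp: L2_rel_def simp del: add_uminus_conv_diff
        intro!: square_integrable_add square_integrable_uminus)
  show "r *\<^sub>R (f + g) = r *\<^sub>R f + r *\<^sub>R g"
    by transfer (auto simp: L2_rel_def distrib_left
        intro!: square_integrable_add square_integrable_scale)
  show "(r + s) *\<^sub>R f = r *\<^sub>R f + s *\<^sub>R f"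
    by transfer (auto simp: L2_rel_def distrib_right
        intro!: square_integrable_add square_integrable_scale)
  show "r *\<^sub>R s *\<^sub>R f = (r * s) *\<^sub>R f"
    by transfer (auto simp: L2_rel_def mult.assoc intro!: square_integrable_scale)
  show "1 *\<^sub>R f = f"
    by transfer (auto simp: L2_rel_def)
  show "z *\<^sub>C (f + g) = z *\<^sub>C f + z *\<^sub>C g"
    by transfer (auto simp: L2_rel_def distrib_left
        intro!: square_integrable_add square_integrable_scale)
  show "(z + w) *\<^sub>C f = z *\<^sub>C f + w *\<^sub>C f"
    by transfer (auto simp: L2_rel_def distrib_right
        intro!: square_integrable_add square_integrable_scale)
  show "z *\<^sub>C w *\<^sub>C f = (z * w) *\<^sub>C f"
    by transfer (auto simp: L2_rel_def mult.assoc intro!: square_integrable_scale)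
  show "complex_of_real r *\<^sub>C f = r *\<^sub>R f"
    by transfer (auto simp: L2_rel_def intro!: square_integrable_scale)
qed

end

text \<open>The inner product below is the real part of the Hermitian one; it induces the usual
  norm, see \<open>norm_L2\<close>.\<close>

instantiation L2 :: (euclidean_space) real_inner
begin

lift_definition inner_L2 :: "'a L2 \<Rightarrow> 'a L2 \<Rightarrow> real" is "\<lambda>f g. LINT x|lborel. f x \<bullet> g x"
  unfolding L2_rel_def
  by (rule integral_cong_AE) (auto simp: square_integrable_def)

definition norm_L2 :: "'a L2 \<Rightarrow> real"
  where "norm_L2 f = sqrt (f \<bullet> f)"

definition sgn_L2 :: "'a L2 \<Rightarrow> 'a L2"
  where "sgn_L2 f = f /\<^sub>R norm f"

definition dist_L2 :: "'a L2 \<Rightarrow> 'a L2 \<Rightarrow> real"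
  where "dist_L2 f g = norm (f - g)"

definition uniformity_L2 :: "('a L2 \<times> 'a L2) filter"
  where "uniformity_L2 = (INF e\<in>{0 <..}. principal {(f, g). dist f g < e})"

definition open_L2 :: "'a L2 set \<Rightarrow> bool"
  where "open_L2 U \<longleftrightarrow>
    (\<forall>f\<in>U. eventually (\<lambda>(f', g). f' = f \<longrightarrow> g \<in> U) uniformity)"

instance
proof
  fix f g h :: "'a L2" and r :: real
  show "f \<bullet> g = g \<bullet> f"
    by transfer (simp add: inner_commute)
  show "(f + g) \<bullet> h = f \<bullet> h + g \<bullet> h"
    by transfer (auto simp: L2_rel_def inner_add_left integrable_inner_square_integrable)
  show "(r *\<^sub>R f) \<bullet> g = r * (f \<bullet> g)"
    by transfer (auto simp: L2_rel_def simp flip: scaleR_conv_of_real)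
  show "0 \<le> f \<bullet> f"
    by transfer simp
  show "f \<bullet> f = 0 \<longleftrightarrow> f = 0"
  proof transfer
    fix f :: "'a \<Rightarrow> complex" assume "L2_rel f f"
    then have sq: "square_integrable f" by (simp add: L2_rel_def)
    show "(LINT x|lborel. f x \<bullet> f x) = 0 \<longleftrightarrow> L2_rel f (\<lambda>_. 0)"
      using sq integral_nonneg_eq_0_iff_AE[OF integrable_inner_square_integrable[OF sq sq]]
      by (auto simp: L2_rel_def square_integrable_0)
  qed
qed (simp_all add: norm_L2_def sgn_L2_def dist_L2_def uniformity_L2_def open_L2_def)

end

lemma square_integrable_rep: "square_integrable (rep_L2 f)"
  using Quotient_rep_reflp[OF Quotient_L2] by (auto simp: L2_rel_def)

lemma norm_L2: "norm f = sqrt (LINT x|lborel. (cmod (rep_L2 f x))\<^sup>2)"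
  by (simp add: norm_L2_def inner_L2.rep_eq power2_norm_eq_inner)

text \<open>\<open>L\<^sup>2(\<Omega>)\<close> is identified, by extension with zero, with the closed
  subspace of \<open>L\<^sup>2(\<real>\<^sup>n)\<close> of the classes that vanish almost everywhere off
  \<open>\<Omega>\<close>.\<close>

definition L2_on :: "'a::euclidean_space set \<Rightarrow> 'a L2 set"
  where "L2_on \<Omega> = {f. AE x in lborel. x \<notin> \<Omega> \<longrightarrow> rep_L2 f x = 0}"


section \<open>Smooth functions and smooth bounded domains\<close>

text \<open>A multi-index is encoded as a list of coordinate directions: its order is the length of
  the list.\<close>

fun partials :: "'a list \<Rightarrow> ('a::euclidean_space \<Rightarrow> 'b::real_normed_vector) \<Rightarrow> 'a \<Rightarrow> 'b"
  where
    "partials [] f = f"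
  | "partials (b # bs) f = (\<lambda>x. frechet_derivative (partials bs f) (at x) b)"

definition smooth :: "('a::euclidean_space \<Rightarrow> 'b::real_normed_vector) \<Rightarrow> bool"
  where "smooth f \<longleftrightarrow>
    (\<forall>bs. set bs \<subseteq> Basis \<longrightarrow> (\<forall>x. partials bs f differentiable at x))"

definition is_domain :: "'a::euclidean_space set \<Rightarrow> bool"
  where "is_domain \<Omega> \<longleftrightarrow> open \<Omega> \<and> connected \<Omega> \<and> \<Omega> \<noteq> {}"

text \<open>Near each boundary point, \<open>\<Omega>\<close> is the strict epigraph of a smooth function
  \<open>\<gamma>\<close> of the remaining coordinates, after relabelling and reorienting the coordinate
  axes: \<open>b\<close> is a signed coordinate direction and \<open>x - (x \<bullet> b) *\<^sub>R b\<close>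
  consists of the other coordinates of \<open>x\<close>.\<close>

definition smooth_boundary :: "'a::euclidean_space set \<Rightarrow> bool"
  where "smooth_boundary \<Omega> \<longleftrightarrow>
    (\<forall>x0 \<in> frontier \<Omega>. \<exists>r > 0. \<exists>b. (b \<in> Basis \<or> - b \<in> Basis) \<and>
      (\<exists>\<gamma> :: 'a \<Rightarrow> real. smooth \<gamma> \<and>
        \<Omega> \<inter> ball x0 r = {x \<in> ball x0 r. \<gamma> (x - (x \<bullet> b) *\<^sub>R b) < x \<bullet> b}))"


section \<open>Sobolev spaces\<close>

definition test_functions :: "'a::euclidean_space set \<Rightarrow> ('a \<Rightarrow> complex) set"
  where "test_functions \<Omega> =
    {\<phi>. smooth \<phi> \<and> (\<exists>K. compact K \<and> K \<subseteq> \<Omega> \<and> (\<forall>x. x \<notin> K \<longrightarrow> \<phi> x = 0))}"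

definition is_weak_deriv :: "'a::euclidean_space set \<Rightarrow> 'a list \<Rightarrow> 'a L2 \<Rightarrow> 'a L2 \<Rightarrow> bool"
  where "is_weak_deriv \<Omega> bs u g \<longleftrightarrow> g \<in> L2_on \<Omega> \<and>
    (\<forall>\<phi>\<in>test_functions \<Omega>.
      (LINT x:\<Omega>|lborel. rep_L2 u x * partials bs \<phi> x)
        = (- 1) ^ length bs * (LINT x:\<Omega>|lborel. rep_L2 g x * \<phi> x))"

definition weak_deriv :: "'a::euclidean_space set \<Rightarrow> 'a list \<Rightarrow> 'a L2 \<Rightarrow> 'a L2"
  where "weak_deriv \<Omega> bs u = (THE g. is_weak_deriv \<Omega> bs u g)"

definition sobolev :: "nat \<Rightarrow> 'a::euclidean_space set \<Rightarrow> 'a L2 set"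
  where "sobolev k \<Omega> = {u \<in> L2_on \<Omega>.
    \<forall>bs. set bs \<subseteq> Basis \<and> length bs \<le> k \<longrightarrow> (\<exists>g. is_weak_deriv \<Omega> bs u g)}"

definition H1_norm :: "'a::euclidean_space set \<Rightarrow> 'a L2 \<Rightarrow> real"
  where "H1_norm \<Omega> u =
    sqrt ((norm u)\<^sup>2 + (\<Sum>b\<in>Basis. (norm (weak_deriv \<Omega> [b] u))\<^sup>2))"

text \<open>\<open>H\<^sub>0\<^sup>1(\<Omega>)\<close>: the closure of the test functions in \<open>H\<^sup>1(\<Omega>)\<close>.\<close>

definition H10 :: "'a::euclidean_space set \<Rightarrow> 'a L2 set"
  where "H10 \<Omega> = {u \<in> sobolev 1 \<Omega>.
    \<forall>\<epsilon>>0. \<exists>\<phi>\<in>test_functions \<Omega>. H1_norm \<Omega> (u - abs_L2 \<phi>) < \<epsilon>}"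

definition laplacian :: "'a::euclidean_space set \<Rightarrow> 'a L2 \<Rightarrow> 'a L2"
  where "laplacian \<Omega> u = (\<Sum>b\<in>Basis. weak_deriv \<Omega> [b, b] u)"

text \<open>\<open>H\<^sub>*\<^sup>4(\<Omega>)\<close>: a boundary condition \<open>w = 0\<close> on
  \<open>\<partial>\<Omega>\<close> for a Sobolev function \<open>w\<close> means
  \<open>w \<in> H\<^sub>0\<^sup>1(\<Omega>)\<close>.\<close>

definition H4_star :: "'a::euclidean_space set \<Rightarrow> 'a L2 set"
  where "H4_star \<Omega> = {u \<in> sobolev 4 \<Omega>. u \<in> H10 \<Omega> \<and> laplacian \<Omega> u \<in> H10 \<Omega>}"


section \<open>Strongly continuous semigroups\<close>

text \<open>The underlying space is a complex linear subspace \<open>X\<close> of the ambient type, normed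
  by \<open>N\<close>, which is in general not the restriction of a norm of that type. The values of a
  semigroup at negative times are irrelevant.\<close>

definition norm_tendsto ::
    "('x::complex_vector \<Rightarrow> real) \<Rightarrow> (real \<Rightarrow> 'x) \<Rightarrow> 'x \<Rightarrow> real filter \<Rightarrow> bool"
  where "norm_tendsto N f l F \<longleftrightarrow> ((\<lambda>h. N (f h - l)) \<longlongrightarrow> 0) F"

definition bounded_operator ::
    "'x::complex_vector set \<Rightarrow> ('x \<Rightarrow> real) \<Rightarrow> ('x \<Rightarrow> 'x) \<Rightarrow> bool"
  where "bounded_operator X N T \<longleftrightarrow>
    (\<forall>x\<in>X. T x \<in> X) \<and>
    (\<forall>x\<in>X. \<forall>y\<in>X. T (x + y) = T x + T y) \<and>
    (\<forall>z. \<forall>x\<in>X. T (z *\<^sub>C x) = z *\<^sub>C T x) \<and>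
    (\<exists>C. \<forall>x\<in>X. N (T x) \<le> C * N x)"

definition C0_semigroup ::
    "'x::complex_vector set \<Rightarrow> ('x \<Rightarrow> real) \<Rightarrow> (real \<Rightarrow> 'x \<Rightarrow> 'x) \<Rightarrow> bool"
  where "C0_semigroup X N S \<longleftrightarrow>
    (\<forall>t\<ge>0. bounded_operator X N (S t)) \<and>
    (\<forall>x\<in>X. S 0 x = x) \<and>
    (\<forall>s\<ge>0. \<forall>t\<ge>0. \<forall>x\<in>X. S (s + t) x = S s (S t x)) \<and>
    (\<forall>x\<in>X. norm_tendsto N (\<lambda>t. S t x) x (at_right 0))"

definition is_generator ::
    "'x::complex_vector set \<Rightarrow> ('x \<Rightarrow> real) \<Rightarrow> (real \<Rightarrow> 'x \<Rightarrow> 'x) \<Rightarrow> 'x set \<Rightarrow> ('x \<Rightarrow> 'x) \<Rightarrow> bool"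
  where "is_generator X N S D A \<longleftrightarrow>
    (\<forall>x y. x \<in> X \<and> y \<in> X \<and> norm_tendsto N (\<lambda>h. (S h x - x) /\<^sub>R h) y (at_right 0)
       \<longleftrightarrow> x \<in> D \<and> y = A x)"

definition differentiable_semigroup ::
    "'x::complex_vector set \<Rightarrow> ('x \<Rightarrow> real) \<Rightarrow> (real \<Rightarrow> 'x \<Rightarrow> 'x) \<Rightarrow> bool"
  where "differentiable_semigroup X N S \<longleftrightarrow>
    (\<forall>x\<in>X. \<forall>t>0. \<exists>y\<in>X. norm_tendsto N (\<lambda>h. (S (t + h) x - S t x) /\<^sub>R h) y (at 0))"


section \<open>The thermoelastic plate operator\<close>

type_synonym 'a plate_state = "'a L2 \<times> 'a L2 \<times> 'a L2"

definition energy_space :: "'a::euclidean_space set \<Rightarrow> 'a plate_state set"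
  where "energy_space \<Omega> = (H10 \<Omega> \<inter> sobolev 2 \<Omega>) \<times> L2_on \<Omega> \<times> L2_on \<Omega>"

definition energy_norm ::
    "'a::euclidean_space set \<Rightarrow> real \<Rightarrow> real \<Rightarrow> real \<Rightarrow> 'a plate_state \<Rightarrow> real"
  where "energy_norm \<Omega> \<rho> a c = (\<lambda>(u, v, \<theta>).
    sqrt (c * (norm (laplacian \<Omega> u))\<^sup>2 + \<rho> * (norm v)\<^sup>2 + a * (norm \<theta>)\<^sup>2))"

definition plate_domain :: "'a::euclidean_space set \<Rightarrow> 'a plate_state set"
  where "plate_domain \<Omega> = H4_star \<Omega> \<times> (sobolev 2 \<Omega> \<inter> H10 \<Omega>) \<times> H4_star \<Omega>"

definition plate_operator ::
    "'a::euclidean_space set \<Rightarrow> real \<Rightarrow> real \<Rightarrow> real \<Rightarrow> real \<Rightarrow> real \<Rightarrow> real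
      \<Rightarrow> 'a plate_state \<Rightarrow> 'a plate_state"
  where "plate_operator \<Omega> \<rho> a b c d \<eta> = (\<lambda>(u, v, \<theta>).
    (v,
     (1 / \<rho>) *\<^sub>R (- c *\<^sub>R laplacian \<Omega> (laplacian \<Omega> u) + \<eta> *\<^sub>R laplacian \<Omega> \<theta>),
     (1 / a) *\<^sub>R (b *\<^sub>R laplacian \<Omega> \<theta> - d *\<^sub>R laplacian \<Omega> (laplacian \<Omega> \<theta>)
       - \<eta> *\<^sub>R laplacian \<Omega> v)))"

end

theory Submission
  imports Defs "HOL-Computational_Algebra.Polynomial"
begin

text \<open>Elliptic regularity, compactness and even completeness of the energy space are avoided by
  duality. If the semigroup were differentiable, \<open>S(t)x\<close> would lie in the domain of the generator for
  every \<open>t > 0\<close>, and so its components could be tested against approximate eigenfunctions \<open>\<phi>\<close> of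
  the weak Dirichlet Laplacian to an eigenvalue \<open>\<mu>\<close>; these are merely functionals and need not
  lie in \<open>H\<^sup>2(\<Omega>)\<close>. The numbers \<open>p = -\<langle>\<Delta>u, \<phi>\<rangle>\<close>, \<open>q = \<langle>v, \<phi>\<rangle>\<close>,
  \<open>r = \<langle>\<theta>, \<phi>\<rangle>\<close> then solve, up to a small error, the system
  \<open>p' = \<mu> q\<close>, \<open>\<rho> q' = -c \<mu> p - \<eta> \<mu> r\<close>, \<open>a r' = -(b \<mu> + d \<mu>\<^sup>2) r + \<eta> \<mu> q\<close>,
  which oscillates with frequency of order \<open>\<mu>\<close> but is damped only at a rate independent of
  \<open>\<mu>\<close>. As the derivative at time 1 stays bounded in \<open>\<mu>\<close>, \<open>\<mu> \<langle>v, \<phi>\<rangle>\<close>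
  is bounded as \<open>\<mu> \<rightarrow> \<infinity>\<close> for each initial state \<open>(0, v, 0)\<close>, \<open>v \<in> L\<^sup>2(\<Omega>)\<close>,
  contradicting the uniform boundedness principle in the complete space \<open>L\<^sup>2(\<Omega>)\<close>.

  Approximate eigenfunctions with arbitrarily large \<open>\<mu>\<close> come from the bounded self-adjoint operator
  \<open>T = (1 - \<Delta>)\<^sup>-\<^sup>1\<close>, obtained by orthogonal projection onto the closure of the graph of the
  gradient; test functions oscillating rapidly show that \<open>T\<close> has approximate eigenvalues
  arbitrarily close to 0.\<close>

section \<open>Smooth functions\<close>

text \<open>The damping stays bounded because for large \<open>\<mu>\<close> the third equation
  forces r ~ \<eta> q / (d \<mu>); inserted into the second, this leaves a friction term -(\<eta>^2
  / d) q without \<open>\<mu>\<close>. Two roots of the scalar system thus lie near the vertical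
  line Re z = -\<eta>^2 / (2 d \<rho>), at height about sqrt (c / \<rho>) \<mu>, and spectrum along
  a whole vertical line contradicts differentiability. The energy argument makes this quantitative
  without computing roots. Differentiability gives a bound at time 1 for each orbit separately, with
  a constant that depends on the initial state, so the contradiction is built from one single v. The
  accuracy of the quasimodes has to be tied to \<open>\<mu>\<close>: the error 1 / (k \<mu>^2) is
  the size at which the perturbation of the squared amplitude is of order 1 / \<mu>^2, like the
  amplitude itself at time 1. This is possible because an approximate eigenvalue offers vectors of
  any accuracy.\<close>

lemma partials_append: "partials (bs @ cs) f = partials bs (partials cs f)"
  by (induction bs) auto

lemma smooth_differentiable: "smooth f \<Longrightarrow> f differentiable at x"
  unfolding smooth_def by (drule spec[of _ "[]"]) auto

lemma smooth_partials:
  assumes "smooth f" "set cs \<subseteq> Basis"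
  shows "smooth (partials cs f)"
  unfolding smooth_def
proof (intro allI impI)
  fix bs :: "'a list" and x
  assume "set bs \<subseteq> Basis"
  then have "set (bs @ cs) \<subseteq> Basis" using assms(2) by auto
  then show "partials bs (partials cs f) differentiable at x"
    using assms(1) unfolding smooth_def by (metis partials_append)
qed

lemma smooth_frechet_derivative:
  "smooth f \<Longrightarrow> b \<in> Basis \<Longrightarrow> smooth (\<lambda>x. frechet_derivative f (at x) b)"
  using smooth_partials[of f "[b]"] by simp

text \<open>Iterated partial derivatives never leave a class that is stable under them. The classes
  used below are the constants, the algebra \<open>smooth_alg\<close> and the multiples of ridge
  functions.\<close>

lemma smooth_coinduct:
  assumes "P f"
    and "\<And>f x. P f \<Longrightarrow> f differentiable at x"
    and "\<And>f b. P f \<Longrightarrow> b \<in> Basis \<Longrightarrow> P (\<lambda>x. frechet_derivative f (at x) b)"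
  shows "smooth f"
proof -
  have "P (partials bs f)" if "set bs \<subseteq> Basis" for bs
    using that
  proof (induction bs)
    case (Cons b bs)
    then show ?case using assms(3)[of "partials bs f" b] by simp
  qed (simp add: assms(1))
  then show ?thesis using assms(2) unfolding smooth_def by blast
qed

lemma frechet_derivative_at_eq:
  "(f has_derivative f') (at x) \<Longrightarrow> frechet_derivative f (at x) b = f' b"
  by (metis frechet_derivative_at)

lemma smooth_has_derivative:
  "smooth f \<Longrightarrow> (f has_derivative frechet_derivative f (at x)) (at x)"
  using smooth_differentiable frechet_derivative_works by blast

lemma smooth_const [simp]: "smooth (\<lambda>_. c)"
  by (rule smooth_coinduct[where P = "\<lambda>f. \<exists>c. f = (\<lambda>_. c)"])
    (auto simp: frechet_derivative_const)

text \<open>A derivative of a product is a sum of products, so products alone are not a stable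
  class. The joint closure under sums and products is, and this replaces a Leibniz formula of higher
  order.\<close>

inductive smooth_alg :: "('a::euclidean_space \<Rightarrow> 'b::real_normed_algebra) \<Rightarrow> bool" where
  base: "smooth f \<Longrightarrow> smooth_alg f"
| add: "smooth_alg f \<Longrightarrow> smooth_alg g \<Longrightarrow> smooth_alg (\<lambda>x. f x + g x)"
| mult: "smooth_alg f \<Longrightarrow> smooth_alg g \<Longrightarrow> smooth_alg (\<lambda>x. f x * g x)"

lemma smooth_alg_differentiable: "smooth_alg f \<Longrightarrow> f differentiable at x"
  by (induction rule: smooth_alg.induct)
    (auto intro: smooth_differentiable differentiable_add differentiable_mult)

lemma smooth_alg_has_derivative:
  "smooth_alg f \<Longrightarrow> (f has_derivative frechet_derivative f (at x)) (at x)"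
  using smooth_alg_differentiable frechet_derivative_works by blast

lemma smooth_alg_frechet_derivative:
  assumes "smooth_alg f" "b \<in> Basis"
  shows "smooth_alg (\<lambda>x. frechet_derivative f (at x) b)"
  using assms
proof (induction rule: smooth_alg.induct)
  case (base f)
  then show ?case by (simp add: smooth_alg.base smooth_frechet_derivative)
next
  case (add f g)
  then have "(\<lambda>x. frechet_derivative (\<lambda>x. f x + g x) (at x) b)
      = (\<lambda>x. frechet_derivative f (at x) b + frechet_derivative g (at x) b)"
    by (intro ext frechet_derivative_at_eq has_derivative_add smooth_alg_has_derivative)
  with add show ?case by (simp add: smooth_alg.add)
next
  case (mult f g)
  then have "(\<lambda>x. frechet_derivative (\<lambda>x. f x * g x) (at x) b)
      = (\<lambda>x. f x * frechet_derivative g (at x) b + frechet_derivative f (at x) b * g x)"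
    by (intro ext frechet_derivative_at_eq has_derivative_mult smooth_alg_has_derivative)
  with mult show ?case by (simp add: smooth_alg.add smooth_alg.mult)
qed

lemma smooth_alg_smooth: "smooth_alg f \<Longrightarrow> smooth f"
  by (erule smooth_coinduct[of smooth_alg])
    (rule smooth_alg_differentiable smooth_alg_frechet_derivative; assumption)+

lemma smooth_add: "smooth f \<Longrightarrow> smooth g \<Longrightarrow> smooth (\<lambda>x. f x + g x)"
  for f :: "'a::euclidean_space \<Rightarrow> 'b::real_normed_algebra"
  by (rule smooth_alg_smooth) (intro smooth_alg.add smooth_alg.base)

lemma smooth_mult: "smooth f \<Longrightarrow> smooth g \<Longrightarrow> smooth (\<lambda>x. f x * g x)"
  for f :: "'a::euclidean_space \<Rightarrow> 'b::real_normed_algebra"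
  by (rule smooth_alg_smooth) (intro smooth_alg.mult smooth_alg.base)

lemma smooth_prod:
  fixes f :: "'i \<Rightarrow> 'a::euclidean_space \<Rightarrow> 'b::{real_normed_algebra, comm_monoid_mult}"
  assumes "\<And>i. i \<in> I \<Longrightarrow> smooth (f i)"
  shows "smooth (\<lambda>x. \<Prod>i\<in>I. f i x)"
  using assms by (induction I rule: infinite_finite_induct) (auto intro: smooth_mult)

section \<open>Composition with bounded linear maps\<close>

lemma frechet_derivative_bounded_linear:
  assumes "bounded_linear T" "f differentiable at x"
  shows "frechet_derivative (\<lambda>x. T (f x)) (at x) b = T (frechet_derivative f (at x) b)"
  by (intro frechet_derivative_at_eq bounded_linear.has_derivative[OF assms(1)]
      assms(2)[unfolded frechet_derivative_works])

lemma partials_bounded_linear: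
  fixes f :: "'a::euclidean_space \<Rightarrow> 'b::real_normed_vector"
  assumes "bounded_linear T" "smooth f" "set bs \<subseteq> Basis"
  shows "partials bs (\<lambda>x. T (f x)) = (\<lambda>x. T (partials bs f x))"
  using assms(3)
proof (induction bs)
  case (Cons b bs)
  have d: "partials bs f differentiable at x" for x
    using Cons.prems by (intro smooth_differentiable smooth_partials[OF assms(2)]) auto
  show ?case
    using Cons.prems Cons.IH by (simp add: frechet_derivative_bounded_linear[OF assms(1) d])
qed simp

lemma smooth_bounded_linear:
  fixes f :: "'a::euclidean_space \<Rightarrow> 'b::real_normed_vector"
  assumes "bounded_linear T" "smooth f"
  shows "smooth (\<lambda>x. T (f x))"
  unfolding smooth_def
proof (intro allI impI)
  fix bs :: "'a list" and x
  assume bs: "set bs \<subseteq> Basis"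
  have "partials bs f differentiable at x"
    using bs by (intro smooth_differentiable smooth_partials[OF assms(2)])
  then have "(\<lambda>x. T (partials bs f x)) differentiable at x"
    using assms(1) bounded_linear.has_derivative unfolding differentiable_def by blast
  then show "partials bs (\<lambda>x. T (f x)) differentiable at x"
    by (simp add: partials_bounded_linear[OF assms bs])
qed

section \<open>Smooth functions of one linear coordinate\<close>

lemma has_derivative_ridge:
  fixes h :: "real \<Rightarrow> 'b::real_normed_vector"
  assumes "(h has_vector_derivative h') (at (x \<bullet> e + s))"
  shows "((\<lambda>x. h (x \<bullet> e + s)) has_derivative (\<lambda>y. (y \<bullet> e) *\<^sub>R h')) (at x)"
proof -
  have "((\<lambda>x. x \<bullet> e + s) has_derivative (\<lambda>y. y \<bullet> e)) (at x)"
    by (auto intro!: derivative_eq_intros)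
  from has_derivative_compose[OF this assms[unfolded has_vector_derivative_def]]
  show ?thesis by simp
qed

text \<open>Differentiating in direction \<open>b\<close> multiplies by \<open>b \<bullet> e\<close>
  and advances the index by one. The sequence \<open>h\<close> lists the successive derivatives of
  the profile, so one-variable calculus suffices for \<open>cis\<close> and
  \<open>flat\<close>.\<close>

lemma smooth_ridge:
  fixes h :: "nat \<Rightarrow> real \<Rightarrow> 'b::real_normed_vector"
  assumes "\<And>n t. (h n has_vector_derivative h (Suc n) t) (at t)"
  shows "smooth (\<lambda>x. h 0 (x \<bullet> e + s))"
proof (rule smooth_coinduct[where P = "\<lambda>f. \<exists>r n. f = (\<lambda>x. r *\<^sub>R h n (x \<bullet> e + s))"])
  have d: "((\<lambda>x. r *\<^sub>R h n (x \<bullet> e + s)) has_derivative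
      (\<lambda>y. r *\<^sub>R (y \<bullet> e) *\<^sub>R h (Suc n) (x \<bullet> e + s))) (at x)" for r n x
    by (intro has_derivative_scaleR_right has_derivative_ridge assms)
  show "\<exists>r n. (\<lambda>x. h 0 (x \<bullet> e + s)) = (\<lambda>x. r *\<^sub>R h n (x \<bullet> e + s))"
    by (rule exI[of _ 1], rule exI[of _ 0]) simp
  show "f differentiable at x" if "\<exists>r n. f = (\<lambda>x. r *\<^sub>R h n (x \<bullet> e + s))" for f x
    using that d unfolding differentiable_def by blast
  show "\<exists>r n. (\<lambda>x. frechet_derivative f (at x) b) = (\<lambda>x. r *\<^sub>R h n (x \<bullet> e + s))"
    if f: "\<exists>r n. f = (\<lambda>x. r *\<^sub>R h n (x \<bullet> e + s))" for f b
  proof -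
    from f obtain r n where "f = (\<lambda>x. r *\<^sub>R h n (x \<bullet> e + s))" by blast
    then have "(\<lambda>x. frechet_derivative f (at x) b)
        = (\<lambda>x. (r * (b \<bullet> e)) *\<^sub>R h (Suc n) (x \<bullet> e + s))"
      using frechet_derivative_at_eq[OF d] by auto
    then show ?thesis by blast
  qed
qed

lemma smooth_cis: "smooth (\<lambda>x. cis (x \<bullet> e))"
proof -
  have "smooth (\<lambda>x. (\<lambda>n t. \<i> ^ n * cis t) 0 (x \<bullet> e + 0))"
    unfolding cis_conv_exp
    by (rule smooth_ridge,
        rule has_vector_derivative_real_field[where f = "\<lambda>z. \<i> ^ n * exp (\<i> * z)" for n])
      (auto intro!: derivative_eq_intros)
  then show ?thesis by simp
qed

subsection \<open>Bump functions\<close>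

text \<open>The functions \<open>p(1/t) exp(-1/t)\<close>, extended by zero to \<open>t \<le> 0\<close>, are stable
  under differentiation.\<close>

definition flat :: "real poly \<Rightarrow> real \<Rightarrow> real"
  where "flat p t = (if t > 0 then poly p (1 / t) * exp (- (1 / t)) else 0)"

lemma poly_mult_exp_tendsto_0: "((\<lambda>s::real. poly p s * exp (- s)) \<longlongrightarrow> 0) at_top"
proof -
  have "((\<lambda>s::real. \<Sum>i\<le>degree p. coeff p i * (s ^ i / exp s)) \<longlongrightarrow>
      (\<Sum>i\<le>degree p. coeff p i * 0)) at_top"
    by (intro tendsto_sum tendsto_mult tendsto_const tendsto_power_div_exp_0)
  then show ?thesis
    by (simp add: poly_altdef sum_distrib_right exp_minus divide_inverse mult.assoc)
qed

lemma flat_tendsto_0: "(flat p \<longlongrightarrow> 0) (at 0)"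
proof -
  have "((\<lambda>t. poly p (inverse t) * exp (- (inverse t))) \<longlongrightarrow> 0) (at_right 0)"
    using filterlim_compose[OF poly_mult_exp_tendsto_0 filterlim_inverse_at_top_right] .
  then have "(flat p \<longlongrightarrow> 0) (at_right 0)"
    by (rule Lim_transform_eventually)
      (auto simp: flat_def inverse_eq_divide eventually_at_right_less
        intro!: eventually_at_rightI[of 0 1])
  moreover have "(flat p \<longlongrightarrow> 0) (at_left 0)"
    by (rule Lim_transform_eventually[OF tendsto_const])
      (auto simp: flat_def intro!: eventually_at_leftI[of "-1" 0])
  ultimately show ?thesis by (simp add: filterlim_split_at)
qed

text \<open>With s = 1/t one has d/dt = -s^2 d/ds, which maps p(s) exp(-s) to s^2 (p - p')(s)
  exp(-s); the factor s^2 is \<open>[:0, 0, 1:]\<close>. At t = 0 the difference quotient is again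
  flat, with polynomial s p(s), and tends to 0.\<close>

lemma flat_has_vector_derivative:
  "(flat p has_vector_derivative flat ([:0, 0, 1:] * (p - pderiv p)) t) (at t)"
proof -
  let ?q = "[:0, 0, 1:] * (p - pderiv p)"
  consider "t > 0" | "t < 0" | "t = 0" by linarith
  then have "(flat p has_real_derivative flat ?q t) (at t)"
  proof cases
    case 1
    have "((\<lambda>t. poly p (1 / t) * exp (- (1 / t))) has_real_derivative flat ?q t) (at t)"
      using 1 by (auto intro!: derivative_eq_intros DERIV_chain'[OF _ poly_DERIV] simp: flat_def)
        (simp add: field_simps power2_eq_square)
    then show ?thesis
      by (rule DERIV_cong_ev[THEN iffD1, OF refl _ refl, rotated])
        (use 1 in \<open>auto intro!: eventually_nhds_in_open[of "{0<..}", THEN eventually_mono]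
          simp: flat_def\<close>)
  next
    case 2
    have "((\<lambda>t. 0) has_real_derivative flat ?q t) (at t)"
      using 2 by (auto simp: flat_def)
    then show ?thesis
      by (rule DERIV_cong_ev[THEN iffD1, OF refl _ refl, rotated])
        (use 2 in \<open>auto intro!: eventually_nhds_in_open[of "{..<0}", THEN eventually_mono]
          simp: flat_def\<close>)
  next
    case 3
    have "(flat p (0 + h) - flat p 0) / h = flat ([:0, 1:] * p) h" for h
      by (simp add: flat_def)
    then have "(\<lambda>h. (flat p (0 + h) - flat p 0) / h) \<midarrow>0\<rightarrow> 0"
      using flat_tendsto_0[of "[:0, 1:] * p"] by simp
    then show ?thesis using 3 by (simp add: DERIV_def flat_def)
  qed
  then show ?thesis by (simp add: has_real_derivative_iff_has_vector_derivative)
qed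

text \<open>The parameter \<open>k\<close> sharpens the edges: for large \<open>k\<close> the bump
  approaches the indicator of the open box. That limit serves the fundamental lemma, while k = 1
  gives the envelope of the oscillating test functions.\<close>

definition bump :: "real \<Rightarrow> 'a::euclidean_space \<Rightarrow> 'a \<Rightarrow> 'a \<Rightarrow> real"
  where "bump k l u x = (\<Prod>i\<in>Basis. flat 1 (k * (x \<bullet> i - l \<bullet> i)) * flat 1 (k * (u \<bullet> i - x \<bullet> i)))"

lemma smooth_flat_ridge: "smooth (\<lambda>x. flat 1 (x \<bullet> e + s))"
proof -
  define P where "P n = ((\<lambda>p. [:0, 0, 1:] * (p - pderiv p)) ^^ n) (1 :: real poly)" for n
  have "(flat (P n) has_vector_derivative flat (P (Suc n)) t) (at t)" for n t
    using flat_has_vector_derivative[of "P n" t] by (simp add: P_def)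
  from smooth_ridge[of "\<lambda>n. flat (P n)", OF this, of e s] show ?thesis
    by (simp add: P_def)
qed

lemma smooth_bump: "smooth (bump k l u)"
proof -
  have "smooth (\<lambda>x. \<Prod>i\<in>Basis. flat 1 (x \<bullet> (k *\<^sub>R i) + - (k * (l \<bullet> i)))
      * flat 1 (x \<bullet> (- k *\<^sub>R i) + k * (u \<bullet> i)))"
    by (intro smooth_prod smooth_mult smooth_flat_ridge)
  moreover have "bump k l u = (\<lambda>x. \<Prod>i\<in>Basis. flat 1 (x \<bullet> (k *\<^sub>R i) + - (k * (l \<bullet> i)))
      * flat 1 (x \<bullet> (- k *\<^sub>R i) + k * (u \<bullet> i)))"
    by (auto simp: bump_def fun_eq_iff algebra_simps intro!: prod.cong)
  ultimately show ?thesis by simp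
qed

lemma flat_1_bounds: "0 \<le> flat 1 t" "flat 1 t \<le> 1"
  by (auto simp: flat_def)

lemma bump_nonneg: "0 \<le> bump k l u x"
  by (simp add: bump_def prod_nonneg flat_1_bounds)

lemma bump_le_1: "bump k l u x \<le> 1"
  unfolding bump_def by (intro prod_le_1) (auto simp: flat_1_bounds mult_le_one)

lemma bump_pos: "k > 0 \<Longrightarrow> x \<in> box l u \<Longrightarrow> 0 < bump k l u x"
  unfolding bump_def by (intro prod_pos) (auto simp: flat_def mem_box)

lemma bump_eq_0:
  assumes "k > 0" "x \<notin> box l u" shows "bump k l u x = 0"
proof -
  from assms(2) obtain i where i: "i \<in> Basis" "x \<bullet> i \<le> l \<bullet> i \<or> u \<bullet> i \<le> x \<bullet> i"
    by (auto simp: mem_box not_less)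
  have "flat 1 (k * (x \<bullet> i - l \<bullet> i)) * flat 1 (k * (u \<bullet> i - x \<bullet> i)) = 0"
    using i(2) assms(1) by (auto simp: flat_def zero_less_mult_iff)
  then show ?thesis unfolding bump_def using i(1) by (intro prod_zero) auto
qed

lemma flat_1_tendsto:
  assumes "t > 0" shows "(\<lambda>n. flat 1 (real (Suc n) * t)) \<longlonglongrightarrow> 1"
proof -
  have "(\<lambda>n. exp (- (inverse (real (Suc n)) * inverse t))) \<longlonglongrightarrow> exp (- (0 * inverse t))"
    by (intro tendsto_intros LIMSEQ_inverse_real_of_nat)
  moreover have "flat 1 (real (Suc n) * t) = exp (- (inverse (real (Suc n)) * inverse t))" for n
    using assms by (simp add: flat_def inverse_eq_divide)
  ultimately show ?thesis by simp
qed

lemma bump_tendsto: "(\<lambda>n. bump (real (Suc n)) l u x) \<longlonglongrightarrow> indicat_real (box l u) x"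
proof (cases "x \<in> box l u")
  case True
  have "(\<lambda>n. bump (real (Suc n)) l u x) \<longlonglongrightarrow> (\<Prod>i\<in>(Basis::'a set). 1 * 1)"
    unfolding bump_def
    by (intro tendsto_prod tendsto_mult flat_1_tendsto) (use True in \<open>auto simp: mem_box\<close>)
  then show ?thesis using True by simp
next
  case False
  then show ?thesis by (simp add: bump_eq_0 del: of_nat_Suc)
qed

section \<open>The Hilbert space of square-integrable functions\<close>

lemma rep_abs_L2: "square_integrable f \<Longrightarrow> AE x in lborel. rep_L2 (abs_L2 f) x = f x"
  using Quotient_rep_abs[OF Quotient_L2, of f] by (auto simp: L2_rel_def)

lemma abs_rep_L2: "abs_L2 (rep_L2 f) = f"
  by (rule Quotient_abs_rep[OF Quotient_L2])

lemma L2_eqI: "(AE x in lborel. rep_L2 f x = rep_L2 g x) \<Longrightarrow> f = g"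
  using Quotient_rel_rep[OF Quotient_L2, of f g] square_integrable_rep
  by (auto simp: L2_rel_def)

lemma rep_L2_measurable [measurable]: "rep_L2 f \<in> borel_measurable borel"
  using square_integrable_rep[of f] by (auto simp: square_integrable_def)

lemma square_integrable_measurable: "square_integrable f \<Longrightarrow> f \<in> borel_measurable borel"
  by (auto simp: square_integrable_def)

lemma L2_rel_refl: "square_integrable f \<Longrightarrow> L2_rel f f"
  by (simp add: L2_rel_def)

lemma abs_L2_add:
  "square_integrable f \<Longrightarrow> square_integrable g \<Longrightarrow> abs_L2 f + abs_L2 g = abs_L2 (\<lambda>x. f x + g x)"
  by (simp add: plus_L2.abs_eq L2_rel_refl)

lemma abs_L2_diff:
  "square_integrable f \<Longrightarrow> square_integrable g \<Longrightarrow> abs_L2 f - abs_L2 g = abs_L2 (\<lambda>x. f x - g x)"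
  by (simp add: minus_L2.abs_eq L2_rel_refl)

lemma abs_L2_scaleR:
  "square_integrable f \<Longrightarrow> r *\<^sub>R abs_L2 f = abs_L2 (\<lambda>x. complex_of_real r * f x)"
  by (simp add: scaleR_L2.abs_eq L2_rel_refl)

lemma square_integrable_diff:
  "square_integrable f \<Longrightarrow> square_integrable g \<Longrightarrow> square_integrable (\<lambda>x. f x - g x)"
  using square_integrable_add[OF _ square_integrable_uminus, of f g] by simp

lemma inner_abs_L2:
  assumes "square_integrable g"
  shows "f \<bullet> abs_L2 g = (LINT x|lborel. rep_L2 f x \<bullet> g x)"
proof -
  have [measurable]: "g \<in> borel_measurable borel" using assms by (rule square_integrable_measurable)
  have "(LINT x|lborel. rep_L2 f x \<bullet> rep_L2 (abs_L2 g) x) = (LINT x|lborel. rep_L2 f x \<bullet> g x)"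
    by (rule integral_cong_AE) (use rep_abs_L2[OF assms] in auto)
  then show ?thesis by (simp add: inner_L2.rep_eq)
qed

lemma norm_abs_L2:
  assumes "square_integrable f"
  shows "(norm (abs_L2 f))\<^sup>2 = (LINT x|lborel. (cmod (f x))\<^sup>2)"
proof -
  have [measurable]: "f \<in> borel_measurable borel" using assms by (rule square_integrable_measurable)
  have "(LINT x|lborel. (cmod (rep_L2 (abs_L2 f) x))\<^sup>2) = (LINT x|lborel. (cmod (f x))\<^sup>2)"
    by (rule integral_cong_AE) (use rep_abs_L2[OF assms] in auto)
  then show ?thesis by (simp add: norm_L2)
qed

lemma integrable_L2: "integrable lborel (\<lambda>x. (cmod (rep_L2 f x))\<^sup>2)"
  using square_integrable_rep[of f] by (simp add: square_integrable_def)

lemma square_integrable_bound: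
  assumes "square_integrable g" "f \<in> borel_measurable borel" "\<And>x. cmod (f x) \<le> cmod (g x)"
  shows "square_integrable f"
proof -
  have [measurable]: "f \<in> borel_measurable borel" by fact
  have "integrable lborel (\<lambda>x. (cmod (f x))\<^sup>2)"
    by (rule Bochner_Integration.integrable_bound[of _ "\<lambda>x. (cmod (g x))\<^sup>2"])
      (use assms in \<open>auto simp: square_integrable_def power_mono\<close>)
  then show ?thesis by (simp add: square_integrable_def)
qed

subsection \<open>Completeness\<close>

lemma rep_L2_minus: "AE x in lborel. rep_L2 (f - g) x = rep_L2 f x - rep_L2 g x"
proof -
  have "f - g = abs_L2 (\<lambda>x. rep_L2 f x - rep_L2 g x)"
    using abs_L2_diff[OF square_integrable_rep square_integrable_rep, of f g]
    by (simp add: abs_rep_L2)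
  then show ?thesis
    using rep_abs_L2[OF square_integrable_diff[OF square_integrable_rep square_integrable_rep], of f g]
    by simp
qed

lemma nn_integral_norm_L2_diff:
  "(\<integral>\<^sup>+x. ennreal ((cmod (rep_L2 f x - rep_L2 g x))\<^sup>2) \<partial>lborel) = ennreal ((norm (f - g))\<^sup>2)"
proof -
  have "(\<integral>\<^sup>+x. ennreal ((cmod (rep_L2 f x - rep_L2 g x))\<^sup>2) \<partial>lborel)
      = (\<integral>\<^sup>+x. ennreal ((cmod (rep_L2 (f - g) x))\<^sup>2) \<partial>lborel)"
    by (rule nn_integral_cong_AE) (use rep_L2_minus[of f g] in auto)
  also have "\<dots> = ennreal (LINT x|lborel. (cmod (rep_L2 (f - g) x))\<^sup>2)"
    by (rule nn_integral_eq_integral) (auto simp: integrable_L2)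
  finally show ?thesis by (simp add: norm_L2)
qed

text \<open>Even with the weight 2^n the integrals of the squared increments are dominated by a
  geometric series, so the weighted series is finite almost everywhere. Since y <= 2^n y^2 + 2^-n
  for y >= 0, it also controls the increments themselves.\<close>

lemma L2_fast_Cauchy_converges_AE:
  assumes F: "\<And>n. norm (F (Suc n) - F n) \<le> (1 / 2) ^ n"
  shows "AE x in lborel. convergent (\<lambda>n. rep_L2 (F n) x)"
proof -
  define D where "D n x = cmod (rep_L2 (F (Suc n)) x - rep_L2 (F n) x)" for n x
  have [measurable]: "D n \<in> borel_measurable borel" for n unfolding D_def by measurable
  have "(\<integral>\<^sup>+x. (\<Sum>n. ennreal (2 ^ n * (D n x)\<^sup>2)) \<partial>lborel)
      = (\<Sum>n. \<integral>\<^sup>+x. ennreal (2 ^ n * (D n x)\<^sup>2) \<partial>lborel)"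
    by (rule nn_integral_suminf) auto
  also have "\<dots> \<le> (\<Sum>n. ennreal ((1 / 2) ^ n))"
  proof (rule suminf_le)
    fix n
    have "(\<integral>\<^sup>+x. ennreal (2 ^ n * (D n x)\<^sup>2) \<partial>lborel)
        = ennreal (2 ^ n) * (\<integral>\<^sup>+x. ennreal ((D n x)\<^sup>2) \<partial>lborel)"
      by (subst nn_integral_cmult[symmetric]) (auto simp: ennreal_mult)
    also have "\<dots> = ennreal (2 ^ n * (norm (F (Suc n) - F n))\<^sup>2)"
      by (simp add: D_def nn_integral_norm_L2_diff ennreal_mult)
    also have "\<dots> \<le> ennreal ((1 / 2) ^ n)"
    proof (rule ennreal_leI)
      have "(norm (F (Suc n) - F n))\<^sup>2 \<le> ((1 / 2) ^ n)\<^sup>2"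
        using F by (intro power_mono) auto
      then have "2 ^ n * (norm (F (Suc n) - F n))\<^sup>2 \<le> 2 ^ n * ((1 / 2) ^ n)\<^sup>2" by simp
      also have "\<dots> = (1 / 2 :: real) ^ n"
        by (simp add: power2_eq_square power_divide)
      finally show "2 ^ n * (norm (F (Suc n) - F n))\<^sup>2 \<le> (1 / 2) ^ n" .
    qed
    finally show "(\<integral>\<^sup>+x. ennreal (2 ^ n * (D n x)\<^sup>2) \<partial>lborel) \<le> ennreal ((1 / 2) ^ n)" .
  qed auto
  also have "\<dots> < \<infinity>"
    by (subst suminf_ennreal2) (auto simp: summable_geometric)
  finally have "AE x in lborel. (\<Sum>n. ennreal (2 ^ n * (D n x)\<^sup>2)) \<noteq> \<infinity>"
    by (intro nn_integral_noteq_infinite) auto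
  then show ?thesis
  proof (rule AE_mp, intro AE_I2 impI)
    fix x assume "(\<Sum>n. ennreal (2 ^ n * (D n x)\<^sup>2)) \<noteq> \<infinity>"
    then have s: "summable (\<lambda>n. 2 ^ n * (D n x)\<^sup>2)"
      by (intro summable_suminf_not_top) (auto simp: top_ennreal_def infinity_ennreal_def)
    have D_le: "D n x \<le> 2 ^ n * (D n x)\<^sup>2 + (1 / 2) ^ n" for n
    proof -
      have "0 \<le> (2 ^ n * D n x - 1)\<^sup>2 + 2 ^ n * D n x"
        by (auto simp: D_def)
      then have "2 ^ n * D n x \<le> 2 ^ n * (2 ^ n * (D n x)\<^sup>2 + (1 / 2) ^ n)"
        by (simp add: power2_eq_square algebra_simps power_divide)
      then show ?thesis by simp
    qed
    have "summable (\<lambda>n. 2 ^ n * (D n x)\<^sup>2 + (1 / 2) ^ n)"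
      by (intro summable_add s summable_geometric) auto
    then have "summable (\<lambda>n. rep_L2 (F (Suc n)) x - rep_L2 (F n) x)"
      by (rule summable_comparison_test[rotated]) (use D_le in \<open>auto simp: D_def\<close>)
    then have "convergent (\<lambda>n. \<Sum>k<n. rep_L2 (F (Suc k)) x - rep_L2 (F k) x)"
      by (simp add: summable_iff_convergent)
    then have "convergent (\<lambda>n. rep_L2 (F n) x - rep_L2 (F 0) x)"
      by (simp add: sum_lessThan_telescope[of "\<lambda>n. rep_L2 (F n) x"])
    then show "convergent (\<lambda>n. rep_L2 (F n) x)"
      by (simp add: convergent_diff_const_right_iff)
  qed
qed

text \<open>Fatou's lemma, applied to the tails, yields both the square integrability of the
  pointwise limit and the rate at which \<open>F\<close> tends to it.\<close>

lemma L2_fast_Cauchy_convergent: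
  fixes F :: "nat \<Rightarrow> 'a::euclidean_space L2"
  assumes F: "\<And>n. norm (F (Suc n) - F n) \<le> (1 / 2) ^ n"
  shows "convergent F"
proof -
  define f where "f x = lim (\<lambda>n. rep_L2 (F n) x)" for x
  have [measurable]: "f \<in> borel_measurable borel" unfolding f_def by measurable
  have lim: "AE x in lborel. (\<lambda>n. rep_L2 (F n) x) \<longlonglongrightarrow> f x"
    using L2_fast_Cauchy_converges_AE[OF F] by (auto simp: f_def convergent_LIMSEQ_iff)
  have tail: "norm (F (m + k) - F m) \<le> 2 * (1 / 2) ^ m" for m k
  proof -
    have "norm (F (m + k) - F m) \<le> (2 - 2 * (1 / 2) ^ k) * (1 / 2) ^ m"
    proof (induction k)
      case (Suc k)
      have "norm (F (m + Suc k) - F m)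
          \<le> norm (F (Suc (m + k)) - F (m + k)) + norm (F (m + k) - F m)"
        using norm_triangle_ineq[of "F (Suc (m + k)) - F (m + k)" "F (m + k) - F m"] by simp
      also have "\<dots> \<le> (1 / 2) ^ (m + k) + (2 - 2 * (1 / 2) ^ k) * (1 / 2) ^ m"
        using Suc F by (intro add_mono) auto
      also have "\<dots> = (2 - 2 * (1 / 2) ^ Suc k) * (1 / 2) ^ m"
        by (simp add: algebra_simps power_add)
      finally show ?case .
    qed simp
    also have "\<dots> \<le> 2 * (1 / 2) ^ m" by (intro mult_right_mono) auto
    finally show ?thesis .
  qed
  have fatou: "(\<integral>\<^sup>+x. ennreal ((cmod (f x - rep_L2 (F m) x))\<^sup>2) \<partial>lborel)
      \<le> ennreal ((2 * (1 / 2) ^ m)\<^sup>2)" for m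
  proof -
    have "(\<integral>\<^sup>+x. ennreal ((cmod (f x - rep_L2 (F m) x))\<^sup>2) \<partial>lborel)
        = (\<integral>\<^sup>+x. liminf (\<lambda>k. ennreal ((cmod (rep_L2 (F (m + k)) x - rep_L2 (F m) x))\<^sup>2)) \<partial>lborel)"
    proof (rule nn_integral_cong_AE, use lim in \<open>rule AE_mp\<close>, intro AE_I2 impI)
      fix x assume l: "(\<lambda>n. rep_L2 (F n) x) \<longlonglongrightarrow> f x"
      have "(\<lambda>k. ennreal ((cmod (rep_L2 (F (m + k)) x - rep_L2 (F m) x))\<^sup>2))
          \<longlonglongrightarrow> ennreal ((cmod (f x - rep_L2 (F m) x))\<^sup>2)"
        by (intro tendsto_intros tendsto_ennrealI) (use LIMSEQ_ignore_initial_segment[OF l, of m]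
            in \<open>simp add: add.commute\<close>)
      then show "ennreal ((cmod (f x - rep_L2 (F m) x))\<^sup>2)
          = liminf (\<lambda>k. ennreal ((cmod (rep_L2 (F (m + k)) x - rep_L2 (F m) x))\<^sup>2))"
        by (rule lim_imp_Liminf[OF trivial_limit_sequentially, symmetric])
    qed
    also have "\<dots> \<le> liminf (\<lambda>k. \<integral>\<^sup>+x. ennreal ((cmod (rep_L2 (F (m + k)) x - rep_L2 (F m) x))\<^sup>2) \<partial>lborel)"
      by (rule nn_integral_liminf) auto
    also have "\<dots> = liminf (\<lambda>k. ennreal ((norm (F (m + k) - F m))\<^sup>2))"
      by (simp add: nn_integral_norm_L2_diff)
    also have "\<dots> \<le> liminf (\<lambda>k::nat. ennreal ((2 * (1 / 2) ^ m)\<^sup>2))"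
      by (intro Liminf_mono always_eventually allI ennreal_leI power_mono tail) auto
    finally show ?thesis by (simp add: Liminf_const)
  qed
  have sq: "square_integrable (\<lambda>x. f x - rep_L2 (F m) x)" for m
    unfolding square_integrable_def
    by (auto intro!: integrableI_nonneg le_less_trans[OF fatou])
  have "square_integrable (\<lambda>x. (f x - rep_L2 (F 0) x) + rep_L2 (F 0) x)"
    by (intro square_integrable_add sq square_integrable_rep)
  then have sqf: "square_integrable f" by simp
  have "norm (F m - abs_L2 f) \<le> 2 * (1 / 2) ^ m" for m
  proof -
    have "abs_L2 f - F m = abs_L2 (\<lambda>x. f x - rep_L2 (F m) x)"
      using abs_L2_diff[OF sqf square_integrable_rep, of "F m"] by (simp add: abs_rep_L2)
    then have "ennreal ((norm (abs_L2 f - F m))\<^sup>2)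
        = ennreal (LINT x|lborel. (cmod (f x - rep_L2 (F m) x))\<^sup>2)"
      using norm_abs_L2[OF sq] by simp
    also have "\<dots> = (\<integral>\<^sup>+x. ennreal ((cmod (f x - rep_L2 (F m) x))\<^sup>2) \<partial>lborel)"
      by (subst nn_integral_eq_integral) (use sq in \<open>auto simp: square_integrable_def\<close>)
    also note fatou
    finally have "(norm (abs_L2 f - F m))\<^sup>2 \<le> (2 * (1 / 2) ^ m)\<^sup>2"
      by (subst (asm) ennreal_le_iff) auto
    then have "norm (abs_L2 f - F m) \<le> 2 * (1 / 2) ^ m"
      by (rule power2_le_imp_le) auto
    then show ?thesis by (simp add: norm_minus_commute)
  qed
  then have bnd: "\<forall>\<^sub>F m in sequentially. norm (F m - abs_L2 f) \<le> 2 * (1 / 2) ^ m"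
    by (intro always_eventually allI)
  have "(\<lambda>m. 2 * (1 / 2) ^ m :: real) \<longlonglongrightarrow> 2 * 0"
    by (intro tendsto_mult tendsto_const LIMSEQ_power_zero) auto
  then have "(\<lambda>m. 2 * (1 / 2) ^ m :: real) \<longlonglongrightarrow> 0" by simp
  from Lim_null_comparison[OF bnd this] have "(\<lambda>m. F m - abs_L2 f) \<longlonglongrightarrow> 0" .
  then have "F \<longlonglongrightarrow> abs_L2 f" by (simp add: LIM_zero_iff)
  then show ?thesis by (rule convergentI)
qed

instance L2 :: (euclidean_space) complete_space
proof
  fix X :: "nat \<Rightarrow> 'a L2" assume X: "Cauchy X"
  then have "\<exists>N. \<forall>m\<ge>N. \<forall>n\<ge>N. dist (X m) (X n) < (1 / 2) ^ k" for k :: nat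
    unfolding Cauchy_def by simp
  then obtain N where N: "\<And>k m n. m \<ge> N k \<Longrightarrow> n \<ge> N k \<Longrightarrow> dist (X m) (X n) < (1 / 2) ^ k"
    by metis
  \<comment> \<open>The sum puts \<open>r k\<close> above \<open>N k\<close>, and the summand
    \<open>k\<close> makes \<open>r\<close> strictly increasing.\<close>
  define r where "r k = (\<Sum>i\<le>k. N i) + k" for k
  have r: "strict_mono r" by (auto simp: strict_mono_Suc_iff r_def)
  have rN: "r k \<ge> N k" for k
    unfolding r_def by (intro trans_le_add1 member_le_sum) auto
  have "norm (X (r (Suc k)) - X (r k)) \<le> (1 / 2) ^ k" for k
    using N[of k "r (Suc k)" "r k"] rN[of k] strict_mono_less_eq[OF r, of k "Suc k"]
    by (simp add: dist_norm less_imp_le)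
  then have "convergent (\<lambda>k. X (r k))" by (rule L2_fast_Cauchy_convergent)
  then obtain l where "(X \<circ> r) \<longlonglongrightarrow> l" by (auto simp: convergent_def comp_def)
  with X r have "X \<longlonglongrightarrow> l" by (rule Cauchy_converges_subseq)
  then show "convergent X" by (rule convergentI)
qed

instance L2 :: (euclidean_space) banach ..

section \<open>Functions supported in a domain\<close>

text \<open>This is the orthogonal projection of L2 of the whole space onto
  \<open>L2_on \<Omega>\<close>.\<close>

definition cutoff :: "'a::euclidean_space set \<Rightarrow> 'a L2 \<Rightarrow> 'a L2"
  where "cutoff \<Omega> f = abs_L2 (\<lambda>x. indicat_real \<Omega> x *\<^sub>R rep_L2 f x)"

lemma square_integrable_cutoff:
  "\<Omega> \<in> sets borel \<Longrightarrow> square_integrable (\<lambda>x. indicat_real \<Omega> x *\<^sub>R rep_L2 f x)"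
  by (rule square_integrable_bound[OF square_integrable_rep[of f]])
    (auto simp: indicator_def)

lemma rep_cutoff:
  "\<Omega> \<in> sets borel \<Longrightarrow> AE x in lborel. rep_L2 (cutoff \<Omega> f) x = indicat_real \<Omega> x *\<^sub>R rep_L2 f x"
  unfolding cutoff_def by (intro rep_abs_L2 square_integrable_cutoff)

lemma cutoff_in_L2_on: "\<Omega> \<in> sets borel \<Longrightarrow> cutoff \<Omega> f \<in> L2_on \<Omega>"
  using rep_cutoff[of \<Omega> f] by (auto simp: L2_on_def)

lemma inner_cutoff:
  assumes "\<Omega> \<in> sets borel"
  shows "g \<bullet> cutoff \<Omega> f = (LINT x|lborel. indicat_real \<Omega> x * (rep_L2 g x \<bullet> rep_L2 f x))"
  unfolding cutoff_def using assms by (subst inner_abs_L2) (auto simp: square_integrable_cutoff)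

lemma cutoff_id:
  assumes "\<Omega> \<in> sets borel" "f \<in> L2_on \<Omega>" shows "cutoff \<Omega> f = f"
  by (rule L2_eqI) (use rep_cutoff[OF assms(1), of f] assms(2) in \<open>auto simp: L2_on_def indicator_def\<close>)

lemma inner_cutoff_left:
  assumes "\<Omega> \<in> sets borel" "f \<in> L2_on \<Omega>" shows "cutoff \<Omega> g \<bullet> f = g \<bullet> f"
proof -
  have "cutoff \<Omega> g \<bullet> f = g \<bullet> cutoff \<Omega> f"
    by (simp add: inner_commute[of "cutoff \<Omega> g"] inner_cutoff[OF assms(1)])
      (simp add: inner_commute)
  then show ?thesis by (simp add: cutoff_id[OF assms])
qed

text \<open>Multiplication by an indicator is symmetric. Written as an intersection of kernels of
  continuous functionals, the space is visibly a closed subspace.\<close>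

lemma L2_on_eq_inner:
  assumes "\<Omega> \<in> sets borel"
  shows "L2_on \<Omega> = {f. \<forall>h. f \<bullet> (h - cutoff \<Omega> h) = 0}"
proof (intro equalityI subsetI)
  fix f assume "f \<in> L2_on \<Omega>"
  then show "f \<in> {f. \<forall>h. f \<bullet> (h - cutoff \<Omega> h) = 0}"
    using inner_cutoff_left[OF assms, of f]
    by (simp add: inner_diff_right inner_commute)
next
  fix f assume *: "f \<in> {f. \<forall>h. f \<bullet> (h - cutoff \<Omega> h) = 0}"
  have "(f - cutoff \<Omega> f) \<bullet> h = 0" for h
  proof -
    have "cutoff \<Omega> f \<bullet> h = f \<bullet> cutoff \<Omega> h"
      by (simp add: inner_commute[of "cutoff \<Omega> f"] inner_cutoff[OF assms])
        (simp add: inner_commute)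
    with * show ?thesis by (simp add: inner_diff_left inner_diff_right)
  qed
  then have "f - cutoff \<Omega> f = 0" using inner_eq_zero_iff by blast
  then show "f \<in> L2_on \<Omega>" using cutoff_in_L2_on[OF assms, of f] by simp
qed

lemma closed_L2_on: "\<Omega> \<in> sets borel \<Longrightarrow> closed (L2_on \<Omega>)"
  by (subst L2_on_eq_inner) (auto intro!: closed_Collect_all closed_Collect_eq continuous_intros)

lemma subspace_L2_on: "\<Omega> \<in> sets borel \<Longrightarrow> subspace (L2_on \<Omega>)"
  by (subst L2_on_eq_inner) (auto simp: subspace_def inner_add_left)

lemma abs_in_L2_on:
  assumes "square_integrable f" "\<And>x. x \<notin> \<Omega> \<Longrightarrow> f x = 0"
  shows "abs_L2 f \<in> L2_on \<Omega>"
  using rep_abs_L2[OF assms(1)] assms(2) by (auto simp: L2_on_def)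

section \<open>Test functions\<close>

lemma test_smooth: "\<phi> \<in> test_functions \<Omega> \<Longrightarrow> smooth \<phi>"
  by (auto simp: test_functions_def)

lemma test_support:
  assumes "\<phi> \<in> test_functions \<Omega>"
  shows "\<exists>K. compact K \<and> K \<subseteq> \<Omega> \<and> (\<forall>x. x \<notin> K \<longrightarrow> \<phi> x = 0)"
  using assms by (auto simp: test_functions_def)

lemma test_mono: "\<Omega> \<subseteq> \<Omega>' \<Longrightarrow> test_functions \<Omega> \<subseteq> test_functions \<Omega>'"
  by (auto simp: test_functions_def)

lemma test_eq_0: "\<phi> \<in> test_functions \<Omega> \<Longrightarrow> x \<notin> \<Omega> \<Longrightarrow> \<phi> x = 0"
  by (auto simp: test_functions_def)

lemma smooth_continuous_on: "smooth f \<Longrightarrow> continuous_on S f"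
  by (meson continuous_at_imp_continuous_on differentiable_imp_continuous_within smooth_differentiable)

lemma test_bounded:
  assumes "\<phi> \<in> test_functions \<Omega>"
  shows "\<exists>C. \<forall>x. cmod (\<phi> x) \<le> C"
proof -
  obtain K where K: "compact K" "\<And>x. x \<notin> K \<Longrightarrow> \<phi> x = 0"
    using test_support[OF assms] by blast
  have "compact (\<phi> ` K)"
    by (intro compact_continuous_image smooth_continuous_on test_smooth[OF assms] K(1))
  then obtain C where C: "\<And>x. x \<in> K \<Longrightarrow> cmod (\<phi> x) \<le> C" "C > 0"
    by (metis bounded_pos compact_imp_bounded imageI)
  have "cmod (\<phi> x) \<le> C" for x
    using C K(2)[of x] by (cases "x \<in> K") auto
  then show ?thesis by blast
qed

lemma test_measurable:
  "\<phi> \<in> test_functions \<Omega> \<Longrightarrow> \<phi> \<in> borel_measurable borel"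
  by (intro borel_measurable_continuous_onI smooth_continuous_on test_smooth)

lemma square_integrable_indicator:
  assumes "K \<in> sets borel" "emeasure lborel K < \<infinity>"
  shows "square_integrable (\<lambda>x. complex_of_real (C * indicat_real K x))"
proof -
  have "(\<lambda>x. (cmod (complex_of_real (C * indicat_real K x)))\<^sup>2) = (\<lambda>x. C\<^sup>2 * indicat_real K x)"
    by (auto simp: indicator_def power2_eq_square)
  then show ?thesis
    using assms by (auto simp: square_integrable_def)
qed

lemma test_square_integrable:
  assumes "\<phi> \<in> test_functions \<Omega>" shows "square_integrable \<phi>"
proof -
  obtain K where K: "compact K" "\<And>x. x \<notin> K \<Longrightarrow> \<phi> x = 0"
    using test_support[OF assms] by blast
  obtain C where C: "\<And>x. cmod (\<phi> x) \<le> C" using test_bounded[OF assms] by blast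
  have "square_integrable (\<lambda>x. complex_of_real (C * indicat_real K x))"
    using K(1) emeasure_bounded_finite[OF compact_imp_bounded[OF K(1)]]
    by (intro square_integrable_indicator) (auto intro: borel_compact)
  then show ?thesis
  proof (rule square_integrable_bound)
    show "cmod (\<phi> x) \<le> cmod (complex_of_real (C * indicat_real K x))" for x
      using C[of x] K(2)[of x] by (auto simp: indicator_def)
  qed (rule test_measurable[OF assms])
qed

lemma test_integrable:
  assumes "\<phi> \<in> test_functions \<Omega>" shows "integrable lborel \<phi>"
proof -
  obtain K where K: "compact K" "\<And>x. x \<notin> K \<Longrightarrow> \<phi> x = 0"
    using test_support[OF assms] by blast
  obtain C where C: "\<And>x. cmod (\<phi> x) \<le> C" using test_bounded[OF assms] by blast
  show ?thesis
  proof (rule Bochner_Integration.integrable_bound)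
    show "integrable lborel (\<lambda>x. C * indicat_real K x)"
      using K(1) by (intro integrable_mult_right integrable_real_indicator emeasure_bounded_finite)
        (auto intro: borel_compact compact_imp_bounded)
    show "AE x in lborel. norm (\<phi> x) \<le> norm (C * indicat_real K x)"
    proof (intro AE_I2)
      show "norm (\<phi> x) \<le> norm (C * indicat_real K x)" for x
        using C[of x] K(2)[of x] by (auto simp: indicator_def)
    qed
  qed (use test_measurable[OF assms] in simp)
qed

lemma frechet_derivative_eq_0_off_support:
  assumes "compact K" "\<And>x. x \<notin> K \<Longrightarrow> f x = 0" "x \<notin> K"
  shows "frechet_derivative f (at x) b = 0"
proof -
  have "open (- K)" using assms(1) by (simp add: compact_imp_closed open_Compl)
  then have "(f has_derivative (\<lambda>_. 0)) (at x)"
    by (rule has_derivative_transform_within_open[OF has_derivative_const[of 0]])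
      (use assms in auto)
  then show ?thesis by (rule frechet_derivative_at_eq)
qed

lemma test_partials:
  assumes "\<phi> \<in> test_functions \<Omega>" "set bs \<subseteq> Basis"
  shows "partials bs \<phi> \<in> test_functions \<Omega>"
proof -
  obtain K where K: "compact K" "K \<subseteq> \<Omega>" "\<And>x. x \<notin> K \<Longrightarrow> \<phi> x = 0"
    using test_support[OF assms(1)] by blast
  have "\<forall>x. x \<notin> K \<longrightarrow> partials bs \<phi> x = 0"
    by (induction bs) (auto simp: K frechet_derivative_eq_0_off_support[OF K(1)])
  then show ?thesis
    using K smooth_partials[OF test_smooth[OF assms(1)] assms(2)]
    unfolding test_functions_def by blast
qed

lemma test_bounded_linear:
  assumes "bounded_linear T" "\<phi> \<in> test_functions \<Omega>"
  shows "(\<lambda>x. T (\<phi> x)) \<in> test_functions \<Omega>"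
proof -
  obtain K where K: "compact K" "K \<subseteq> \<Omega>" "\<And>x. x \<notin> K \<Longrightarrow> \<phi> x = 0"
    using test_support[OF assms(2)] by blast
  then show ?thesis
    using smooth_bounded_linear[OF assms(1) test_smooth[OF assms(2)]]
      linear_0[OF bounded_linear.linear[OF assms(1)]]
    unfolding test_functions_def by auto
qed

lemma test_mult:
  assumes "\<phi> \<in> test_functions \<Omega>" "smooth \<psi>"
  shows "(\<lambda>x. \<phi> x * \<psi> x) \<in> test_functions \<Omega>"
proof -
  obtain K where K: "compact K" "K \<subseteq> \<Omega>" "\<And>x. x \<notin> K \<Longrightarrow> \<phi> x = 0"
    using test_support[OF assms(1)] by blast
  then show ?thesis
    using smooth_mult[OF test_smooth[OF assms(1)] assms(2)]
    unfolding test_functions_def by auto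
qed

lemma test_add:
  assumes "\<phi> \<in> test_functions \<Omega>" "\<psi> \<in> test_functions \<Omega>"
  shows "(\<lambda>x. \<phi> x + \<psi> x) \<in> test_functions \<Omega>"
proof -
  obtain K L where K: "compact K" "K \<subseteq> \<Omega>" "\<And>x. x \<notin> K \<Longrightarrow> \<phi> x = 0"
    and L: "compact L" "L \<subseteq> \<Omega>" "\<And>x. x \<notin> L \<Longrightarrow> \<psi> x = 0"
    using assms by (metis test_support)
  then have "compact (K \<union> L)" "K \<union> L \<subseteq> \<Omega>" "\<forall>x. x \<notin> K \<union> L \<longrightarrow> \<phi> x + \<psi> x = 0"
    by (auto intro: compact_Un)
  then show ?thesis
    using smooth_add[OF test_smooth[OF assms(1)] test_smooth[OF assms(2)]]
    unfolding test_functions_def by blast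
qed

lemma test_bump:
  assumes "cbox l u \<subseteq> \<Omega>" "k > 0"
  shows "(\<lambda>x. z * complex_of_real (bump k l u x)) \<in> test_functions \<Omega>"
proof -
  have "smooth (\<lambda>x. z * complex_of_real (bump k l u x))"
    by (intro smooth_bounded_linear[OF _ smooth_bump] bounded_linear_mult_right[THEN bounded_linear_compose]
        bounded_linear_of_real)
  moreover have "bump k l u x = 0" if "x \<notin> cbox l u" for x
    using that box_subset_cbox by (intro bump_eq_0[OF assms(2)]) auto
  ultimately show ?thesis
    using assms(1) unfolding test_functions_def by (auto intro!: exI[of _ "cbox l u"])
qed

lemma abs_test_in_L2_on: "\<phi> \<in> test_functions \<Omega> \<Longrightarrow> abs_L2 \<phi> \<in> L2_on \<Omega>"
  by (intro abs_in_L2_on test_square_integrable) (auto simp: test_eq_0)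

lemma inner_abs_test:
  "\<phi> \<in> test_functions \<Omega> \<Longrightarrow> f \<bullet> abs_L2 \<phi> = (LINT x|lborel. rep_L2 f x \<bullet> \<phi> x)"
  by (intro inner_abs_L2 test_square_integrable)

subsection \<open>The fundamental lemma of the calculus of variations\<close>

text \<open>On a set of finite measure L2 embeds in L1, here through s <= s^2 + 1. The function
  dominates in the next lemma.\<close>

lemma integrable_norm_rep_on_box:
  "integrable lborel (\<lambda>x. cmod (rep_L2 g x) * indicat_real (box l u) x)"
proof (rule Bochner_Integration.integrable_bound)
  show "integrable lborel (\<lambda>x. (cmod (rep_L2 g x))\<^sup>2 + indicat_real (box l u) x)"
    by (intro Bochner_Integration.integrable_add integrable_L2 integrable_real_indicator
        emeasure_bounded_finite) auto
  show "AE x in lborel. norm (cmod (rep_L2 g x) * indicat_real (box l u) x)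
      \<le> norm ((cmod (rep_L2 g x))\<^sup>2 + indicat_real (box l u) x)"
  proof (intro AE_I2)
    fix x
    have "0 \<le> (cmod (rep_L2 g x) - 1 / 2)\<^sup>2 + 3 / 4" by simp
    then have "cmod (rep_L2 g x) \<le> (cmod (rep_L2 g x))\<^sup>2 + 1"
      by (simp add: power2_eq_square algebra_simps)
    then show "norm (cmod (rep_L2 g x) * indicat_real (box l u) x)
      \<le> norm ((cmod (rep_L2 g x))\<^sup>2 + indicat_real (box l u) x)"
      by (simp add: indicator_def)
  qed
qed auto

text \<open>Bumps tend to the indicator of the open box, and dominated convergence carries the
  orthogonality over. The inner product is only a real part; the bumps are therefore rotated by a
  unit \<open>z\<close>, and the values 1 and \<open>\<i>\<close> recover both components of the
  integral.\<close>

lemma integral_box_eq_0: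
  assumes "\<And>\<phi>. \<phi> \<in> test_functions \<Omega> \<Longrightarrow> g \<bullet> abs_L2 \<phi> = 0" "cbox l u \<subseteq> \<Omega>"
  shows "(LINT x|lborel. indicat_real (box l u) x *\<^sub>R rep_L2 g x) = 0"
proof -
  let ?I = "\<lambda>x. indicat_real (box l u) x *\<^sub>R rep_L2 g x"
  have i: "integrable lborel (\<lambda>x. cmod (rep_L2 g x) * indicat_real (box l u) x)"
    by (rule integrable_norm_rep_on_box)
  have int: "integrable lborel ?I"
    by (rule Bochner_Integration.integrable_bound[OF i]) (auto simp: mult.commute)
  have [measurable]: "bump k l u \<in> borel_measurable borel" for k
    by (intro borel_measurable_continuous_onI smooth_continuous_on smooth_bump)
  have z: "(LINT x|lborel. ?I x \<bullet> z) = 0" if z: "cmod z = 1" for z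
  proof -
    have "(\<lambda>n. LINT x|lborel. rep_L2 g x \<bullet> (z * complex_of_real (bump (real (Suc n)) l u x)))
        \<longlonglongrightarrow> (LINT x|lborel. ?I x \<bullet> z)"
    proof (rule integral_dominated_convergence[OF _ _ i])
      show "(\<lambda>x. ?I x \<bullet> z) \<in> borel_measurable lborel" by measurable
      show "(\<lambda>x. rep_L2 g x \<bullet> (z * complex_of_real (bump (real (Suc n)) l u x)))
          \<in> borel_measurable lborel" for n
        by measurable
      show "AE x in lborel. (\<lambda>n. rep_L2 g x \<bullet> (z * complex_of_real (bump (real (Suc n)) l u x)))
          \<longlonglongrightarrow> ?I x \<bullet> z"
      proof (intro AE_I2)
        fix x
        have "(\<lambda>n. rep_L2 g x \<bullet> (z * complex_of_real (bump (real (Suc n)) l u x)))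
          \<longlonglongrightarrow> rep_L2 g x \<bullet> (z * complex_of_real (indicat_real (box l u) x))"
          by (intro tendsto_intros bump_tendsto)
        then show "(\<lambda>n. rep_L2 g x \<bullet> (z * complex_of_real (bump (real (Suc n)) l u x)))
          \<longlonglongrightarrow> ?I x \<bullet> z"
          by (auto simp: indicator_def split: if_splits)
      qed
      show "AE x in lborel. norm (rep_L2 g x \<bullet> (z * complex_of_real (bump (real (Suc n)) l u x)))
          \<le> cmod (rep_L2 g x) * indicat_real (box l u) x" for n
      proof (intro AE_I2)
        fix x
        have "norm (rep_L2 g x \<bullet> (z * complex_of_real (bump (real (Suc n)) l u x)))
            \<le> cmod (rep_L2 g x) * cmod (z * complex_of_real (bump (real (Suc n)) l u x))"
          unfolding real_norm_def by (rule Cauchy_Schwarz_ineq2)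
        also have "\<dots> \<le> cmod (rep_L2 g x) * indicat_real (box l u) x"
          using z bump_nonneg[of "real (Suc n)" l u x] bump_le_1[of "real (Suc n)" l u x]
            bump_eq_0[of "real (Suc n)" x l u]
          by (intro mult_left_mono) (auto simp: norm_mult indicator_def simp del: of_nat_Suc)
        finally show "norm (rep_L2 g x \<bullet> (z * complex_of_real (bump (real (Suc n)) l u x)))
          \<le> cmod (rep_L2 g x) * indicat_real (box l u) x" .
      qed
    qed
    moreover have "(LINT x|lborel. rep_L2 g x \<bullet> (z * complex_of_real (bump (real (Suc n)) l u x))) = 0" for n
    proof -
      have t: "(\<lambda>x. z * complex_of_real (bump (real (Suc n)) l u x)) \<in> test_functions \<Omega>"
        by (intro test_bump assms) simp
      then show ?thesis using assms(1)[OF t] inner_abs_test[OF t] by simp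
    qed
    ultimately show ?thesis by (simp add: LIMSEQ_const_iff)
  qed
  have "(LINT x|lborel. ?I x) \<bullet> z = 0" if "cmod z = 1" for z
    using z[OF that] integral_inner_left[OF int, of z] by simp
  from this[of 1] this[of \<i>] show ?thesis
    by (simp add: inner_complex_def complex_eq_iff)
qed

text \<open>Open boxes form an intersection-stable generator of the Borel sets, so the vanishing of
  the integral spreads from boxes to all Borel sets; a density all of whose integrals vanish is
  null.\<close>

lemma AE_eq_0_on_box:
  assumes "\<And>\<phi>. \<phi> \<in> test_functions \<Omega> \<Longrightarrow> g \<bullet> abs_L2 \<phi> = 0" "cbox l u \<subseteq> \<Omega>"
  shows "AE x in lborel. x \<in> box l u \<longrightarrow> rep_L2 g x = 0"
proof -
  let ?I = "\<lambda>x. indicat_real (box l u) x *\<^sub>R rep_L2 g x"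
  have int: "integrable lborel ?I"
    by (rule Bochner_Integration.integrable_bound[OF integrable_norm_rep_on_box[of g l u]])
      (auto simp: mult.commute)
  have seti: "set_integrable lborel A ?I" if "A \<in> sets borel" for A
    using integrable_mult_indicator[OF _ int, of A] that by (simp add: set_integrable_def)
  have "(LINT x:A|lborel. ?I x) = 0" if "A \<in> sets lborel" for A
  proof -
    have "Int_stable (range (\<lambda>(a, b). box a b :: 'a set))"
      by (auto simp: Int_stable_def box_Int_box)
    moreover have "range (\<lambda>(a, b). box a b) \<subseteq> Pow (UNIV :: 'a set)" by auto
    moreover have "A \<in> sigma_sets UNIV (range (\<lambda>(a, b). box a b))"
      using that by (simp add: borel_eq_box)
    ultimately show ?thesis
    proof (induction rule: sigma_sets_induct_disjoint)
      case (basic A)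
      then obtain p q where A: "A = box p q" by auto
      obtain l' u' where lu': "box p q \<inter> box l u = box l' u'" by (simp add: box_Int_box)
      have "(LINT x|lborel. indicat_real (box l' u') x *\<^sub>R rep_L2 g x) = 0"
      \<comment> \<open>For an empty open box the closed box with the same corners need not be its
        closure, so the inclusion in \<open>cbox l u\<close> is derived in the nonempty
        case.\<close>
      proof (cases "box l' u' = {}")
        case False
        then have "cbox l' u' = closure (box l' u')" by simp
        also have "\<dots> \<subseteq> closure (box l u)" using lu' by (intro closure_mono) auto
        also have "\<dots> \<subseteq> cbox l u" by (intro closure_minimal box_subset_cbox closed_cbox)
        finally have "cbox l' u' \<subseteq> cbox l u" .
        then show ?thesis using assms by (intro integral_box_eq_0[of \<Omega>]) auto
      qed simp
      then show ?case
        unfolding A set_lebesgue_integral_def lu'[symmetric]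
        by (simp add: indicator_inter_arith)
    next
      case empty
      then show ?case by (simp add: set_lebesgue_integral_def)
    next
      case (compl A)
      then have A: "A \<in> sets borel" by (simp add: borel_eq_box)
      have "(LINT x|lborel. ?I x) = (LINT x:A|lborel. ?I x) + (LINT x:UNIV - A|lborel. ?I x)"
        using set_integral_Un[of A "UNIV - A" lborel ?I] seti A
        by (auto simp: set_lebesgue_integral_def[of _ UNIV])
      then show ?case
        using compl integral_box_eq_0[OF assms] by simp
    next
      case (union A)
      then have A: "A i \<in> sets borel" for i by (auto simp: borel_eq_box)
      have "(LINT x:(\<Union>i. A i)|lborel. ?I x) = (\<Sum>i. LINT x:A i|lborel. ?I x)"
        using union(1) A by (intro lebesgue_integral_countable_add seti)
          (auto simp: disjoint_family_on_def)
      then show ?case using union by simp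
    qed
  qed
  from sigma_finite_measure.density_zero[OF sigma_finite_lborel int this] show ?thesis
    by (auto simp: indicator_def)
qed

text \<open>Each box contributes an exceptional null set; the Lindelof property leaves countably
  many boxes, so the union of these sets is still null.\<close>

lemma L2_on_eq_0I:
  assumes "open \<Omega>" "g \<in> L2_on \<Omega>"
    and "\<And>\<phi>. \<phi> \<in> test_functions \<Omega> \<Longrightarrow> g \<bullet> abs_L2 \<phi> = 0"
  shows "g = 0"
proof -
  define B where "B = {box l u | l u. cbox l u \<subseteq> \<Omega>}"
  have "\<And>S. S \<in> B \<Longrightarrow> open S" by (auto simp: B_def)
  then obtain B' where B': "B' \<subseteq> B" "countable B'" "\<Union>B' = \<Union>B" by (rule Lindelof)
  have "\<Omega> \<subseteq> \<Union>B"
  proof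
    fix x assume "x \<in> \<Omega>"
    with assms(1) obtain l u where "cbox l u \<subseteq> \<Omega>" "x \<in> box l u"
      by (rule open_contains_cbox)
    then show "x \<in> \<Union>B" by (auto simp: B_def)
  qed
  have "AE x in lborel. \<forall>U\<in>B'. x \<in> U \<longrightarrow> rep_L2 g x = 0"
    using B' AE_eq_0_on_box[OF assms(3)]
    by (subst AE_ball_countable) (auto simp: B_def)
  moreover have "AE x in lborel. x \<notin> \<Omega> \<longrightarrow> rep_L2 g x = 0"
    using assms(2) by (simp add: L2_on_def)
  ultimately have "AE x in lborel. rep_L2 g x = 0"
    by eventually_elim (use \<open>\<Omega> \<subseteq> \<Union>B\<close> B'(3) in blast)
  moreover have "AE x in lborel. rep_L2 (0 :: 'a L2) x = 0"
    using rep_abs_L2[OF square_integrable_0] by (simp add: zero_L2_def)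
  ultimately show ?thesis by (intro L2_eqI) auto
qed

subsection \<open>Integration by parts\<close>

text \<open>Difference quotients have integral zero by translation invariance of Lebesgue measure,
  and they converge to the derivative under a common dominating function. This replaces Fubini's
  theorem and the fundamental theorem of calculus.\<close>

lemma integral_frechet_derivative_test:
  fixes \<phi> :: "'a::euclidean_space \<Rightarrow> complex"
  assumes \<phi>: "\<phi> \<in> test_functions UNIV" and b: "b \<in> Basis"
  shows "(LINT x|lborel. frechet_derivative \<phi> (at x) b) = 0"
proof -
  define D where "D x = frechet_derivative \<phi> (at x) b" for x
  have D: "D \<in> test_functions UNIV"
    using test_partials[OF \<phi>, of "[b]"] b by (simp add: D_def[abs_def])
  obtain C where C: "\<And>x. cmod (D x) \<le> C" using test_bounded[OF D] by blast
  obtain K where K: "compact K" "\<And>x. x \<notin> K \<Longrightarrow> \<phi> x = 0"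
    using test_support[OF \<phi>] by blast
  obtain R where R: "\<And>x. x \<in> K \<Longrightarrow> norm x \<le> R"
    using compact_imp_bounded[OF K(1)] by (auto simp: bounded_iff)
  have C0: "0 \<le> C" using order_trans[OF norm_ge_zero C] .
  have line: "((\<lambda>t. \<phi> (x + t *\<^sub>R b)) has_vector_derivative D (x + t *\<^sub>R b)) (at t)" for x t
  proof -
    have "((\<lambda>t. x + t *\<^sub>R b) has_derivative (\<lambda>s. s *\<^sub>R b)) (at t)"
      by (auto intro!: derivative_eq_intros)
    from has_derivative_compose[OF this smooth_has_derivative[OF test_smooth[OF \<phi>]]]
    show ?thesis
      using linear_frechet_derivative[OF smooth_differentiable[OF test_smooth[OF \<phi>]], of "x + t *\<^sub>R b"]
      by (simp add: has_vector_derivative_def D_def linear_scale)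
  qed
  define q where "q n x = real (Suc n) *\<^sub>R (\<phi> (inverse (real (Suc n)) *\<^sub>R b + x) - \<phi> x)" for n x
  have [measurable]: "\<phi> \<in> borel_measurable borel" "D \<in> borel_measurable borel"
    using \<phi> D by (auto intro: test_measurable)
  have "(\<lambda>n. LINT x|lborel. q n x) \<longlonglongrightarrow> (LINT x|lborel. D x)"
  \<comment> \<open>The steps 1 / (n + 1) are at most 1, so all quotients vanish off the ball of
    radius \<open>R + 1\<close>; the mean value estimate bounds them by \<open>C\<close>.\<close>
  proof (rule integral_dominated_convergence[where w = "\<lambda>x. C * indicat_real (cball 0 (R + 1)) x"])
    show "D \<in> borel_measurable lborel" "q n \<in> borel_measurable lborel" for n
      unfolding q_def by measurable
    show "integrable lborel (\<lambda>x. C * indicat_real (cball 0 (R + 1)) x)"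
      by (intro integrable_mult_right integrable_real_indicator emeasure_bounded_finite) auto
    show "AE x in lborel. (\<lambda>n. q n x) \<longlonglongrightarrow> D x"
    proof (intro AE_I2)
      fix x
      let ?h = "\<lambda>n. inverse (real (Suc n))"
      have "((\<lambda>h. norm (\<phi> (x + h *\<^sub>R b) - \<phi> x - h *\<^sub>R D x) / norm h) \<longlongrightarrow> 0) (at 0)"
        using line[of x 0] by (simp add: has_vector_derivative_def has_derivative_at)
      moreover have "filterlim ?h (at 0) sequentially"
        unfolding filterlim_at using LIMSEQ_inverse_real_of_nat by simp
      ultimately have "(\<lambda>n. norm (\<phi> (x + ?h n *\<^sub>R b) - \<phi> x - ?h n *\<^sub>R D x) / norm (?h n)) \<longlonglongrightarrow> 0"
        by (rule filterlim_compose)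
      moreover have "norm (\<phi> (x + ?h n *\<^sub>R b) - \<phi> x - ?h n *\<^sub>R D x) / norm (?h n) = norm (q n x - D x)" for n
      proof -
        have "q n x - D x = real (Suc n) *\<^sub>R (\<phi> (x + ?h n *\<^sub>R b) - \<phi> x - ?h n *\<^sub>R D x)"
          by (simp add: q_def add.commute scaleR_diff_right)
        then show ?thesis by (simp add: divide_inverse mult.commute del: of_nat_Suc)
      qed
      ultimately have "(\<lambda>n. norm (q n x - D x)) \<longlonglongrightarrow> 0" by simp
      then show "(\<lambda>n. q n x) \<longlonglongrightarrow> D x"
        using LIM_zero_iff tendsto_norm_zero_iff by blast
    qed
    show "AE x in lborel. norm (q n x) \<le> C * indicat_real (cball 0 (R + 1)) x" for n
    proof (intro AE_I2)
      fix x
      define h where "h = inverse (real (Suc n))"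
      have h: "0 < h" "h \<le> 1" by (auto simp: h_def inverse_le_1_iff)
      show "norm (q n x) \<le> C * indicat_real (cball 0 (R + 1)) x"
      proof (cases "x \<in> cball 0 (R + 1)")
        case True
        have "norm (\<phi> (x + h *\<^sub>R b) - \<phi> (x + 0 *\<^sub>R b)) \<le> C * norm (h - 0)"
        proof (rule differentiable_bound[where S = UNIV and f' = "\<lambda>t s. s *\<^sub>R D (x + t *\<^sub>R b)"])
          show "((\<lambda>t. \<phi> (x + t *\<^sub>R b)) has_derivative (\<lambda>s. s *\<^sub>R D (x + t *\<^sub>R b))) (at t within UNIV)" for t
            using line[of x t] by (simp add: has_vector_derivative_def)
          show "onorm (\<lambda>s. s *\<^sub>R D (x + t *\<^sub>R b)) \<le> C" for t
          proof (rule onorm_le)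
            show "norm (s *\<^sub>R D (x + t *\<^sub>R b)) \<le> C * norm s" for s :: real
              using C[of "x + t *\<^sub>R b"] by (simp add: mult.commute[of C] mult_left_mono)
          qed
        qed auto
        then have "norm (\<phi> (h *\<^sub>R b + x) - \<phi> x) / h \<le> C"
          using h by (simp add: pos_divide_le_eq add.commute)
        moreover have "norm (q n x) = norm (\<phi> (h *\<^sub>R b + x) - \<phi> x) / h"
          by (simp add: q_def h_def divide_inverse)
        ultimately show ?thesis using True by simp
      next
        case False
        then have "norm x > R + 1" by simp
        moreover have "norm (h *\<^sub>R b + x) \<ge> norm x - norm (h *\<^sub>R b)"
          using norm_triangle_ineq2[of x "- (h *\<^sub>R b)"] by (simp add: add.commute)
        moreover have "norm (h *\<^sub>R b) \<le> 1" using h b by simp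
        ultimately have "x \<notin> K" "h *\<^sub>R b + x \<notin> K" using R by fastforce+
        then show ?thesis
            using K(2)[of x] K(2)[of "h *\<^sub>R b + x"] False by (simp add: q_def h_def)
      qed
    qed
  qed
  moreover have "(LINT x|lborel. q n x) = 0" for n
  proof -
    let ?c = "inverse (real (Suc n)) *\<^sub>R b"
    have tr: "(LINT x|lborel. \<phi> (?c + x)) = (LINT x|lborel. \<phi> x)"
      by (subst (2) lborel_distr_plus[of ?c, symmetric], subst integral_distr) auto
    have "integrable (distr lborel borel ((+) ?c)) \<phi>"
      using test_integrable[OF \<phi>] by (simp add: lborel_distr_plus)
    then have "integrable lborel (\<lambda>x. \<phi> (?c + x))"
      by (subst (asm) integrable_distr_eq) auto
    then show ?thesis using tr test_integrable[OF \<phi>] by (simp add: q_def)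
  qed
  ultimately show ?thesis by (simp add: D_def LIMSEQ_const_iff)
qed

lemma integral_by_parts_test:
  assumes \<phi>: "\<phi> \<in> test_functions UNIV" and \<psi>: "\<psi> \<in> test_functions UNIV" and b: "b \<in> Basis"
  shows "(LINT x|lborel. \<phi> x * frechet_derivative \<psi> (at x) b)
    = - (LINT x|lborel. frechet_derivative \<phi> (at x) b * \<psi> x)"
proof -
  have D: "(\<lambda>x. frechet_derivative f (at x) b) \<in> test_functions UNIV"
    if "f \<in> test_functions UNIV" for f :: "'a \<Rightarrow> complex"
    using test_partials[OF that, of "[b]"] b by simp
  have "frechet_derivative (\<lambda>x. \<phi> x * \<psi> x) (at x) b
      = \<phi> x * frechet_derivative \<psi> (at x) b + frechet_derivative \<phi> (at x) b * \<psi> x" for x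
    by (intro frechet_derivative_at_eq has_derivative_mult smooth_has_derivative test_smooth[OF \<phi>]
        test_smooth[OF \<psi>])
  then have "(LINT x|lborel. \<phi> x * frechet_derivative \<psi> (at x) b + frechet_derivative \<phi> (at x) b * \<psi> x) = 0"
    using integral_frechet_derivative_test[OF test_mult[OF \<phi> test_smooth[OF \<psi>]] b] by simp
  moreover have "integrable lborel (\<lambda>x. \<phi> x * frechet_derivative \<psi> (at x) b)"
      "integrable lborel (\<lambda>x. frechet_derivative \<phi> (at x) b * \<psi> x)"
    by (intro test_integrable[of _ UNIV] test_mult[OF \<phi>] test_mult[OF D[OF \<phi>]]
        test_smooth[OF \<psi>] test_smooth[OF D[OF \<psi>]])+
  ultimately show ?thesis by (simp add: eq_neg_iff_add_eq_0)
qed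

section \<open>Weak derivatives\<close>

text \<open>\<open>is_weak_deriv\<close> uses the bilinear pairing; complex conjugation of the test function
  turns it into the real inner product, and a rotation by \<open>\<i>\<close> recovers the imaginary part.\<close>

lemma set_integral_mult_test:
  assumes "\<psi> \<in> test_functions \<Omega>"
  shows "(LINT x:\<Omega>|lborel. rep_L2 u x * \<psi> x)
    = Complex (u \<bullet> abs_L2 (\<lambda>x. cnj (\<psi> x))) (u \<bullet> abs_L2 (\<lambda>x. \<i> * cnj (\<psi> x)))"
proof -
  have c: "(\<lambda>x. cnj (\<psi> x)) \<in> test_functions \<Omega>"
    by (rule test_bounded_linear[OF bounded_linear_cnj assms])
  then have ic: "(\<lambda>x. \<i> * cnj (\<psi> x)) \<in> test_functions \<Omega>"
    by (rule test_bounded_linear[OF bounded_linear_mult_right])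
  have eq: "indicat_real \<Omega> x *\<^sub>R (rep_L2 u x * \<psi> x) = rep_L2 u x * \<psi> x" for x
    using test_eq_0[OF assms] by (auto simp: indicator_def)
  have re: "Re (rep_L2 u x * \<psi> x) = rep_L2 u x \<bullet> cnj (\<psi> x)"
    and im: "Im (rep_L2 u x * \<psi> x) = rep_L2 u x \<bullet> (\<i> * cnj (\<psi> x))" for x
    by (simp_all add: inner_complex_def)
  have int: "integrable lborel (\<lambda>x. rep_L2 u x * \<psi> x)"
  proof -
    have "integrable lborel (\<lambda>x. complex_of_real (rep_L2 u x \<bullet> cnj (\<psi> x))
        + \<i> * complex_of_real (rep_L2 u x \<bullet> (\<i> * cnj (\<psi> x))))"
      by (intro Bochner_Integration.integrable_add integrable_mult_right integrable_of_real
          integrable_inner_square_integrable square_integrable_rep test_square_integrable[OF c]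
          test_square_integrable[OF ic])
    moreover have "complex_of_real (rep_L2 u x \<bullet> cnj (\<psi> x))
        + \<i> * complex_of_real (rep_L2 u x \<bullet> (\<i> * cnj (\<psi> x))) = rep_L2 u x * \<psi> x" for x
      unfolding re[symmetric] im[symmetric] by (simp add: complex_eq_iff)
    ultimately show ?thesis by simp
  qed
  have "(LINT x|lborel. rep_L2 u x * \<psi> x)
      = Complex (LINT x|lborel. Re (rep_L2 u x * \<psi> x)) (LINT x|lborel. Im (rep_L2 u x * \<psi> x))"
    by (simp only: integral_Re[OF int] integral_Im[OF int] complex.collapse)
  then show ?thesis
    unfolding set_lebesgue_integral_def eq inner_abs_test[OF c] inner_abs_test[OF ic] re im .
qed

lemma is_weak_deriv_iff_inner:
  assumes bs: "set bs \<subseteq> Basis"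
  shows "is_weak_deriv \<Omega> bs u g \<longleftrightarrow> g \<in> L2_on \<Omega> \<and>
    (\<forall>\<phi>\<in>test_functions \<Omega>. u \<bullet> abs_L2 (partials bs \<phi>) = (- 1) ^ length bs * (g \<bullet> abs_L2 \<phi>))"
    (is "_ \<longleftrightarrow> _ \<and> ?R")
proof -
  have s: "(- 1) ^ length bs * Complex a b = Complex ((- 1) ^ length bs * a) ((- 1) ^ length bs * b)" for a b
    by (cases "even (length bs)") (auto simp: complex_eq_iff)
  have cnj: "(\<lambda>x. cnj (\<phi> x)) \<in> test_functions \<Omega>" if "\<phi> \<in> test_functions \<Omega>" for \<phi>
    using that by (rule test_bounded_linear[OF bounded_linear_cnj])
  have icnj: "(\<lambda>x. \<i> * cnj (\<phi> x)) \<in> test_functions \<Omega>" if "\<phi> \<in> test_functions \<Omega>" for \<phi>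
    using cnj[OF that] by (rule test_bounded_linear[OF bounded_linear_mult_right])
  have pc: "(\<lambda>x. cnj (partials bs \<phi> x)) = partials bs (\<lambda>x. cnj (\<phi> x))" if "\<phi> \<in> test_functions \<Omega>" for \<phi>
    using partials_bounded_linear[OF bounded_linear_cnj test_smooth[OF that] bs] by simp
  have pic: "(\<lambda>x. \<i> * cnj (partials bs \<phi> x)) = partials bs (\<lambda>x. \<i> * cnj (\<phi> x))" if "\<phi> \<in> test_functions \<Omega>" for \<phi>
    using partials_bounded_linear[OF bounded_linear_mult_right[of \<i>] test_smooth[OF cnj[OF that]] bs]
      pc[OF that] by (simp add: fun_eq_iff)
  have "(\<forall>\<phi>\<in>test_functions \<Omega>.
      (LINT x:\<Omega>|lborel. rep_L2 u x * partials bs \<phi> x)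
        = (- 1) ^ length bs * (LINT x:\<Omega>|lborel. rep_L2 g x * \<phi> x)) \<longleftrightarrow> ?R" (is "?L \<longleftrightarrow> _")
  proof
    assume L: ?L
    show ?R
    proof
      fix \<phi> :: "'a \<Rightarrow> complex" assume \<phi>: "\<phi> \<in> test_functions \<Omega>"
      show "u \<bullet> abs_L2 (partials bs \<phi>) = (- 1) ^ length bs * (g \<bullet> abs_L2 \<phi>)"
        using L[rule_format, OF cnj[OF \<phi>]]
        by (simp add: set_integral_mult_test cnj[OF test_partials[OF \<phi> bs]] cnj[OF \<phi>] s
            flip: pc[OF \<phi>])
    qed
  next
    assume R: ?R
    show ?L
    proof
      fix \<phi> :: "'a \<Rightarrow> complex" assume \<phi>: "\<phi> \<in> test_functions \<Omega>"
      show "(LINT x:\<Omega>|lborel. rep_L2 u x * partials bs \<phi> x)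
        = (- 1) ^ length bs * (LINT x:\<Omega>|lborel. rep_L2 g x * \<phi> x)"
        using R[rule_format, OF cnj[OF \<phi>]] R[rule_format, OF icnj[OF \<phi>]]
        by (simp add: set_integral_mult_test test_partials[OF \<phi> bs] \<phi> s pc[OF \<phi>] pic[OF \<phi>])
    qed
  qed
  then show ?thesis unfolding is_weak_deriv_def by blast
qed

lemma is_weak_deriv_unique:
  assumes "open \<Omega>" "set bs \<subseteq> Basis" "is_weak_deriv \<Omega> bs u g" "is_weak_deriv \<Omega> bs u h"
  shows "g = h"
proof -
  have "g - h = 0"
  proof (rule L2_on_eq_0I[OF assms(1)])
    show "g - h \<in> L2_on \<Omega>"
      using assms by (intro subspace_diff subspace_L2_on) (auto simp: is_weak_deriv_iff_inner)
    fix \<phi> :: "'a \<Rightarrow> complex" assume "\<phi> \<in> test_functions \<Omega>"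
    then show "(g - h) \<bullet> abs_L2 \<phi> = 0"
      using assms(2-) by (auto simp: is_weak_deriv_iff_inner inner_diff_left)
  qed
  then show ?thesis by simp
qed

lemma weak_deriv_eqI:
  "open \<Omega> \<Longrightarrow> set bs \<subseteq> Basis \<Longrightarrow> is_weak_deriv \<Omega> bs u g \<Longrightarrow> weak_deriv \<Omega> bs u = g"
  unfolding weak_deriv_def by (rule the_equality) (auto intro: is_weak_deriv_unique)

lemma is_weak_deriv_weak_deriv:
  assumes "open \<Omega>" "u \<in> sobolev k \<Omega>" "set bs \<subseteq> Basis" "length bs \<le> k"
  shows "is_weak_deriv \<Omega> bs u (weak_deriv \<Omega> bs u)"
proof -
  obtain g where "is_weak_deriv \<Omega> bs u g" using assms by (auto simp: sobolev_def)
  then show ?thesis using weak_deriv_eqI[OF assms(1,3)] by simp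
qed

lemma is_weak_deriv_add:
  assumes "open \<Omega>" "set bs \<subseteq> Basis" "is_weak_deriv \<Omega> bs u g" "is_weak_deriv \<Omega> bs v h"
  shows "is_weak_deriv \<Omega> bs (u + v) (g + h)"
  using assms subspace_add[OF subspace_L2_on, of \<Omega> g h]
  by (auto simp: is_weak_deriv_iff_inner inner_add_left algebra_simps)

lemma is_weak_deriv_scaleR:
  assumes "open \<Omega>" "set bs \<subseteq> Basis" "is_weak_deriv \<Omega> bs u g"
  shows "is_weak_deriv \<Omega> bs (r *\<^sub>R u) (r *\<^sub>R g)"
  using assms subspace_scale[OF subspace_L2_on, of \<Omega> g r]
  by (auto simp: is_weak_deriv_iff_inner)

lemma subspace_sobolev: "open \<Omega> \<Longrightarrow> subspace (sobolev k \<Omega>)"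
proof (rule subspaceI)
  assume "open \<Omega>"
  then have s: "subspace (L2_on \<Omega>)" by (simp add: subspace_L2_on)
  have "is_weak_deriv \<Omega> bs 0 0" if "set bs \<subseteq> Basis" for bs
    using that subspace_0[OF s] by (simp add: is_weak_deriv_iff_inner)
  then show "0 \<in> sobolev k \<Omega>" using subspace_0[OF s] by (auto simp: sobolev_def)
  show "u + v \<in> sobolev k \<Omega>" if "u \<in> sobolev k \<Omega>" "v \<in> sobolev k \<Omega>" for u v
    using that is_weak_deriv_add[OF \<open>open \<Omega>\<close>] subspace_add[OF s]
    unfolding sobolev_def by simp metis
  show "r *\<^sub>R u \<in> sobolev k \<Omega>" if "u \<in> sobolev k \<Omega>" for r u
    using that is_weak_deriv_scaleR[OF \<open>open \<Omega>\<close>] subspace_scale[OF s]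
    unfolding sobolev_def by simp metis
qed

lemma sobolev_mono: "k \<le> l \<Longrightarrow> sobolev l \<Omega> \<subseteq> sobolev k \<Omega>"
  by (auto simp: sobolev_def)

lemma weak_deriv_add:
  assumes "open \<Omega>" "u \<in> sobolev k \<Omega>" "v \<in> sobolev k \<Omega>" "set bs \<subseteq> Basis" "length bs \<le> k"
  shows "weak_deriv \<Omega> bs (u + v) = weak_deriv \<Omega> bs u + weak_deriv \<Omega> bs v"
  using assms by (intro weak_deriv_eqI is_weak_deriv_add is_weak_deriv_weak_deriv)

lemma weak_deriv_scaleR:
  assumes "open \<Omega>" "u \<in> sobolev k \<Omega>" "set bs \<subseteq> Basis" "length bs \<le> k"
  shows "weak_deriv \<Omega> bs (r *\<^sub>R u) = r *\<^sub>R weak_deriv \<Omega> bs u"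
  using assms by (intro weak_deriv_eqI is_weak_deriv_scaleR is_weak_deriv_weak_deriv)

lemma weak_deriv_in_sobolev:
  assumes "open \<Omega>" "u \<in> sobolev (k + length cs) \<Omega>" "set cs \<subseteq> Basis"
  shows "weak_deriv \<Omega> cs u \<in> sobolev k \<Omega>"
proof -
  let ?d = "weak_deriv \<Omega> cs u"
  have d: "is_weak_deriv \<Omega> cs u ?d"
    using assms by (intro is_weak_deriv_weak_deriv) auto
  have "\<exists>g. is_weak_deriv \<Omega> bs ?d g" if bs: "set bs \<subseteq> Basis" "length bs \<le> k" for bs
  proof -
    \<comment> \<open>In the pairing with \<open>partials cs (partials bs \<phi>)\<close> the outer
      block \<open>cs\<close> is moved onto \<open>u\<close> first, hence this order of the
      concatenation.\<close>
    have cb: "set (cs @ bs) \<subseteq> Basis" using assms(3) bs(1) by auto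
    moreover have "length (cs @ bs) \<le> k + length cs" using bs(2) by simp
    ultimately have "\<exists>g. is_weak_deriv \<Omega> (cs @ bs) u g"
      using assms(2) unfolding sobolev_def by blast
    then obtain g where g: "is_weak_deriv \<Omega> (cs @ bs) u g" by blast
    have "is_weak_deriv \<Omega> bs ?d g"
      unfolding is_weak_deriv_iff_inner[OF bs(1)]
    proof (intro conjI ballI)
      show "g \<in> L2_on \<Omega>" using g by (simp add: is_weak_deriv_def)
      fix \<phi> :: "'a \<Rightarrow> complex" assume \<phi>: "\<phi> \<in> test_functions \<Omega>"
      have "(- 1) ^ length cs * (?d \<bullet> abs_L2 (partials bs \<phi>)) = u \<bullet> abs_L2 (partials (cs @ bs) \<phi>)"
        using d test_partials[OF \<phi> bs(1)]
        by (simp add: is_weak_deriv_iff_inner[OF assms(3)] partials_append)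
      also have "\<dots> = (- 1) ^ length cs * ((- 1) ^ length bs * (g \<bullet> abs_L2 \<phi>))"
        using g \<phi> by (simp add: is_weak_deriv_iff_inner[OF cb] power_add)
      finally show "?d \<bullet> abs_L2 (partials bs \<phi>) = (- 1) ^ length bs * (g \<bullet> abs_L2 \<phi>)" by simp
    qed
    then show ?thesis by blast
  qed
  moreover have "?d \<in> L2_on \<Omega>" using d by (simp add: is_weak_deriv_def)
  ultimately show ?thesis by (simp add: sobolev_def)
qed

lemma inner_abs_partial_test:
  assumes "\<phi> \<in> test_functions UNIV" "\<psi> \<in> test_functions UNIV" "b \<in> Basis"
  shows "abs_L2 \<phi> \<bullet> abs_L2 (partials [b] \<psi>) = - (abs_L2 (partials [b] \<phi>) \<bullet> abs_L2 \<psi>)"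
proof -
  have c: "(\<lambda>x. cnj (\<psi> x)) \<in> test_functions UNIV"
    by (rule test_bounded_linear[OF bounded_linear_cnj assms(2)])
  have D: "partials [b] f \<in> test_functions UNIV"
    if "f \<in> test_functions UNIV" for f :: "'a \<Rightarrow> complex"
    by (rule test_partials[OF that]) (use assms(3) in simp)
  have inner: "abs_L2 f \<bullet> abs_L2 g = Re (LINT x|lborel. f x * cnj (g x))"
    if "f \<in> test_functions UNIV" "g \<in> test_functions UNIV" for f g :: "'a \<Rightarrow> complex"
  proof -
    have "integrable lborel (\<lambda>x. f x * cnj (g x))"
      by (intro test_integrable[of _ UNIV] test_mult[OF that(1)]
          test_smooth[OF test_bounded_linear[OF bounded_linear_cnj that(2)]])
    from integral_Re[OF this] have "Re (LINT x|lborel. f x * cnj (g x)) = (LINT x|lborel. f x \<bullet> g x)"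
      by (simp add: inner_complex_def)
    then show ?thesis
      by (simp add: inner_L2.abs_eq L2_rel_refl test_square_integrable[OF that(1)]
          test_square_integrable[OF that(2)])
  qed
  have "partials [b] (\<lambda>x. cnj (\<psi> x)) = (\<lambda>x. cnj (partials [b] \<psi> x))"
    by (rule partials_bounded_linear[OF bounded_linear_cnj test_smooth[OF assms(2)]])
      (use assms(3) in simp)
  then have "(LINT x|lborel. \<phi> x * cnj (partials [b] \<psi> x))
      = - (LINT x|lborel. partials [b] \<phi> x * cnj (\<psi> x))"
    using integral_by_parts_test[OF assms(1) c assms(3)] by (simp add: fun_eq_iff)
  then show ?thesis by (simp only: inner assms D uminus_complex.sel)
qed

text \<open>Integration by parts strips the head of \<open>bs\<close> and lets it act on
  \<open>\<phi>\<close> before the rest, which reverses the list. Recording \<open>rev bs\<close>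
  avoids an appeal to the symmetry of second derivatives.\<close>

lemma is_weak_deriv_test:
  assumes "\<phi> \<in> test_functions \<Omega>" "set bs \<subseteq> Basis"
  shows "is_weak_deriv \<Omega> bs (abs_L2 \<phi>) (abs_L2 (partials (rev bs) \<phi>))"
  unfolding is_weak_deriv_iff_inner[OF assms(2)]
proof (intro conjI ballI)
  show "abs_L2 (partials (rev bs) \<phi>) \<in> L2_on \<Omega>"
    using assms by (intro abs_test_in_L2_on test_partials) auto
  fix \<psi> :: "'a \<Rightarrow> complex" assume \<psi>: "\<psi> \<in> test_functions \<Omega>"
  show "abs_L2 \<phi> \<bullet> abs_L2 (partials bs \<psi>)
      = (- 1) ^ length bs * (abs_L2 (partials (rev bs) \<phi>) \<bullet> abs_L2 \<psi>)"
    using assms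
  proof (induction bs arbitrary: \<phi>)
    case (Cons b bs)
    have U: "test_functions \<Omega> \<subseteq> test_functions UNIV" by (rule test_mono) auto
    have "partials bs \<psi> \<in> test_functions \<Omega>" using Cons.prems by (intro test_partials \<psi>) auto
    then have "abs_L2 \<phi> \<bullet> abs_L2 (partials (b # bs) \<psi>)
        = - (abs_L2 (partials [b] \<phi>) \<bullet> abs_L2 (partials bs \<psi>))"
      using inner_abs_partial_test[of \<phi> "partials bs \<psi>" b] Cons.prems U by auto
    also have "\<dots> = - ((- 1) ^ length bs * (abs_L2 (partials (rev bs) (partials [b] \<phi>)) \<bullet> abs_L2 \<psi>))"
      using Cons.prems by (subst Cons.IH) (auto intro!: test_partials simp del: partials.simps)
    finally show ?case by (simp add: partials_append)
  qed simp
qed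

section \<open>Hilbert space lemmas\<close>

lemma nearest_point_orthogonal:
  fixes x p :: "'h::real_inner"
  assumes "subspace V" "p \<in> V" "v \<in> V" "\<And>w. w \<in> V \<Longrightarrow> norm (x - p) \<le> norm (x - w)"
  shows "(x - p) \<bullet> v = 0"
proof (cases "v = 0")
  case False
  \<comment> \<open>This \<open>t\<close> minimises the squared norm of x - p - t v; the minimum
    lies strictly below the value at 0 unless the inner product vanishes.\<close>
  define t where "t = ((x - p) \<bullet> v) / (v \<bullet> v)"
  have vv: "v \<bullet> v > 0" using False by simp
  have "p + t *\<^sub>R v \<in> V" using assms by (intro subspace_add subspace_scale)
  then have "(norm (x - p))\<^sup>2 \<le> (norm (x - (p + t *\<^sub>R v)))\<^sup>2"
    using assms(4) by (intro power_mono) auto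
  also have "\<dots> = (norm ((x - p) - t *\<^sub>R v))\<^sup>2" by (simp add: diff_diff_eq)
  also have "\<dots> = (norm (x - p))\<^sup>2 - 2 * t * ((x - p) \<bullet> v) + t\<^sup>2 * (v \<bullet> v)"
    unfolding power2_norm_eq_inner
    by (simp add: inner_diff_left inner_diff_right inner_commute power2_eq_square algebra_simps)
  also have "\<dots> = (norm (x - p))\<^sup>2 - ((x - p) \<bullet> v)\<^sup>2 / (v \<bullet> v)"
    using vv by (simp add: t_def power2_eq_square field_simps)
  finally have "((x - p) \<bullet> v)\<^sup>2 / (v \<bullet> v) \<le> 0" by simp
  then show ?thesis using vv by (simp add: divide_le_0_iff)
qed simp

lemma orthogonal_projection_exists:
  fixes x :: "'h::{real_inner, complete_space}"
  assumes V: "subspace V" "closed V"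
  obtains p where "p \<in> V" "\<And>v. v \<in> V \<Longrightarrow> (x - p) \<bullet> v = 0"
proof -
  define d where "d = infdist x V"
  have ne: "V \<noteq> {}" using subspace_0[OF V(1)] by auto
  have d: "d \<le> norm (x - v)" if "v \<in> V" for v
    using infdist_le[OF that, of x] by (simp add: d_def dist_norm)
  have d0: "d \<ge> 0" by (simp add: d_def infdist_nonneg)
  have "\<exists>v\<in>V. norm (x - v) < d + 1 / real (Suc n)" for n
  proof -
    have "infdist x V < d + 1 / real (Suc n)" by (simp add: d_def)
    then have "\<exists>v\<in>V. dist x v < d + 1 / real (Suc n)"
      using ne by (simp add: infdist_notempty cINF_less_iff)
    then show ?thesis by (simp add: dist_norm)
  qed
  then obtain a where a: "\<And>n. a n \<in> V" "\<And>n. norm (x - a n) < d + 1 / real (Suc n)"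
    by metis
  \<comment> \<open>Parallelogram identity: the midpoint of \<open>v\<close> and \<open>w\<close>
    lies in \<open>V\<close>, hence at distance at least \<open>d\<close> from \<open>x\<close>.
    Nearly minimal points are therefore close to each other.\<close>
  have par: "(norm (v - w))\<^sup>2 \<le> 2 * (norm (x - v))\<^sup>2 + 2 * (norm (x - w))\<^sup>2 - 4 * d\<^sup>2"
    if "v \<in> V" "w \<in> V" for v w
  proof -
    have "(1 / 2) *\<^sub>R (v + w) \<in> V" using V(1) that by (intro subspace_scale subspace_add)
    then have "d\<^sup>2 \<le> (norm (x - (1 / 2) *\<^sub>R (v + w)))\<^sup>2"
      using d d0 by (intro power_mono) auto
    moreover have "(norm (v - w))\<^sup>2 + 4 * (norm (x - (1 / 2) *\<^sub>R (v + w)))\<^sup>2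
        = 2 * (norm (x - v))\<^sup>2 + 2 * (norm (x - w))\<^sup>2"
      by (simp add: power2_norm_eq_inner inner_diff_left inner_diff_right inner_add_left
          inner_add_right inner_commute algebra_simps)
    ultimately show ?thesis by simp
  qed
  have "Cauchy a"
  proof (rule CauchyI)
    fix e :: real assume e: "e > 0"
    \<comment> \<open>For two points within d + \<delta> of \<open>x\<close> the estimate
      \<open>par\<close> leaves 4 ((d + \<delta>)^2 - d^2) = (8 d + 4 \<delta>) \<delta>, and
      \<open>8 * d + 4 + 1\<close> dominates the first factor when \<delta> <= 1.\<close>
    define \<eta> where "\<eta> = e\<^sup>2 / (8 * d + 4 + 1)"
    have \<eta>: "\<eta> > 0" unfolding \<eta>_def using e d0 by (intro divide_pos_pos) auto
    obtain N where N: "inverse (real (Suc N)) < \<eta>" using reals_Archimedean[OF \<eta>] by blast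
    have "norm (a m - a n) < e" if "m \<ge> N" "n \<ge> N" for m n
    proof -
      define \<delta> where "\<delta> = inverse (real (Suc N))"
      have \<delta>: "0 < \<delta>" "\<delta> \<le> 1" "\<delta> < \<eta>" using N by (auto simp: \<delta>_def inverse_le_1_iff)
      have le: "(norm (x - a k))\<^sup>2 \<le> (d + \<delta>)\<^sup>2" if "k \<ge> N" for k
      proof (intro power_mono)
        have "1 / real (Suc k) \<le> \<delta>" using that by (simp add: \<delta>_def divide_inverse le_imp_inverse_le)
        then show "norm (x - a k) \<le> d + \<delta>" using a(2)[of k] by simp
      qed auto
      have "(norm (a m - a n))\<^sup>2 \<le> 2 * (d + \<delta>)\<^sup>2 + 2 * (d + \<delta>)\<^sup>2 - 4 * d\<^sup>2"
        using par[OF a(1) a(1), of m n] le[OF that(1)] le[OF that(2)] by linarith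
      also have "\<dots> = (8 * d + 4 * \<delta>) * \<delta>"
        by (simp add: power2_eq_square algebra_simps)
      also have "\<dots> \<le> (8 * d + 4 + 1) * \<delta>" using \<delta> by (intro mult_right_mono) auto
      also have "\<dots> < (8 * d + 4 + 1) * \<eta>" using \<delta> d0 by (intro mult_strict_left_mono) auto
      also have "\<dots> = e\<^sup>2" using d0 by (simp add: \<eta>_def)
      finally show ?thesis using e by (simp add: power2_less_imp_less)
    qed
    then show "\<exists>N. \<forall>m\<ge>N. \<forall>n\<ge>N. norm (a m - a n) < e" by blast
  qed
  then obtain p where p: "a \<longlonglongrightarrow> p" using Cauchy_convergent convergent_def by blast
  have pV: "p \<in> V" using V(2) a(1) p closed_sequentially by blast
  have "(\<lambda>n. norm (x - a n)) \<longlonglongrightarrow> norm (x - p)" by (intro tendsto_intros p)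
  moreover have "(\<lambda>n. d + 1 / real (Suc n)) \<longlonglongrightarrow> d + 0"
    by (intro tendsto_intros LIMSEQ_Suc[OF lim_1_over_n])
  ultimately have "norm (x - p) \<le> d + 0"
    by (rule LIMSEQ_le) (use a(2) in \<open>auto intro: less_imp_le\<close>)
  then have "norm (x - p) \<le> norm (x - w)" if "w \<in> V" for w using d[OF that] by simp
  then show ?thesis using that pV nearest_point_orthogonal[OF V(1) pV] by blast
qed

definition proj :: "'h::real_inner set \<Rightarrow> 'h \<Rightarrow> 'h"
  where "proj V x = (SOME p. p \<in> V \<and> (\<forall>v\<in>V. (x - p) \<bullet> v = 0))"

lemma proj:
  fixes x :: "'h::{real_inner, complete_space}"
  assumes "subspace V" "closed V"
  shows proj_in: "proj V x \<in> V" and proj_orthogonal: "v \<in> V \<Longrightarrow> (x - proj V x) \<bullet> v = 0"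
proof -
  have "\<exists>p. p \<in> V \<and> (\<forall>v\<in>V. (x - p) \<bullet> v = 0)"
    using orthogonal_projection_exists[OF assms] by metis
  from someI_ex[OF this] show "proj V x \<in> V" "v \<in> V \<Longrightarrow> (x - proj V x) \<bullet> v = 0"
    unfolding proj_def by blast+
qed

lemma proj_unique:
  fixes x :: "'h::{real_inner, complete_space}"
  assumes "subspace V" "closed V" "p \<in> V" "\<And>v. v \<in> V \<Longrightarrow> (x - p) \<bullet> v = 0"
  shows "proj V x = p"
proof -
  let ?w = "proj V x - p"
  have w: "?w \<in> V" using proj_in[OF assms(1,2)] assms by (intro subspace_diff)
  have "?w \<bullet> ?w = (x - p) \<bullet> ?w - (x - proj V x) \<bullet> ?w"
    by (simp add: inner_diff_left)
  also have "\<dots> = 0" using assms(4)[OF w] proj_orthogonal[OF assms(1,2) w] by simp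
  finally show ?thesis by simp
qed

text \<open>If \<open>T (\<epsilon> - T)\<close> is positive somewhere, then its supremum \<open>\<kappa>\<close> over the unit sphere is
  an approximate eigenvalue, and \<open>\<kappa> - T (\<epsilon> - T) = (T - r\<^sub>1) (T - r\<^sub>2)\<close> with
  \<open>0 < r\<^sub>1 \<le> r\<^sub>2 < \<epsilon>\<close>; hence \<open>r\<^sub>1\<close> or \<open>r\<^sub>2\<close> is an approximate eigenvalue of \<open>T\<close>.\<close>

lemma approximate_eigenvalue_below:
  fixes T :: "'h::real_inner \<Rightarrow> 'h"
  assumes lin: "linear T" and sym: "\<And>x y. T x \<bullet> y = x \<bullet> T y" and bd: "\<And>x. norm (T x) \<le> norm x"
    and "\<epsilon> > 0" and ex: "(norm (T x0))\<^sup>2 < \<epsilon> * (x0 \<bullet> T x0)"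
  obtains \<nu> where "0 < \<nu>" "\<nu> < \<epsilon>" "\<And>\<delta>. \<delta> > 0 \<Longrightarrow> \<exists>x. norm x = 1 \<and> norm (T x - \<nu> *\<^sub>R x) \<le> \<delta>"
proof -
  note T_simps = linear_add[OF lin] linear_diff[OF lin] linear_scale[OF lin] linear_0[OF lin]
  define q where "q x = \<epsilon> * (x \<bullet> T x) - (norm (T x))\<^sup>2" for x
  define S where "S = q ` {x. norm x = 1}"
  define \<kappa> where "\<kappa> = Sup S"
  have q_scale: "q (r *\<^sub>R x) = r\<^sup>2 * q x" for r x
    by (simp add: q_def T_simps power2_eq_square algebra_simps)
  \<comment> \<open>Completing the square bounds \<open>q\<close> by \<epsilon>^2 / 4 on the unit
    sphere; this makes the expression under the root in \<open>s\<close> nonnegative.\<close>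
  have q_square: "q x = \<epsilon>\<^sup>2 / 4 * (norm x)\<^sup>2 - (norm (T x - (\<epsilon> / 2) *\<^sub>R x))\<^sup>2" for x
    unfolding q_def power2_norm_eq_inner
    by (simp add: inner_diff_left inner_diff_right inner_commute power2_eq_square algebra_simps)
  have S_le: "s \<le> \<epsilon>\<^sup>2 / 4" if "s \<in> S" for s
    using that by (auto simp: S_def q_square)
  then have bdd: "bdd_above S" by (rule bdd_aboveI)
  have "x0 \<noteq> 0" using ex by (auto simp: T_simps)
  then have x1: "norm (x0 /\<^sub>R norm x0) = 1" by simp
  have "0 < q (x0 /\<^sub>R norm x0)"
    using ex \<open>x0 \<noteq> 0\<close> by (subst q_scale) (simp add: q_def)
  also have "\<dots> \<le> \<kappa>" unfolding \<kappa>_def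
    by (rule cSup_upper[OF _ bdd]) (use x1 in \<open>auto simp: S_def\<close>)
  finally have \<kappa>: "\<kappa> > 0" .
  have Sne: "S \<noteq> {}" using x1 unfolding S_def by blast
  have \<kappa>_le: "\<kappa> \<le> \<epsilon>\<^sup>2 / 4" unfolding \<kappa>_def by (rule cSup_least[OF Sne S_le])
  have q_le: "q x \<le> \<kappa> * (norm x)\<^sup>2" for x
  proof (cases "x = 0")
    case False
    have "q (x /\<^sub>R norm x) \<le> \<kappa>" unfolding \<kappa>_def
      by (rule cSup_upper[OF _ bdd]) (use False in \<open>auto simp: S_def\<close>)
    then show ?thesis using False by (simp add: q_scale field_simps)
  qed (simp add: q_def T_simps)
  define B where "B x = \<kappa> *\<^sub>R x - \<epsilon> *\<^sub>R T x + T (T x)" for x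
  have B_form: "x \<bullet> B x = \<kappa> * (norm x)\<^sup>2 - q x" for x
    by (simp add: B_def q_def inner_add_right inner_diff_right power2_norm_eq_inner sym)
  have B_nonneg: "0 \<le> x \<bullet> B x" for x using q_le[of x] by (simp add: B_form)
  have B_sym: "B x \<bullet> y = x \<bullet> B y" for x y
    by (simp add: B_def inner_add_right inner_diff_right inner_add_left inner_diff_left sym)
  have B_diff: "B (x - t *\<^sub>R y) = B x - t *\<^sub>R B y" for x t y
    by (simp add: B_def T_simps algebra_simps)
  define C where "C = \<kappa> + \<epsilon> + 1"
  have C: "C > 0" using \<kappa> \<open>\<epsilon> > 0\<close> by (simp add: C_def)
  have B_bd: "norm (B x) \<le> C * norm x" for x
  proof -
    have "norm (B x) \<le> norm (\<kappa> *\<^sub>R x) + norm (\<epsilon> *\<^sub>R T x) + norm (T (T x))"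
      unfolding B_def
      by (rule order_trans[OF norm_triangle_ineq]) (rule add_right_mono[OF norm_triangle_ineq4])
    also have "\<dots> \<le> \<kappa> * norm x + \<epsilon> * norm x + norm x"
      using \<kappa> \<open>\<epsilon> > 0\<close> bd[of x] order_trans[OF bd bd, of x]
      by (intro add_mono) (auto intro: mult_left_mono)
    finally show ?thesis by (simp add: C_def algebra_simps)
  qed
  \<comment> \<open>This comes from the nonnegativity of the form of \<open>B\<close> at x - B x /
    C. Hence unit vectors that nearly maximise \<open>q\<close> are nearly annihilated by
    \<open>B\<close>.\<close>
  have B_CS: "(norm (B x))\<^sup>2 \<le> C * (x \<bullet> B x)" for x
  proof -
    define y where "y = B x"
    have "0 \<le> (x - (1 / C) *\<^sub>R y) \<bullet> B (x - (1 / C) *\<^sub>R y)" by (rule B_nonneg)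
    also have "\<dots> = x \<bullet> B x - 2 / C * (y \<bullet> y) + (1 / C)\<^sup>2 * (y \<bullet> B y)"
      using B_sym[of x y] by (simp add: B_diff inner_diff_left inner_diff_right power2_eq_square y_def
          inner_commute algebra_simps)
    also have "\<dots> \<le> x \<bullet> B x - 2 / C * (y \<bullet> y) + (1 / C)\<^sup>2 * (C * (y \<bullet> y))"
    proof -
      have "y \<bullet> B y \<le> norm y * norm (B y)" by (rule norm_cauchy_schwarz)
      also have "\<dots> \<le> norm y * (C * norm y)" by (intro mult_left_mono B_bd) auto
      also have "\<dots> = C * (y \<bullet> y)" by (simp add: dot_square_norm power2_eq_square)
      finally show ?thesis by (intro add_left_mono mult_left_mono) auto
    qed
    also have "\<dots> = x \<bullet> B x - (y \<bullet> y) / C" using C by (simp add: power2_eq_square field_simps)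
    finally show ?thesis using C by (simp add: y_def power2_norm_eq_inner field_simps)
  qed
  have small: "\<exists>x. norm x = 1 \<and> norm (B x) \<le> \<eta>" if "\<eta> > 0" for \<eta>
  proof -
    have "\<kappa> - \<eta>\<^sup>2 / C < \<kappa>" using that C by simp
    then have "\<exists>r\<in>S. \<kappa> - \<eta>\<^sup>2 / C < r"
      using less_cSup_iff[OF Sne bdd] unfolding \<kappa>_def by blast
    then obtain x where x: "norm x = 1" "\<kappa> - \<eta>\<^sup>2 / C < q x" by (auto simp: S_def)
    then have "C * (x \<bullet> B x) \<le> \<eta>\<^sup>2" using C by (simp add: B_form field_simps)
    then have "(norm (B x))\<^sup>2 \<le> \<eta>\<^sup>2" using B_CS[of x] by linarith
    then show ?thesis using x(1) that by (auto intro: power2_le_imp_le)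
  qed
  define s where "s = sqrt (\<epsilon>\<^sup>2 / 4 - \<kappa>)"
  define r1 where "r1 = \<epsilon> / 2 - s"
  define r2 where "r2 = \<epsilon> / 2 + s"
  have s: "0 \<le> s" "s\<^sup>2 = \<epsilon>\<^sup>2 / 4 - \<kappa>" using \<kappa>_le by (auto simp: s_def)
  have "s\<^sup>2 < (\<epsilon> / 2)\<^sup>2" using s \<kappa> by (simp add: power_divide)
  then have "s < \<epsilon> / 2" by (rule power2_less_imp_less) (use \<open>\<epsilon> > 0\<close> in simp)
  then have r: "0 < r1" "r1 < \<epsilon>" "0 < r2" "r2 < \<epsilon>" using s \<open>\<epsilon> > 0\<close> by (auto simp: r1_def r2_def)
  have r12: "r1 + r2 = \<epsilon>" "r1 * r2 = \<kappa>"
    using s by (simp_all add: r1_def r2_def power2_eq_square algebra_simps)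
  have factor: "B x = T (T x - r2 *\<^sub>R x) - r1 *\<^sub>R (T x - r2 *\<^sub>R x)" for x
    unfolding B_def r12[symmetric] by (simp add: T_simps algebra_simps)
  show thesis
  \<comment> \<open>If \<open>r2\<close> fails, T - r2 is bounded below by some
    \<open>\<delta>0\<close> on the unit sphere. Then y = (T - r2) x stays away from 0 while (T -
    r1) y = B x becomes small, and \<open>y\<close> normalised works for \<open>r1\<close>.\<close>
  proof (cases "\<forall>\<delta>>0. \<exists>x. norm x = 1 \<and> norm (T x - r2 *\<^sub>R x) \<le> \<delta>")
    case True
    then show thesis using that[of r2] r by blast
  next
    case False
    then obtain \<delta>0 where \<delta>0: "\<delta>0 > 0" "\<And>x. norm x = 1 \<Longrightarrow> \<delta>0 < norm (T x - r2 *\<^sub>R x)"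
      unfolding not_all not_imp not_ex de_Morgan_conj not_le by blast
    have "\<exists>z. norm z = 1 \<and> norm (T z - r1 *\<^sub>R z) \<le> \<delta>" if \<delta>: "\<delta> > 0" for \<delta>
    proof -
      obtain x where x: "norm x = 1" "norm (B x) \<le> \<delta> * \<delta>0" using small \<delta> \<delta>0 by (metis mult_pos_pos)
      define y where "y = T x - r2 *\<^sub>R x"
      have y: "\<delta>0 < norm y" using \<delta>0 x by (simp add: y_def)
      define z where "z = y /\<^sub>R norm y"
      have "T z - r1 *\<^sub>R z = B x /\<^sub>R norm y"
        unfolding z_def factor y_def[symmetric] by (simp add: T_simps algebra_simps)
      then have "norm (T z - r1 *\<^sub>R z) = norm (B x) / norm y" by (simp add: divide_inverse mult.commute)
      also have "\<dots> \<le> \<delta> * \<delta>0 / \<delta>0"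
        using x y \<delta>0 \<delta> by (intro frac_le) auto
      finally have "norm (T z - r1 *\<^sub>R z) \<le> \<delta>" using \<delta>0 by simp
      moreover have "y \<noteq> 0" using y \<delta>0(1) by auto
      then have "norm z = 1" by (simp add: z_def)
      ultimately show ?thesis by blast
    qed
    then show thesis using that[of r1] r by blast
  qed
qed

text \<open>For \<open>T = (1 + L)\<^sup>-\<^sup>1\<close>, the vector \<open>\<phi> = T (T x)\<close> has \<open>L \<phi> = T x - T (T x)\<close> and
  \<open>L (L \<phi>) = x - 2 T x + T (T x)\<close>; it is an approximate eigenvector of \<open>L\<close> to the eigenvalue
  \<open>1 / \<nu> - 1\<close>, with control in the graph norm.\<close>

lemma approximate_eigenvector_inverse:
  fixes T :: "'h::real_inner \<Rightarrow> 'h"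
  assumes lin: "linear T" and bd: "\<And>x. norm (T x) \<le> norm x" and \<nu>: "0 < \<nu>" "\<nu> < 1"
    and ex: "\<And>\<delta>. \<delta> > 0 \<Longrightarrow> \<exists>x. norm x = 1 \<and> norm (T x - \<nu> *\<^sub>R x) \<le> \<delta>"
    and \<delta>: "\<delta> > 0"
  obtains x where "norm (T (T x)) = 1"
    "norm ((T x - T (T x)) - (1 / \<nu> - 1) *\<^sub>R T (T x)) \<le> \<delta>"
    "norm ((x - 2 *\<^sub>R T x + T (T x)) - (1 / \<nu> - 1)\<^sup>2 *\<^sub>R T (T x)) \<le> \<delta>"
proof -
  note T_simps = linear_add[OF lin] linear_diff[OF lin] linear_scale[OF lin] linear_0[OF lin]
  \<comment> \<open>The first bound keeps the norm of \<open>T (T x)\<close> above \<nu>^2 / 2. The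
    second pays for the normalisation: the errors 4 d / \<nu>^2, divided by \<nu>^2 / 2, amount to 8
    d / \<nu>^4.\<close>
  define d where "d = min (\<nu>\<^sup>2 / 4) (\<delta> * \<nu> ^ 4 / 8)"
  have d: "d > 0" "d \<le> \<nu>\<^sup>2 / 4" "d \<le> \<delta> * \<nu> ^ 4 / 8" using \<nu> \<delta> by (auto simp: d_def)
  obtain x where x: "norm x = 1" "norm (T x - \<nu> *\<^sub>R x) \<le> d" using ex[OF d(1)] by blast
  define e where "e = T x - \<nu> *\<^sub>R x"
  have Tx: "T x = \<nu> *\<^sub>R x + e" by (simp add: e_def)
  have TTx: "T (T x) = \<nu>\<^sup>2 *\<^sub>R x + \<nu> *\<^sub>R e + T e"
    by (simp add: Tx T_simps power2_eq_square algebra_simps)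
  have e: "norm e \<le> d" "norm (T e) \<le> d" using x bd[of e] by (auto simp: e_def)
  have \<nu>e: "norm (\<nu> *\<^sub>R e) \<le> d" using e \<nu> mult_left_le_one_le[of "norm e" \<nu>] by simp
  define k where "k = norm (T (T x))"
  have "\<nu>\<^sup>2 = norm (\<nu>\<^sup>2 *\<^sub>R x)" using x by simp
  also have "\<dots> = norm (T (T x) - (\<nu> *\<^sub>R e + T e))" by (simp add: TTx)
  also have "\<dots> \<le> k + (d + d)"
    unfolding k_def using e \<nu>e
    by (intro order_trans[OF norm_triangle_ineq4] add_mono order_trans[OF norm_triangle_ineq]) auto
  finally have k: "\<nu>\<^sup>2 / 2 \<le> k" using d(2) by simp
  have "\<nu>\<^sup>2 / 2 > 0" using \<nu> by simp
  then have k0: "k > 0" using k by linarith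
  define y where "y = x /\<^sub>R k"
  have Ty: "T y = T x /\<^sub>R k" "T (T y) = T (T x) /\<^sub>R k" by (simp_all add: y_def T_simps)
  have scale: "norm (v /\<^sub>R k) \<le> \<delta>" if "norm v \<le> 4 * d / \<nu>\<^sup>2" for v :: 'h
  proof -
    have "norm (v /\<^sub>R k) = norm v / k" using k0 by (simp add: divide_inverse mult.commute)
    also have "\<dots> \<le> (4 * d / \<nu>\<^sup>2) / (\<nu>\<^sup>2 / 2)"
      using that k \<nu> d by (intro frac_le) auto
    also have "\<dots> = 8 * d / \<nu> ^ 4" by (simp add: power2_eq_square power4_eq_xxxx)
    also have "\<dots> \<le> \<delta>" using d(3) \<nu> by (simp add: field_simps)
    finally show ?thesis .
  qed
  have le: "d / \<nu> \<le> d / \<nu>\<^sup>2"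
    using \<nu> d by (intro divide_left_mono) (auto simp: power2_eq_square mult_left_le)
  have n1: "norm ((T x - T (T x)) - (1 / \<nu> - 1) *\<^sub>R T (T x)) \<le> 4 * d / \<nu>\<^sup>2"
  proof -
    have "(T x - T (T x)) - (1 / \<nu> - 1) *\<^sub>R T (T x) = - ((1 / \<nu>) *\<^sub>R T e)"
      using \<nu> by (simp add: e_def T_simps algebra_simps)
    then have "norm ((T x - T (T x)) - (1 / \<nu> - 1) *\<^sub>R T (T x)) = norm (T e) / \<nu>"
      using \<nu> by simp
    also have "\<dots> \<le> d / \<nu>" using e \<nu> by (intro divide_right_mono) auto
    also have "\<dots> \<le> d / \<nu>\<^sup>2" by (rule le)
    also have "\<dots> \<le> 4 * d / \<nu>\<^sup>2" using d by (intro divide_right_mono) auto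
    finally show ?thesis .
  qed
  have n2: "norm ((x - 2 *\<^sub>R T x + T (T x)) - (1 / \<nu> - 1)\<^sup>2 *\<^sub>R T (T x)) \<le> 4 * d / \<nu>\<^sup>2"
  proof -
    \<comment> \<open>Expanding (1 / \<nu> - 1)^2 regroups the expression so that each part is of
      the order of the defect e = T x - \<nu> x: \<open>T (T x)\<close> equals both \<nu>^2 x and
      \<nu> T x up to terms in \<open>e\<close>.\<close>
    have "(x - 2 *\<^sub>R T x + T (T x)) - (1 / \<nu> - 1)\<^sup>2 *\<^sub>R T (T x)
        = x - (1 / \<nu>\<^sup>2) *\<^sub>R T (T x) + (2 / \<nu>) *\<^sub>R (T (T x) - \<nu> *\<^sub>R T x)"
      using \<nu> by (simp add: power2_diff power_divide algebra_simps)
    also have "x - (1 / \<nu>\<^sup>2) *\<^sub>R T (T x) = - ((1 / \<nu>\<^sup>2) *\<^sub>R (\<nu> *\<^sub>R e + T e))"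
      using \<nu> by (simp add: TTx algebra_simps)
    also have "T (T x) - \<nu> *\<^sub>R T x = T e" by (simp add: e_def T_simps)
    finally have "norm ((x - 2 *\<^sub>R T x + T (T x)) - (1 / \<nu> - 1)\<^sup>2 *\<^sub>R T (T x))
        \<le> norm ((1 / \<nu>\<^sup>2) *\<^sub>R (\<nu> *\<^sub>R e + T e)) + norm ((2 / \<nu>) *\<^sub>R T e)"
      using norm_triangle_ineq[of "- ((1 / \<nu>\<^sup>2) *\<^sub>R (\<nu> *\<^sub>R e + T e))" "(2 / \<nu>) *\<^sub>R T e"]
      by (simp only: norm_minus_cancel)
    also have "\<dots> \<le> (d + d) / \<nu>\<^sup>2 + 2 * (d / \<nu>)"
    proof (intro add_mono)
      have "norm (\<nu> *\<^sub>R e + T e) \<le> d + d"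
        using e \<nu>e by (intro order_trans[OF norm_triangle_ineq] add_mono)
      then show "norm ((1 / \<nu>\<^sup>2) *\<^sub>R (\<nu> *\<^sub>R e + T e)) \<le> (d + d) / \<nu>\<^sup>2"
        using \<nu> by (simp add: divide_right_mono)
      show "norm ((2 / \<nu>) *\<^sub>R T e) \<le> 2 * (d / \<nu>)"
        using e \<nu> by (simp add: divide_right_mono)
    qed
    also have "\<dots> \<le> 4 * d / \<nu>\<^sup>2" using le by (simp add: add_divide_distrib)
    finally show ?thesis .
  qed
  show thesis
  proof (rule that[of y])
    show "norm (T (T y)) = 1" using k0 unfolding Ty(2) norm_scaleR k_def[symmetric] by simp
    show "norm ((T y - T (T y)) - (1 / \<nu> - 1) *\<^sub>R T (T y)) \<le> \<delta>"
      using scale[OF n1] unfolding Ty(2) unfolding Ty(1) by (simp add: algebra_simps)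
    show "norm ((y - 2 *\<^sub>R T y + T (T y)) - (1 / \<nu> - 1)\<^sup>2 *\<^sub>R T (T y)) \<le> \<delta>"
      using scale[OF n2] unfolding Ty(2) unfolding Ty(1) by (simp add: y_def algebra_simps)
  qed
qed

section \<open>The weak Dirichlet Laplacian\<close>

lemma Basis_vec_axis: "(Basis :: (real ^ 'n) set) = range (\<lambda>i. axis i 1)"
  by (auto simp: Basis_vec_def)

lemma sum_Basis_axis: "(\<Sum>b\<in>(Basis :: (real ^ 'n) set). f b) = (\<Sum>i\<in>UNIV. f (axis i 1))"
proof -
  have "inj (\<lambda>i::'n. axis i (1::real))" by (auto simp: inj_def axis_eq_axis)
  then show ?thesis by (simp add: Basis_vec_axis sum.reindex)
qed

definition gradient :: "(real ^ 'n) set \<Rightarrow> (real ^ 'n) L2 \<Rightarrow> (real ^ 'n) L2 ^ 'n"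
  where "gradient \<Omega> u = (\<chi> i. weak_deriv \<Omega> [axis i 1] u)"

definition test_graph :: "(real ^ 'n \<Rightarrow> complex) \<Rightarrow> (real ^ 'n) L2 \<times> ((real ^ 'n) L2 ^ 'n)"
  where "test_graph \<phi> = (abs_L2 \<phi>, \<chi> i. abs_L2 (partials [axis i 1] \<phi>))"

text \<open>H_0^1 as a closed subspace of a Hilbert space: each function is carried along with its
  gradient, and the inner product of such pairs is that of H^1. Vectors over the index type inherit
  inner product and completeness from L2.\<close>

definition gradient_graph :: "(real ^ 'n) set \<Rightarrow> ((real ^ 'n) L2 \<times> ((real ^ 'n) L2 ^ 'n)) set"
  where "gradient_graph \<Omega> = closure (test_graph ` test_functions \<Omega>)"

lemma test_graph_add:
  assumes "\<phi> \<in> test_functions \<Omega>" "\<psi> \<in> test_functions \<Omega>"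
  shows "test_graph \<phi> + test_graph \<psi> = test_graph (\<lambda>x. \<phi> x + \<psi> x)"
proof -
  have "frechet_derivative (\<lambda>x. \<phi> x + \<psi> x) (at x) b
      = frechet_derivative \<phi> (at x) b + frechet_derivative \<psi> (at x) b" for x b
    by (intro frechet_derivative_at_eq has_derivative_add smooth_has_derivative test_smooth[OF assms(1)]
        test_smooth[OF assms(2)])
  moreover have "square_integrable (\<lambda>x. frechet_derivative \<phi> (at x) (axis i 1))"
    "square_integrable (\<lambda>x. frechet_derivative \<psi> (at x) (axis i 1))" for i
    using test_square_integrable[OF test_partials[OF assms(1), of "[axis i 1]"]]
      test_square_integrable[OF test_partials[OF assms(2), of "[axis i 1]"]] by simp_all
  ultimately show ?thesis
    using assms by (simp add: test_graph_def abs_L2_add test_square_integrable[of _ \<Omega>] vec_eq_iff)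
qed

lemma test_graph_scaleR:
  assumes "\<phi> \<in> test_functions \<Omega>"
  shows "r *\<^sub>R test_graph \<phi> = test_graph (\<lambda>x. complex_of_real r * \<phi> x)"
proof -
  have "partials [axis i 1] (\<lambda>x. complex_of_real r * \<phi> x)
      = (\<lambda>x. complex_of_real r * partials [axis i 1] \<phi> x)" for i
    by (rule partials_bounded_linear[OF bounded_linear_mult_right test_smooth[OF assms]]) simp
  moreover have "square_integrable (partials [axis i 1] \<phi>)" for i
    by (rule test_square_integrable[OF test_partials[OF assms]]) simp
  ultimately show ?thesis
    using assms by (simp add: test_graph_def abs_L2_scaleR test_square_integrable[of _ \<Omega>] vec_eq_iff
        del: partials.simps)
qed

lemma subspace_gradient_graph: "subspace (gradient_graph \<Omega>)"
proof (rule subspaceI)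
  let ?G = "test_graph ` test_functions \<Omega>"
  have z: "(\<lambda>_. 0) \<in> test_functions \<Omega>"
    unfolding test_functions_def by (auto intro!: exI[of _ "{}"])
  have add: "p + q \<in> ?G" if "p \<in> ?G" "q \<in> ?G" for p q
    using that by (auto simp: test_graph_add intro!: imageI test_add)
  have scale: "r *\<^sub>R p \<in> ?G" if "p \<in> ?G" for r p
    using that by (auto simp: test_graph_scaleR intro!: imageI test_bounded_linear[OF bounded_linear_mult_right])
  have "0 *\<^sub>R test_graph (\<lambda>_. 0) \<in> ?G" by (rule scale[OF imageI[OF z]])
  then show "0 \<in> gradient_graph \<Omega>"
    using closure_subset[of ?G] unfolding gradient_graph_def by auto
  show "p + q \<in> gradient_graph \<Omega>" if "p \<in> gradient_graph \<Omega>" "q \<in> gradient_graph \<Omega>" for p q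
  proof -
    from that obtain f g where "\<forall>n. f n \<in> ?G" "f \<longlonglongrightarrow> p" "\<forall>n. g n \<in> ?G" "g \<longlonglongrightarrow> q"
      unfolding gradient_graph_def closure_sequential by blast
    then have "\<forall>n. f n + g n \<in> ?G" "(\<lambda>n. f n + g n) \<longlonglongrightarrow> p + q"
      using add by (blast, intro tendsto_add)
    then show ?thesis unfolding gradient_graph_def closure_sequential by (auto intro!: exI[of _ "\<lambda>n. f n + g n"])
  qed
  show "r *\<^sub>R p \<in> gradient_graph \<Omega>" if "p \<in> gradient_graph \<Omega>" for r p
  proof -
    from that obtain f where "\<forall>n. f n \<in> ?G" "f \<longlonglongrightarrow> p"
      unfolding gradient_graph_def closure_sequential by blast
    then have "\<forall>n. r *\<^sub>R f n \<in> ?G" "(\<lambda>n. r *\<^sub>R f n) \<longlonglongrightarrow> r *\<^sub>R p"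
      using scale by (blast, intro tendsto_intros)
    then show ?thesis unfolding gradient_graph_def closure_sequential by (auto intro!: exI[of _ "\<lambda>n. r *\<^sub>R f n"])
  qed
qed

lemma closed_gradient_graph: "closed (gradient_graph \<Omega>)"
  by (simp add: gradient_graph_def)

lemma test_graph_in_gradient_graph: "\<phi> \<in> test_functions \<Omega> \<Longrightarrow> test_graph \<phi> \<in> gradient_graph \<Omega>"
  unfolding gradient_graph_def by (intro subsetD[OF closure_subset] imageI)

lemma fst_gradient_graph:
  fixes \<Omega> :: "(real ^ 'n) set"
  assumes "open \<Omega>" "p \<in> gradient_graph \<Omega>" shows "fst p \<in> L2_on \<Omega>"
proof -
  have "closed (fst -` L2_on \<Omega> :: ((real ^ 'n) L2 \<times> ((real ^ 'n) L2 ^ 'n)) set)"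
    using assms(1) by (intro closed_vimage closed_L2_on continuous_intros) auto
  then have "gradient_graph \<Omega> \<subseteq> fst -` L2_on \<Omega>"
    unfolding gradient_graph_def
    by (rule closure_minimal[rotated]) (auto simp: test_graph_def abs_test_in_L2_on)
  then show ?thesis using assms(2) by auto
qed

lemma gradient_test:
  assumes "open \<Omega>" "\<phi> \<in> test_functions \<Omega>"
  shows "(abs_L2 \<phi>, gradient \<Omega> (abs_L2 \<phi>)) = test_graph \<phi>"
  using weak_deriv_eqI[OF assms(1) _ is_weak_deriv_test[OF assms(2)], of "[axis _ 1]"]
  by (simp add: gradient_def test_graph_def vec_eq_iff del: partials.simps)

lemma laplacian_axis: "laplacian \<Omega> u = (\<Sum>i\<in>UNIV. weak_deriv \<Omega> [axis i 1, axis i 1] u)"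
  for u :: "(real ^ 'n) L2"
  by (simp add: laplacian_def sum_Basis_axis)

text \<open>On the graph of a test function this is the definition of the two weak derivatives,
  applied in turn; both sides are continuous in \<open>p\<close>, which extends it to the closure.
  The zero boundary values are carried by \<open>p\<close>.\<close>

lemma green_gradient_graph:
  fixes \<Omega> :: "(real ^ 'n) set"
  assumes "open \<Omega>" "u \<in> sobolev 2 \<Omega>" "p \<in> gradient_graph \<Omega>"
  shows "laplacian \<Omega> u \<bullet> fst p = - (gradient \<Omega> u \<bullet> snd p)"
proof -
  have test: "laplacian \<Omega> u \<bullet> fst (test_graph \<phi>) = - (gradient \<Omega> u \<bullet> snd (test_graph \<phi>))"
    if \<phi>: "\<phi> \<in> test_functions \<Omega>" for \<phi>
  proof -
    have "weak_deriv \<Omega> [axis i 1, axis i 1] u \<bullet> abs_L2 \<phi>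
        = - (weak_deriv \<Omega> [axis i 1] u \<bullet> abs_L2 (partials [axis i 1] \<phi>))" for i
    proof -
      have 2: "is_weak_deriv \<Omega> [axis i 1, axis i 1] u (weak_deriv \<Omega> [axis i 1, axis i 1] u)"
        by (rule is_weak_deriv_weak_deriv[OF assms(1,2)]) auto
      have 1: "is_weak_deriv \<Omega> [axis i 1] u (weak_deriv \<Omega> [axis i 1] u)"
        by (rule is_weak_deriv_weak_deriv[OF assms(1,2)]) auto
      have "weak_deriv \<Omega> [axis i 1, axis i 1] u \<bullet> abs_L2 \<phi> = u \<bullet> abs_L2 (partials [axis i 1, axis i 1] \<phi>)"
        using 2 \<phi> by (subst (asm) is_weak_deriv_iff_inner) auto
      also have "\<dots> = u \<bullet> abs_L2 (partials [axis i 1] (partials [axis i 1] \<phi>))" by simp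
      also have "\<dots> = - (weak_deriv \<Omega> [axis i 1] u \<bullet> abs_L2 (partials [axis i 1] \<phi>))"
        using 1 test_partials[OF \<phi>, of "[axis i 1]"] by (subst (asm) is_weak_deriv_iff_inner) auto
      finally show ?thesis .
    qed
    then show ?thesis
      by (simp add: laplacian_axis test_graph_def gradient_def inner_sum_left inner_vec_def sum_negf
          del: partials.simps)
  qed
  have "closed {p. laplacian \<Omega> u \<bullet> fst p = - (gradient \<Omega> u \<bullet> snd p)}"
    by (intro closed_Collect_eq continuous_intros)
  then have "gradient_graph \<Omega> \<subseteq> {p. laplacian \<Omega> u \<bullet> fst p = - (gradient \<Omega> u \<bullet> snd p)}"
    unfolding gradient_graph_def by (rule closure_minimal[rotated]) (auto simp: test)
  then show ?thesis using assms(3) by blast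
qed

text \<open>The \<open>H1_norm\<close> of the difference with a test function is exactly the
  distance of the two graph points, so approximation in H^1 is approximation in the graph.\<close>

lemma gradient_in_gradient_graph:
  assumes "open \<Omega>" "u \<in> H10 \<Omega>"
  shows "(u, gradient \<Omega> u) \<in> gradient_graph \<Omega>"
  unfolding gradient_graph_def closure_approachable
proof (intro allI impI)
  fix e :: real assume "e > 0"
  then obtain \<phi> where \<phi>: "\<phi> \<in> test_functions \<Omega>" "H1_norm \<Omega> (u - abs_L2 \<phi>) < e"
    using assms(2) by (auto simp: H10_def)
  have u: "u \<in> sobolev 1 \<Omega>" using assms(2) by (simp add: H10_def)
  have "weak_deriv \<Omega> [axis i 1] (u - abs_L2 \<phi>)
      = weak_deriv \<Omega> [axis i 1] u - abs_L2 (partials [axis i 1] \<phi>)" for i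
  proof (rule weak_deriv_eqI[OF assms(1)])
    have "is_weak_deriv \<Omega> [axis i 1] u (weak_deriv \<Omega> [axis i 1] u)"
      by (rule is_weak_deriv_weak_deriv[OF assms(1) u]) auto
    moreover have "is_weak_deriv \<Omega> [axis i 1] ((- 1) *\<^sub>R abs_L2 \<phi>) ((- 1) *\<^sub>R abs_L2 (partials [axis i 1] \<phi>))"
      using is_weak_deriv_scaleR[OF assms(1) _ is_weak_deriv_test[OF \<phi>(1), of "[axis i 1]"], of "- 1"]
      by (simp del: partials.simps)
    ultimately have "is_weak_deriv \<Omega> [axis i 1] (u + (- 1) *\<^sub>R abs_L2 \<phi>)
        (weak_deriv \<Omega> [axis i 1] u + (- 1) *\<^sub>R abs_L2 (partials [axis i 1] \<phi>))"
      by (rule is_weak_deriv_add[OF assms(1), rotated]) simp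
    then show "is_weak_deriv \<Omega> [axis i 1] (u - abs_L2 \<phi>)
        (weak_deriv \<Omega> [axis i 1] u - abs_L2 (partials [axis i 1] \<phi>))"
      by (simp del: partials.simps)
  qed simp
  then have "H1_norm \<Omega> (u - abs_L2 \<phi>) = norm ((u, gradient \<Omega> u) - test_graph \<phi>)"
    by (simp add: H1_norm_def test_graph_def norm_Pair gradient_def norm_vec_def L2_set_def sum_Basis_axis
        sum_nonneg del: partials.simps)
  then show "\<exists>p\<in>test_graph ` test_functions \<Omega>. dist p (u, gradient \<Omega> u) < e"
    using \<phi> by (auto simp: dist_norm norm_minus_commute)
qed

text \<open>\<open>dirichlet_resolvent \<Omega>\<close> is \<open>(1 - \<Delta>)\<^sup>-\<^sup>1\<close> for the weak (form) Dirichlet Laplacian. No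
  regularity of its values is needed below: they are only paired with functions that do lie in
  \<open>H\<^sup>2(\<Omega>) \<inter> H\<^sub>0\<^sup>1(\<Omega>)\<close>.\<close>

definition dirichlet_resolvent :: "(real ^ 'n) set \<Rightarrow> (real ^ 'n) L2 \<Rightarrow> (real ^ 'n) L2"
  where "dirichlet_resolvent \<Omega> f = fst (proj (gradient_graph \<Omega>) (f, 0))"

lemmas gradient_graph_proj_in = proj_in[OF subspace_gradient_graph closed_gradient_graph]
lemmas gradient_graph_proj_orthogonal = proj_orthogonal[OF subspace_gradient_graph closed_gradient_graph]
lemmas gradient_graph_proj_unique = proj_unique[OF subspace_gradient_graph closed_gradient_graph]

lemma linear_dirichlet_resolvent:
  fixes \<Omega> :: "(real ^ 'n) set"
  shows "linear (dirichlet_resolvent \<Omega>)"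
proof (rule linearI)
  let ?V = "gradient_graph \<Omega>"
  note V = subspace_gradient_graph[of \<Omega>]
  have "proj ?V (f + g, 0) = proj ?V (f, 0) + proj ?V (g, 0)" for f g :: "(real ^ 'n) L2"
  proof (rule gradient_graph_proj_unique)
    show "proj ?V (f, 0) + proj ?V (g, 0) \<in> ?V"
      by (intro subspace_add[OF V] gradient_graph_proj_in)
    fix v assume v: "v \<in> ?V"
    have "(f + g, 0) - (proj ?V (f, 0) + proj ?V (g, 0)) = ((f, 0) - proj ?V (f, 0)) + ((g, 0) - proj ?V (g, 0))"
      by (simp add: prod_eq_iff)
    then show "((f + g, 0) - (proj ?V (f, 0) + proj ?V (g, 0))) \<bullet> v = 0"
      by (simp only: inner_add_left gradient_graph_proj_orthogonal[OF v] add_0)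
  qed
  then show "dirichlet_resolvent \<Omega> (f + g) = dirichlet_resolvent \<Omega> f + dirichlet_resolvent \<Omega> g" for f g
    by (simp add: dirichlet_resolvent_def)
  have "proj ?V (r *\<^sub>R f, 0) = r *\<^sub>R proj ?V (f, 0)" for r and f :: "(real ^ 'n) L2"
  proof (rule gradient_graph_proj_unique)
    show "r *\<^sub>R proj ?V (f, 0) \<in> ?V"
      by (intro subspace_scale[OF V] gradient_graph_proj_in)
    fix v assume v: "v \<in> ?V"
    have "(r *\<^sub>R f, 0) - r *\<^sub>R proj ?V (f, 0) = r *\<^sub>R ((f, 0) - proj ?V (f, 0))"
      by (simp add: prod_eq_iff scaleR_diff_right)
    then show "((r *\<^sub>R f, 0) - r *\<^sub>R proj ?V (f, 0)) \<bullet> v = 0"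
      by (simp only: inner_scaleR_left gradient_graph_proj_orthogonal[OF v] mult_zero_right)
  qed
  then show "dirichlet_resolvent \<Omega> (r *\<^sub>R f) = r *\<^sub>R dirichlet_resolvent \<Omega> f" for r f
    by (simp add: dirichlet_resolvent_def)
qed

text \<open>Paired with a point of the subspace, \<open>(f, 0)\<close> may be replaced by its
  projection. This exhibits the symmetry of the resolvent and turns its quadratic form into a
  squared H^1 norm.\<close>

lemma inner_dirichlet_resolvent:
  "f \<bullet> dirichlet_resolvent \<Omega> g = proj (gradient_graph \<Omega>) (f, 0) \<bullet> proj (gradient_graph \<Omega>) (g, 0)"
  using gradient_graph_proj_orthogonal[OF gradient_graph_proj_in[where x = "(g, 0)" and \<Omega> = \<Omega>],
      where x = "(f, 0)"]
  by (simp add: inner_diff_left dirichlet_resolvent_def inner_prod_def)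

lemma dirichlet_resolvent_symmetric:
  "dirichlet_resolvent \<Omega> f \<bullet> g = f \<bullet> dirichlet_resolvent \<Omega> g"
  by (subst inner_commute) (simp add: inner_dirichlet_resolvent inner_commute)

lemma norm_dirichlet_resolvent_le: "norm (dirichlet_resolvent \<Omega> f) \<le> norm f"
proof -
  let ?p = "proj (gradient_graph \<Omega>) (f, 0)"
  have "(norm ?p)\<^sup>2 = (f, 0) \<bullet> ?p"
    using gradient_graph_proj_orthogonal[OF gradient_graph_proj_in, where x = "(f, 0)" and \<Omega> = \<Omega>]
    by (simp add: inner_diff_left power2_norm_eq_inner)
  also have "\<dots> \<le> norm (f, 0 :: (real ^ 'a) L2 ^ 'a) * norm ?p" by (rule norm_cauchy_schwarz)
  finally have "norm ?p \<le> norm f"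
    by (cases "norm ?p = 0") (auto simp: power2_eq_square norm_Pair)
  moreover have "norm (dirichlet_resolvent \<Omega> f) \<le> norm ?p"
    unfolding dirichlet_resolvent_def by (metis norm_fst_le prod.collapse)
  ultimately show ?thesis by simp
qed

lemma dirichlet_resolvent_in_L2_on: "open \<Omega> \<Longrightarrow> dirichlet_resolvent \<Omega> f \<in> L2_on \<Omega>"
  unfolding dirichlet_resolvent_def by (intro fst_gradient_graph gradient_graph_proj_in)

text \<open>Orthogonality of (f, 0) - p to the graph is the weak form of w - \<Delta> w = f for the
  first component w of p, tested here with \<open>u\<close>. Green's formula then lets the Laplacian
  fall on the regular function \<open>u\<close> and not on the resolvent.\<close>

lemma inner_laplacian_dirichlet_resolvent:
  assumes "open \<Omega>" "u \<in> sobolev 2 \<Omega>" "u \<in> H10 \<Omega>"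
  shows "- laplacian \<Omega> u \<bullet> dirichlet_resolvent \<Omega> f = u \<bullet> (f - dirichlet_resolvent \<Omega> f)"
proof -
  let ?p = "proj (gradient_graph \<Omega>) (f, 0)"
  have "((f, 0) - ?p) \<bullet> (u, gradient \<Omega> u) = 0"
    by (rule gradient_graph_proj_orthogonal[OF gradient_in_gradient_graph[OF assms(1,3)]])
  then have "(f - fst ?p) \<bullet> u = snd ?p \<bullet> gradient \<Omega> u"
    by (simp add: inner_prod_def)
  also have "\<dots> = - laplacian \<Omega> u \<bullet> fst ?p"
    using green_gradient_graph[OF assms(1,2) gradient_graph_proj_in, of "(f, 0)"]
    by (simp add: inner_commute)
  finally show ?thesis by (simp add: dirichlet_resolvent_def inner_commute)
qed

lemma test_in_sobolev:
  assumes "\<phi> \<in> test_functions \<Omega>" shows "abs_L2 \<phi> \<in> sobolev k \<Omega>"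
  using is_weak_deriv_test[OF assms] abs_test_in_L2_on[OF assms] by (auto simp: sobolev_def)

text \<open>A test function solves the weak equation for this \<open>f\<close>, and the projection
  is unique. The explicit values serve to verify the hypothesis of
  \<open>approximate_eigenvalue_below\<close>.\<close>

lemma dirichlet_resolvent_test:
  assumes "open \<Omega>" "\<phi> \<in> test_functions \<Omega>"
  defines "f \<equiv> abs_L2 \<phi> - laplacian \<Omega> (abs_L2 \<phi>)"
  shows "dirichlet_resolvent \<Omega> f = abs_L2 \<phi>"
    and "f \<bullet> dirichlet_resolvent \<Omega> f
      = (norm (abs_L2 \<phi>))\<^sup>2 + (\<Sum>i\<in>UNIV. (norm (abs_L2 (partials [axis i 1] \<phi>)))\<^sup>2)"
proof -
  have p: "proj (gradient_graph \<Omega>) (f, 0) = test_graph \<phi>"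
  proof (rule gradient_graph_proj_unique[OF test_graph_in_gradient_graph[OF assms(2)]])
    fix v assume v: "v \<in> gradient_graph \<Omega>"
    have "laplacian \<Omega> (abs_L2 \<phi>) \<bullet> fst v = - (gradient \<Omega> (abs_L2 \<phi>) \<bullet> snd v)"
      by (rule green_gradient_graph[OF assms(1) test_in_sobolev[OF assms(2)] v])
    then show "((f, 0) - test_graph \<phi>) \<bullet> v = 0"
      by (simp add: f_def inner_prod_def inner_diff_left flip: gradient_test[OF assms(1,2)])
  qed
  show "dirichlet_resolvent \<Omega> f = abs_L2 \<phi>"
    by (simp add: dirichlet_resolvent_def p test_graph_def)
  show "f \<bullet> dirichlet_resolvent \<Omega> f
      = (norm (abs_L2 \<phi>))\<^sup>2 + (\<Sum>i\<in>UNIV. (norm (abs_L2 (partials [axis i 1] \<phi>)))\<^sup>2)"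
    unfolding inner_dirichlet_resolvent p
    by (simp add: test_graph_def inner_vec_def power2_norm_eq_inner del: partials.simps)
qed

section \<open>Rapid oscillation and quasimodes\<close>

lemma has_derivative_cis_ridge:
  fixes e :: "'a::euclidean_space"
  shows "((\<lambda>x. cis (x \<bullet> e)) has_derivative (\<lambda>y. (y \<bullet> e) *\<^sub>R (\<i> * cis (x \<bullet> e)))) (at x)"
proof -
  have "(cis has_vector_derivative \<i> * cis (x \<bullet> e + 0)) (at (x \<bullet> e + 0))"
    unfolding cis_conv_exp
    by (rule has_vector_derivative_real_field[where f = "\<lambda>z. exp (\<i> * z)"])
      (auto intro!: derivative_eq_intros)
  from has_derivative_ridge[OF this] show ?thesis by simp
qed

text \<open>For a real envelope \<beta> with j-th derivative \<beta>', the derivative of \<beta>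
  exp(i k x_j) is (\<beta>' + i k \<beta>) exp(i k x_j). The two parts are perpendicular in the
  complex plane, so the modulus is pointwise at least |k| \<beta>, whatever the slope of the
  envelope.\<close>

lemma oscillating_test_functions:
  fixes \<Omega> :: "(real ^ 'n) set"
  assumes "open \<Omega>" "\<Omega> \<noteq> {}"
  obtains \<phi> where "\<phi> \<in> test_functions \<Omega>" "abs_L2 \<phi> \<noteq> 0"
    "k\<^sup>2 * (norm (abs_L2 \<phi>))\<^sup>2 \<le> (norm (abs_L2 (partials [axis j 1] \<phi>)))\<^sup>2"
proof -
  obtain x where "x \<in> \<Omega>" using assms(2) by blast
  then obtain l u where lu: "cbox l u \<subseteq> \<Omega>" "x \<in> box l u"
    using open_contains_cbox[OF assms(1)] by metis
  define \<beta> where "\<beta> x = complex_of_real (bump 1 l u x)" for x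
  define c where "c x = cis (x \<bullet> (k *\<^sub>R axis j 1))" for x :: "real ^ 'n"
  define \<phi> where "\<phi> x = \<beta> x * c x" for x
  have \<beta>: "\<beta> \<in> test_functions \<Omega>"
    using test_bump[OF lu(1), of 1 1] by (simp add: \<beta>_def[abs_def])
  have "smooth c" unfolding c_def by (rule smooth_cis)
  then have \<phi>: "\<phi> \<in> test_functions \<Omega>"
    unfolding \<phi>_def by (rule test_mult[OF \<beta>])
  have c1: "cmod (c x) = 1" for x by (simp add: c_def)
  have sq: "square_integrable \<phi>" "square_integrable (partials [axis j 1] \<phi>)"
    using \<phi> by (auto intro!: test_square_integrable[of _ \<Omega>] test_partials simp del: partials.simps)
  have "k\<^sup>2 * (cmod (\<phi> x))\<^sup>2 \<le> (cmod (partials [axis j 1] \<phi> x))\<^sup>2" for x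
  proof -
    let ?d = "frechet_derivative (bump 1 l u) (at x) (axis j 1)"
    have "((\<lambda>x. \<phi> x) has_derivative (\<lambda>y. \<beta> x * ((y \<bullet> (k *\<^sub>R axis j 1)) *\<^sub>R (\<i> * c x))
        + complex_of_real (frechet_derivative (bump 1 l u) (at x) y) * c x)) (at x)"
      unfolding \<phi>_def \<beta>_def c_def
      by (intro has_derivative_mult has_derivative_cis_ridge has_derivative_of_real
          smooth_has_derivative smooth_bump)
    from frechet_derivative_at_eq[OF this, of "axis j 1"]
    have "partials [axis j 1] \<phi> x = Complex ?d (bump 1 l u x * k) * c x"
      by (simp add: \<beta>_def inner_axis_axis complex_eq_iff algebra_simps)
    then have "(cmod (partials [axis j 1] \<phi> x))\<^sup>2 = ?d\<^sup>2 + (bump 1 l u x * k)\<^sup>2"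
      by (simp add: norm_mult c1 cmod_power2 del: partials.simps)
    moreover have "(cmod (\<phi> x))\<^sup>2 = (bump 1 l u x)\<^sup>2"
      by (simp add: \<phi>_def \<beta>_def norm_mult c1)
    ultimately show ?thesis by (simp add: power_mult_distrib mult.commute del: partials.simps)
  qed
  then have "k\<^sup>2 * (norm (abs_L2 \<phi>))\<^sup>2 \<le> (norm (abs_L2 (partials [axis j 1] \<phi>)))\<^sup>2"
    unfolding norm_abs_L2[OF sq(1)] norm_abs_L2[OF sq(2)] integral_mult_right_zero[symmetric]
    using sq by (intro integral_mono) (auto simp: square_integrable_def simp del: partials.simps)
  moreover have "abs_L2 \<phi> \<noteq> 0"
  proof
    assume "abs_L2 \<phi> = 0"
    then have "(LINT x|lborel. (cmod (\<phi> x))\<^sup>2) = 0" using norm_abs_L2[OF sq(1)] by simp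
    then have "AE x in lborel. \<phi> x = 0"
      using sq(1) by (subst (asm) integral_nonneg_eq_0_iff_AE) (auto simp: square_integrable_def)
    moreover have "\<phi> x \<noteq> 0" if "x \<in> box l u" for x
      using bump_pos[of 1 x l u] that c1[of x] by (auto simp: \<phi>_def \<beta>_def)
    ultimately have "AE x in lborel. x \<notin> box l u" by auto
    then have "emeasure lborel (box l u) = 0"
      by (subst (asm) AE_iff_measurable[of "box l u"]) auto
    moreover have "l \<bullet> b < u \<bullet> b" if "b \<in> Basis" for b
      using lu(2) that by (auto simp: mem_box intro: less_trans)
    then have "emeasure lborel (box l u) = ennreal (\<Prod>b\<in>Basis. (u - l) \<bullet> b)" "0 < (\<Prod>b\<in>Basis. (u - l) \<bullet> b)"
      by (auto simp: less_imp_le inner_diff_left intro!: prod_pos)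
    ultimately have "ennreal (\<Prod>b\<in>Basis. (u - l) \<bullet> b) = 0" by metis
    with \<open>0 < (\<Prod>b\<in>Basis. (u - l) \<bullet> b)\<close> show False by (simp only: ennreal_eq_0_iff)
  qed
  ultimately show thesis using that \<phi> by blast
qed

text \<open>\<open>\<psi>1\<close> and \<open>\<psi>2\<close> stand for -\<Delta> and \<Delta>^2
  applied to \<open>\<phi>\<close>, defined only through duality with H^2 \<inter> H_0^1. The second
  order is included because the heat equation contains \<Delta>^2 \<theta>.\<close>

definition dirichlet_quasimode :: "(real ^ 'n) set \<Rightarrow> real \<Rightarrow> real \<Rightarrow> (real ^ 'n) L2 \<Rightarrow> bool"
  where "dirichlet_quasimode \<Omega> \<delta> \<mu> \<phi> \<longleftrightarrow> \<phi> \<in> L2_on \<Omega> \<and> norm \<phi> = 1 \<and> (\<exists>\<psi>1 \<psi>2.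
    norm (\<psi>1 - \<mu> *\<^sub>R \<phi>) \<le> \<delta> \<and> norm (\<psi>2 - \<mu>\<^sup>2 *\<^sub>R \<phi>) \<le> \<delta> \<and>
    (\<forall>u \<in> sobolev 2 \<Omega> \<inter> H10 \<Omega>. - laplacian \<Omega> u \<bullet> \<phi> = u \<bullet> \<psi>1 \<and> - laplacian \<Omega> u \<bullet> \<psi>1 = u \<bullet> \<psi>2))"

text \<open>The order of quantifiers matters: \<open>\<mu>\<close> is fixed before
  \<open>\<delta>\<close>, so the accuracy may later depend on \<open>\<mu>\<close>.\<close>

lemma dirichlet_quasimodes:
  fixes \<Omega> :: "(real ^ 'n) set"
  assumes "open \<Omega>" "\<Omega> \<noteq> {}"
  shows "\<exists>\<mu>>M. \<forall>\<delta>>0. \<exists>\<phi>. dirichlet_quasimode \<Omega> \<delta> \<mu> \<phi>"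
proof -
  let ?T = "dirichlet_resolvent \<Omega>"
  \<comment> \<open>From \<nu> < 1 / K one gets 1 / \<nu> - 1 > K - 1 = |M| + 1 > M. The same
    \<open>K\<close> is the wave number of the oscillating function, and K >= 2 ensures \<epsilon> <
    1.\<close>
  define K where "K = \<bar>M\<bar> + 2"
  define \<epsilon> where "\<epsilon> = 1 / K"
  have K: "K \<ge> 2" by (simp add: K_def)
  then have \<epsilon>: "0 < \<epsilon>" "\<epsilon> < 1" by (auto simp: \<epsilon>_def)
  obtain \<phi> where \<phi>: "\<phi> \<in> test_functions \<Omega>" "abs_L2 \<phi> \<noteq> 0"
    "K\<^sup>2 * (norm (abs_L2 \<phi>))\<^sup>2 \<le> (norm (abs_L2 (partials [axis undefined 1] \<phi>)))\<^sup>2"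
    using oscillating_test_functions[OF assms] by blast
  define f where "f = abs_L2 \<phi> - laplacian \<Omega> (abs_L2 \<phi>)"
  \<comment> \<open>Since T f is the test function itself, this says that \<open>K\<close> times its
    squared L2 norm is below its squared H^1 norm.\<close>
  have "(norm (?T f))\<^sup>2 < \<epsilon> * (f \<bullet> ?T f)"
  proof -
    have pos: "(norm (abs_L2 \<phi>))\<^sup>2 > 0" using \<phi>(2) by simp
    have "K * (norm (abs_L2 \<phi>))\<^sup>2 < K\<^sup>2 * (norm (abs_L2 \<phi>))\<^sup>2 + (norm (abs_L2 \<phi>))\<^sup>2"
    proof -
      have "K * (norm (abs_L2 \<phi>))\<^sup>2 \<le> K\<^sup>2 * (norm (abs_L2 \<phi>))\<^sup>2"
        using K by (intro mult_right_mono) (auto simp: power2_eq_square)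
      then show ?thesis using pos by linarith
    qed
    also have "\<dots> \<le> (norm (abs_L2 (partials [axis undefined 1] \<phi>)))\<^sup>2 + (norm (abs_L2 \<phi>))\<^sup>2"
      using \<phi>(3) by simp
    also have "\<dots> \<le> f \<bullet> ?T f"
      unfolding f_def dirichlet_resolvent_test(2)[OF assms(1) \<phi>(1)]
      using member_le_sum[of undefined UNIV "\<lambda>i. (norm (abs_L2 (partials [axis i 1] \<phi>)))\<^sup>2"] by simp
    finally show ?thesis
      using K by (simp add: dirichlet_resolvent_test(1)[OF assms(1) \<phi>(1), folded f_def] \<epsilon>_def field_simps)
  qed
  then obtain \<nu> where \<nu>: "0 < \<nu>" "\<nu> < \<epsilon>"
    "\<And>\<delta>. \<delta> > 0 \<Longrightarrow> \<exists>x. norm x = 1 \<and> norm (?T x - \<nu> *\<^sub>R x) \<le> \<delta>"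
    using approximate_eigenvalue_below[OF linear_dirichlet_resolvent dirichlet_resolvent_symmetric
        norm_dirichlet_resolvent_le \<epsilon>(1)] by blast
  have "\<nu> < 1" using \<nu> \<epsilon> by simp
  have "K < 1 / \<nu>" using \<nu> K by (simp add: \<epsilon>_def field_simps)
  then have \<mu>: "1 / \<nu> - 1 > M" by (simp add: K_def)
  show ?thesis
  proof (intro exI[of _ "1 / \<nu> - 1"] conjI \<mu> allI impI)
    fix \<delta> :: real assume "\<delta> > 0"
    then obtain x where x: "norm (?T (?T x)) = 1"
      "norm ((?T x - ?T (?T x)) - (1 / \<nu> - 1) *\<^sub>R ?T (?T x)) \<le> \<delta>"
      "norm ((x - 2 *\<^sub>R ?T x + ?T (?T x)) - (1 / \<nu> - 1)\<^sup>2 *\<^sub>R ?T (?T x)) \<le> \<delta>"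
      using approximate_eigenvector_inverse[OF linear_dirichlet_resolvent norm_dirichlet_resolvent_le
          \<nu>(1) \<open>\<nu> < 1\<close> \<nu>(3)] by blast
    have 1: "- laplacian \<Omega> u \<bullet> ?T (?T x) = u \<bullet> (?T x - ?T (?T x))"
      and 2: "- laplacian \<Omega> u \<bullet> (?T x - ?T (?T x)) = u \<bullet> (x - 2 *\<^sub>R ?T x + ?T (?T x))"
      if "u \<in> sobolev 2 \<Omega> \<inter> H10 \<Omega>" for u
      using that inner_laplacian_dirichlet_resolvent[OF assms(1), of u]
      by (auto simp: inner_diff_right inner_add_right algebra_simps scaleR_2)
    show "\<exists>\<phi>. dirichlet_quasimode \<Omega> \<delta> (1 / \<nu> - 1) \<phi>"
      unfolding dirichlet_quasimode_def
      using x 1 2 dirichlet_resolvent_in_L2_on[OF assms(1)] by blast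
  qed
qed

section \<open>An energy estimate for the scalar system\<close>

text \<open>By the differential inequality, exp (K t) (G + F / K) is nondecreasing. The sign of
  \<open>G\<close> is left open, as the energy to which this is applied is indefinite.\<close>

lemma gronwall_below:
  fixes G :: "real \<Rightarrow> real"
  assumes "K > 0" and cont: "continuous_on {0..1} G"
    and der: "\<And>t. 0 < t \<Longrightarrow> t < 1 \<Longrightarrow> (G has_real_derivative G' t) (at t)"
    and bnd: "\<And>t. 0 < t \<Longrightarrow> t < 1 \<Longrightarrow> G' t \<ge> - K * G t - F"
  shows "G 0 + F / K \<le> exp K * (G 1 + F / K)"
proof -
  define H where "H t = exp (K * t) * (G t + F / K)" for t
  have "H 0 \<le> H 1"
  proof (rule DERIV_nonneg_imp_increasing_open[of 0 1 H])
    fix t :: real assume t: "0 < t" "t < 1"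
    have "(H has_real_derivative exp (K * t) * (K * G t + F + G' t)) (at t)"
      unfolding H_def using der[OF t] \<open>K > 0\<close>
      by (auto intro!: derivative_eq_intros simp: algebra_simps)
    moreover have "0 \<le> exp (K * t) * (K * G t + F + G' t)"
      using bnd[OF t] by (intro mult_nonneg_nonneg) auto
    ultimately show "\<exists>y. (H has_real_derivative y) (at t) \<and> 0 \<le> y" by blast
  qed (auto simp: H_def intro!: continuous_intros cont)
  then show ?thesis by (simp add: H_def)
qed

text \<open>The initial state need not lie in the domain of the generator, so only continuity is
  asked at t = 0, and the derivatives, which may blow up there, are bounded at t = 1 alone. The
  error B / \<mu>^2, multiplied by values of size B, matches the order of the energy at time
  1.\<close>

definition nearly_solves ::
    "real \<Rightarrow> real \<Rightarrow> real \<Rightarrow> real \<Rightarrow> real \<Rightarrow> real \<Rightarrow> real \<Rightarrow> real \<Rightarrow> (real \<Rightarrow> real) \<Rightarrow> (real \<Rightarrow> real) \<Rightarrow>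
      (real \<Rightarrow> real) \<Rightarrow> (real \<Rightarrow> real) \<Rightarrow> (real \<Rightarrow> real) \<Rightarrow> (real \<Rightarrow> real) \<Rightarrow> bool"
  where "nearly_solves \<rho> a b c d \<eta> \<mu> B p q r p' q' r' \<longleftrightarrow>
    continuous_on {0..1} p \<and> continuous_on {0..1} q \<and> continuous_on {0..1} r \<and>
    (\<forall>t\<in>{0<..1}.
      (p has_real_derivative p' t) (at t) \<and>
      (q has_real_derivative q' t) (at t) \<and>
      (r has_real_derivative r' t) (at t) \<and>
      \<bar>p' t - \<mu> * q t\<bar> \<le> B / \<mu>\<^sup>2 \<and>
      \<bar>\<rho> * q' t + c * \<mu> * p t + \<eta> * \<mu> * r t\<bar> \<le> B / \<mu>\<^sup>2 \<and>
      \<bar>a * r' t + (b * \<mu> + d * \<mu>\<^sup>2) * r t - \<eta> * \<mu> * q t\<bar> \<le> B / \<mu>\<^sup>2 \<and>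
      \<bar>p t\<bar> \<le> B \<and> \<bar>q t\<bar> \<le> B \<and> \<bar>r t\<bar> \<le> B) \<and>
    \<bar>p' 1\<bar> \<le> B \<and> \<bar>q' 1\<bar> \<le> B \<and> \<bar>r' 1\<bar> \<le> B \<and> p 0 = 0 \<and> r 0 = 0"

text \<open>With \<open>G = c p\<^sup>2 + \<rho> q\<^sup>2 - a r\<^sup>2\<close> the coupling terms cost only
  \<open>O(q\<^sup>2)\<close>, uniformly in \<open>\<mu>\<close>, because the dissipation of \<open>r\<close> enters \<open>G'\<close> with a good sign;
  so \<open>G\<close> decays at most exponentially at a rate independent of \<open>\<mu>\<close>. At time 1 the bound on the
  derivatives makes \<open>G\<close> of order \<open>1 / \<mu>\<^sup>2\<close>.\<close>

lemma nearly_solves_bound: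
  fixes \<rho> a b c d \<eta> :: real
  assumes pos: "\<rho> > 0" "a > 0" "b > 0" "c > 0" "d > 0" and "\<eta> \<noteq> 0"
  shows "\<exists>C. \<exists>M\<ge>1. \<forall>\<mu>\<ge>M. \<forall>B p q r p' q' r'.
    nearly_solves \<rho> a b c d \<eta> \<mu> B p q r p' q' r' \<longrightarrow> (\<mu> * q 0)\<^sup>2 \<le> C * B\<^sup>2"
proof -
  \<comment> \<open>\<open>K * \<rho>\<close> is 4 \<eta>^2 / d, the cost in q^2 of absorbing the
    coupling 4 \<eta> \<mu> q r into d \<mu>^2 r^2. \<open>M\<close> lets a second copy of d \<mu>^2
    r^2 absorb the term K a r^2 that appears when \<rho> q^2 is estimated by
    \<open>G\<close>.\<close>
  define K where "K = 4 * \<eta>\<^sup>2 / (d * \<rho>)"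
  have K: "K > 0" using pos \<open>\<eta> \<noteq> 0\<close> by (simp add: K_def)
  define M where "M = max 1 (K * a / d)"
  \<comment> \<open>\<open>C1\<close> and \<open>C2\<close> bound \<mu> |r| and \<mu> |p| at time 1
    in units of \<open>B\<close>, read off from the third and the second equation; \<open>C\<close>
    collects the energy at time 1 and the error term.\<close>
  define C1 where "C1 = (a + 2 * \<bar>\<eta>\<bar> + 1) / d"
  define C2 where "C2 = (\<bar>\<eta>\<bar> * C1 + \<rho> + 1) / c"
  define C where "C = exp K * (c * C2\<^sup>2 + 4 * \<rho> + (2 * c + 4) / K) / \<rho>"
  show ?thesis
  proof (rule exI[of _ C], rule exI[of _ M], intro conjI allI impI)
    show "M \<ge> 1" by (simp add: M_def)
    fix \<mu> B :: real and p q r p' q' r' :: "real \<Rightarrow> real"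
    assume M: "\<mu> \<ge> M" and sol: "nearly_solves \<rho> a b c d \<eta> \<mu> B p q r p' q' r'"
    have cont: "continuous_on {0..1} p" "continuous_on {0..1} q" "continuous_on {0..1} r"
      and bd1: "\<bar>p' 1\<bar> \<le> B" "\<bar>q' 1\<bar> \<le> B" "\<bar>r' 1\<bar> \<le> B" and zero: "p 0 = 0" "r 0 = 0"
      using sol by (simp_all add: nearly_solves_def)
    have dp: "(p has_real_derivative p' t) (at t)" and dq: "(q has_real_derivative q' t) (at t)"
      and dr: "(r has_real_derivative r' t) (at t)"
      and ep: "\<bar>p' t - \<mu> * q t\<bar> \<le> B / \<mu>\<^sup>2"
      and eq: "\<bar>\<rho> * q' t + c * \<mu> * p t + \<eta> * \<mu> * r t\<bar> \<le> B / \<mu>\<^sup>2"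
      and er: "\<bar>a * r' t + (b * \<mu> + d * \<mu>\<^sup>2) * r t - \<eta> * \<mu> * q t\<bar> \<le> B / \<mu>\<^sup>2"
      and bd: "\<bar>p t\<bar> \<le> B \<and> \<bar>q t\<bar> \<le> B \<and> \<bar>r t\<bar> \<le> B"
      if "0 < t" "t \<le> 1" for t
      using sol that unfolding nearly_solves_def by simp_all
    have \<mu>: "\<mu> \<ge> 1" "K * a / d \<le> \<mu>" using M by (auto simp: M_def)
    have B: "B \<ge> 0" using bd1(1) by linarith
    have \<mu>\<mu>: "\<mu> \<le> \<mu>\<^sup>2" using \<mu> by (simp add: power2_eq_square)
    have "K * a \<le> d * \<mu>" using \<mu>(2) pos by (simp add: field_simps)
    also have "\<dots> \<le> d * \<mu>\<^sup>2" using \<mu>\<mu> pos by simp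
    finally have Ka: "K * a \<le> d * \<mu>\<^sup>2" .
    define E where "E = B / \<mu>\<^sup>2"
    have E: "0 \<le> E" "E \<le> B"
      using B \<mu> by (auto simp: E_def divide_le_eq mult_le_cancel_left1)
    define F where "F = (2 * c + 4) * B * E"
    define G where "G t = c * (p t)\<^sup>2 + \<rho> * (q t)\<^sup>2 - a * (r t)\<^sup>2" for t
    define G' where "G' t = 2 * c * p t * p' t + 2 * \<rho> * q t * q' t - 2 * a * r t * r' t" for t
    have "G 0 + F / K \<le> exp K * (G 1 + F / K)"
    proof (rule gronwall_below[OF K])
      show "continuous_on {0..1} G" unfolding G_def by (intro continuous_intros cont)
      fix t :: real assume "0 < t" "t < 1"
      then have t: "0 < t" "t \<le> 1" by auto
      show "(G has_real_derivative G' t) (at t)"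
        unfolding G_def G'_def
        by (rule derivative_eq_intros dp[OF t] dq[OF t] dr[OF t] refl)+ (simp add: algebra_simps)
      define e1 where "e1 = p' t - \<mu> * q t"
      define e2 where "e2 = \<rho> * q' t + c * \<mu> * p t + \<eta> * \<mu> * r t"
      define e3 where "e3 = a * r' t + (b * \<mu> + d * \<mu>\<^sup>2) * r t - \<eta> * \<mu> * q t"
      have e: "\<bar>e1\<bar> \<le> E" "\<bar>e2\<bar> \<le> E" "\<bar>e3\<bar> \<le> E"
        using ep[OF t] eq[OF t] er[OF t] by (auto simp: e1_def e2_def e3_def E_def)
      have prod: "\<bar>x * y\<bar> \<le> B * E" if "\<bar>x\<bar> \<le> B" "\<bar>y\<bar> \<le> E" for x y
        using that B by (simp add: abs_mult mult_mono)
      have pe: "\<bar>p t * e1\<bar> \<le> B * E" "\<bar>q t * e2\<bar> \<le> B * E" "\<bar>r t * e3\<bar> \<le> B * E"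
        using bd[OF t] e by (auto intro!: prod)
      have c1: "2 * c * (p t * e1) \<ge> - (2 * c * (B * E))"
        using mult_left_mono[of "- (B * E)" "p t * e1" "2 * c"] pe(1) pos by simp
      \<comment> \<open>The terms in p q cancel between the first two equations. Those in q r add up
        to -4 \<eta> \<mu> q r because the sign of r^2 in \<open>G\<close> is reversed; the same
        reversal makes the dissipation contribute +2 (b \<mu> + d \<mu>^2) r^2.\<close>
      have "G' t = 2 * c * p t * (e1 + \<mu> * q t) + 2 * q t * (e2 - c * \<mu> * p t - \<eta> * \<mu> * r t)
          - 2 * r t * (e3 - (b * \<mu> + d * \<mu>\<^sup>2) * r t + \<eta> * \<mu> * q t)"
        by (simp add: G'_def e1_def e2_def e3_def algebra_simps)
      also have "\<dots> = 2 * b * \<mu> * (r t)\<^sup>2 + 2 * d * \<mu>\<^sup>2 * (r t)\<^sup>2 - 4 * (\<eta> * q t) * (\<mu> * r t)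
          + 2 * c * (p t * e1) + 2 * (q t * e2) - 2 * (r t * e3)"
        by (simp add: power2_eq_square algebra_simps)
      finally have 1: "G' t \<ge> 2 * d * \<mu>\<^sup>2 * (r t)\<^sup>2 - 4 * (\<eta> * q t) * (\<mu> * r t) - F"
      proof -
        assume G': "G' t = 2 * b * \<mu> * (r t)\<^sup>2 + 2 * d * \<mu>\<^sup>2 * (r t)\<^sup>2 - 4 * (\<eta> * q t) * (\<mu> * r t)
          + 2 * c * (p t * e1) + 2 * (q t * e2) - 2 * (r t * e3)"
        have "0 \<le> 2 * b * \<mu> * (r t)\<^sup>2" using pos \<mu> by simp
        moreover have "F = 2 * c * (B * E) + 4 * (B * E)" by (simp add: F_def algebra_simps)
        ultimately show ?thesis using G' c1 pe(2,3) by linarith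
      qed
      have "0 \<le> d * (\<mu> * r t - 2 * (\<eta> * q t) / d)\<^sup>2" using pos by simp
      also have "\<dots> = d * \<mu>\<^sup>2 * (r t)\<^sup>2 - 4 * (\<eta> * q t) * (\<mu> * r t) + K * (\<rho> * (q t)\<^sup>2)"
        using pos by (simp add: K_def power2_eq_square field_simps)
      finally have 2: "4 * (\<eta> * q t) * (\<mu> * r t) \<le> d * \<mu>\<^sup>2 * (r t)\<^sup>2 + K * (\<rho> * (q t)\<^sup>2)" by simp
      have 3: "\<rho> * (q t)\<^sup>2 \<le> G t + a * (r t)\<^sup>2" using pos by (simp add: G_def)
      have 4: "K * (\<rho> * (q t)\<^sup>2) \<le> K * G t + K * a * (r t)\<^sup>2"
        using mult_left_mono[OF 3, of K] K by (simp add: algebra_simps)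
      have 5: "K * a * (r t)\<^sup>2 \<le> d * \<mu>\<^sup>2 * (r t)\<^sup>2" using Ka by (intro mult_right_mono) auto
      show "- K * G t - F \<le> G' t" using 1 2 4 5 by simp
    qed
    moreover have "F / K \<ge> 0" using K E B pos by (simp add: F_def)
    \<comment> \<open>Starting with p = r = 0 leaves no negative part in \<open>G 0\<close>.\<close>
    moreover have "G 0 = \<rho> * (q 0)\<^sup>2" by (simp add: G_def zero)
    ultimately have G0: "\<rho> * (q 0)\<^sup>2 \<le> exp K * (G 1 + F / K)" by linarith
    \<comment> \<open>At time 1 the bounded derivatives are played back through the equations: p'
      controls \<mu> q, then r' controls \<mu> r, and finally q' controls \<mu> p.\<close>
    have q1: "\<mu> * \<bar>q 1\<bar> \<le> 2 * B"
    proof -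
      have "\<mu> * \<bar>q 1\<bar> = \<bar>\<mu> * q 1\<bar>" using \<mu> by (simp add: abs_mult)
      also have "\<dots> \<le> 2 * B" using ep[of 1] bd1(1) E by (auto simp: E_def)
      finally show ?thesis .
    qed
    have r1: "\<mu> * \<bar>r 1\<bar> \<le> C1 * B"
    proof -
      have "d * \<mu> * (\<mu> * \<bar>r 1\<bar>) \<le> \<bar>(b * \<mu> + d * \<mu>\<^sup>2) * r 1\<bar>"
      proof -
        have "0 \<le> b * \<mu> + d * \<mu>\<^sup>2" using pos \<mu> by simp
        then have "\<bar>(b * \<mu> + d * \<mu>\<^sup>2) * r 1\<bar> = (b * \<mu> + d * \<mu>\<^sup>2) * \<bar>r 1\<bar>" by (simp add: abs_mult)
        moreover have "d * \<mu>\<^sup>2 * \<bar>r 1\<bar> \<le> (b * \<mu> + d * \<mu>\<^sup>2) * \<bar>r 1\<bar>"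
          using pos \<mu> by (intro mult_right_mono) auto
        ultimately show ?thesis by (simp add: power2_eq_square mult.assoc)
      qed
      also have "\<dots> \<le> a * B + \<bar>\<eta>\<bar> * (\<mu> * \<bar>q 1\<bar>) + B"
      proof -
        have "\<bar>a * r' 1\<bar> \<le> a * B" using bd1(3) pos by (simp add: abs_mult)
        moreover have "\<bar>\<eta> * \<mu> * q 1\<bar> = \<bar>\<eta>\<bar> * (\<mu> * \<bar>q 1\<bar>)" using \<mu> by (simp add: abs_mult)
        ultimately show ?thesis using er[of 1] E(2) by (simp add: E_def)
      qed
      also have "\<dots> \<le> a * B + \<bar>\<eta>\<bar> * (2 * B) + B"
        using mult_left_mono[OF q1, of "\<bar>\<eta>\<bar>"] by simp
      also have "\<dots> = d * 1 * (C1 * B)" using pos by (simp add: C1_def field_simps)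
      finally have "d * \<mu> * (\<mu> * \<bar>r 1\<bar>) \<le> d * (C1 * B)" by simp
      then have "\<mu> * (\<mu> * \<bar>r 1\<bar>) \<le> C1 * B" using pos by (simp add: mult.assoc)
      moreover have "\<mu> * \<bar>r 1\<bar> \<le> \<mu> * (\<mu> * \<bar>r 1\<bar>)" using mult_right_mono[of 1 \<mu> "\<mu> * \<bar>r 1\<bar>"] \<mu> by simp
      ultimately show ?thesis by linarith
    qed
    have p1: "\<mu> * \<bar>p 1\<bar> \<le> C2 * B"
    proof -
      have "c * (\<mu> * \<bar>p 1\<bar>) = \<bar>c * \<mu> * p 1\<bar>" using pos \<mu> by (simp add: abs_mult)
      also have "\<dots> \<le> \<rho> * B + \<bar>\<eta>\<bar> * (\<mu> * \<bar>r 1\<bar>) + B"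
      proof -
        have "\<bar>\<rho> * q' 1\<bar> \<le> \<rho> * B" using bd1(2) pos by (simp add: abs_mult)
        moreover have "\<bar>\<eta> * \<mu> * r 1\<bar> = \<bar>\<eta>\<bar> * (\<mu> * \<bar>r 1\<bar>)" using \<mu> by (simp add: abs_mult)
        ultimately show ?thesis using eq[of 1] E(2) by (simp add: E_def)
      qed
      also have "\<dots> \<le> \<rho> * B + \<bar>\<eta>\<bar> * (C1 * B) + B"
        using mult_left_mono[OF r1, of "\<bar>\<eta>\<bar>"] by simp
      also have "\<dots> = c * (C2 * B)" using pos by (simp add: C2_def field_simps)
      finally show ?thesis using pos by simp
    qed
    have "\<mu>\<^sup>2 * G 1 \<le> c * (\<mu> * \<bar>p 1\<bar>)\<^sup>2 + \<rho> * (\<mu> * \<bar>q 1\<bar>)\<^sup>2"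
      using pos by (simp add: G_def power_mult_distrib algebra_simps)
    also have "\<dots> \<le> c * (C2 * B)\<^sup>2 + \<rho> * (2 * B)\<^sup>2"
      using p1 q1 pos \<mu> by (intro add_mono mult_left_mono power_mono) auto
    finally have G1: "\<mu>\<^sup>2 * G 1 \<le> (c * C2\<^sup>2 + 4 * \<rho>) * B\<^sup>2"
      by (simp add: power_mult_distrib algebra_simps)
    have F1: "\<mu>\<^sup>2 * (F / K) = (2 * c + 4) / K * B\<^sup>2"
      using \<mu> by (simp add: F_def E_def power2_eq_square)
    have "\<rho> * (\<mu> * q 0)\<^sup>2 = \<mu>\<^sup>2 * (\<rho> * (q 0)\<^sup>2)" by (simp add: power_mult_distrib)
    also have "\<dots> \<le> \<mu>\<^sup>2 * (exp K * (G 1 + F / K))" using G0 by (intro mult_left_mono) auto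
    also have "\<dots> = exp K * (\<mu>\<^sup>2 * G 1 + \<mu>\<^sup>2 * (F / K))" by (simp add: algebra_simps)
    also have "\<dots> \<le> exp K * ((c * C2\<^sup>2 + 4 * \<rho>) * B\<^sup>2 + (2 * c + 4) / K * B\<^sup>2)"
      unfolding F1 using G1 by (intro mult_left_mono add_right_mono) auto
    also have "\<dots> = \<rho> * (C * B\<^sup>2)" using pos by (simp add: C_def field_simps)
    finally show "(\<mu> * q 0)\<^sup>2 \<le> C * B\<^sup>2" using pos by simp
  qed
qed

section \<open>A gliding hump\<close>

text \<open>The vector is a series of terms +-3^-n \<phi>_n. Each sign agrees with what the earlier
  terms contribute to the n-th functional, so the partial sum reaches at least 3^-n there; the later
  terms have total norm at most 3^-n / 2 and cannot undo it. Against \<mu>_n >= 9^n at least 3^n / 2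
  is left.\<close>

lemma unbounded_functionals:
  fixes \<phi> :: "nat \<Rightarrow> 'h::{real_inner, banach}"
  assumes V: "subspace V" "closed V" and \<phi>: "\<And>n. \<phi> n \<in> V" "\<And>n. norm (\<phi> n) = 1"
    and \<mu>: "\<And>n. 9 ^ n \<le> \<mu> n"
  shows "\<exists>v\<in>V. \<forall>B. \<exists>n. B < \<mu> n * \<bar>v \<bullet> \<phi> n\<bar>"
proof -
  define s where "s x n = (if x \<bullet> \<phi> n \<ge> 0 then 1 else - 1 :: real)" for x n
  define X where "X = rec_nat 0 (\<lambda>n x. x + (s x n * (1 / 3) ^ n) *\<^sub>R \<phi> n)"
  have X: "X 0 = 0" "X (Suc n) = X n + (s (X n) n * (1 / 3) ^ n) *\<^sub>R \<phi> n" for n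
    by (simp_all add: X_def)
  define D where "D n = (s (X n) n * (1 / 3) ^ n) *\<^sub>R \<phi> n" for n
  have normD: "norm (D n) = (1 / 3) ^ n" for n by (simp add: D_def \<phi> s_def)
  have XV: "X n \<in> V" for n
    by (induction n) (auto simp: X subspace_0[OF V(1)] intro!: subspace_add[OF V(1)] subspace_scale[OF V(1)] \<phi>)
  have X_sum: "X n = (\<Sum>k<n. D k)" for n by (induction n) (auto simp: X D_def)
  have sn: "summable (\<lambda>n. norm (D n))" by (simp add: normD summable_geometric)
  then have sD: "summable D" by (rule summable_norm_cancel)
  define v where "v = suminf D"
  have "X \<longlonglongrightarrow> v" using summable_LIMSEQ[OF sD] by (simp add: v_def X_sum[abs_def])
  then have vV: "v \<in> V" using V(2) XV closed_sequentially by blast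
  have low: "(1 / 3) ^ n / 2 \<le> \<bar>v \<bullet> \<phi> n\<bar>" for n
  proof -
    have "v - X (Suc n) = (\<Sum>k. D (k + Suc n))"
      unfolding v_def X_sum using suminf_minus_initial_segment[OF sD, of "Suc n"] by simp
    then have "norm (v - X (Suc n)) \<le> (\<Sum>k. norm (D (k + Suc n)))"
      using summable_norm[OF summable_ignore_initial_segment[OF sn, of "Suc n"]] by simp
    also have "\<dots> = (\<Sum>k. (1 / 3) ^ Suc n * (1 / 3) ^ k)"
      by (simp only: normD power_add mult.commute)
    also have "\<dots> = (1 / 3) ^ n / 2"
      by (subst suminf_mult) (auto simp: summable_geometric suminf_geometric)
    finally have "norm (v - X (Suc n)) \<le> (1 / 3) ^ n / 2" .
    then have "\<bar>(v - X (Suc n)) \<bullet> \<phi> n\<bar> \<le> (1 / 3) ^ n / 2"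
      using Cauchy_Schwarz_ineq2[of "v - X (Suc n)" "\<phi> n"] by (simp add: \<phi>)
    moreover have "\<bar>X (Suc n) \<bullet> \<phi> n\<bar> \<ge> (1 / 3) ^ n"
    proof -
      have "\<phi> n \<bullet> \<phi> n = 1" using \<phi>(2)[of n] by (simp add: norm_eq_1)
      then have "X (Suc n) \<bullet> \<phi> n = X n \<bullet> \<phi> n + s (X n) n * (1 / 3) ^ n"
        by (simp add: X inner_add_left)
      moreover have "(1 / 3) ^ n > (0::real)" by simp
      ultimately show ?thesis by (auto simp: s_def)
    qed
    ultimately show ?thesis unfolding inner_diff_left by linarith
  qed
  have "\<exists>n. B < \<mu> n * \<bar>v \<bullet> \<phi> n\<bar>" for B
  proof -
    obtain n where n: "2 * B < 3 ^ n" using real_arch_pow[of 3 "2 * B"] by auto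
    have "(9 :: real) ^ n = 3 ^ n * 3 ^ n" by (simp flip: power_mult_distrib)
    then have "3 ^ n / 2 = 9 ^ n * ((1 / 3) ^ n / 2 :: real)"
      by (simp add: power_divide)
    also have "\<dots> \<le> \<mu> n * \<bar>v \<bullet> \<phi> n\<bar>"
      using \<mu>[of n] low[of n] by (intro mult_mono) (auto intro: order_trans[of 0 "9 ^ n"])
    finally show ?thesis using n by (intro exI[of _ n]) simp
  qed
  then show ?thesis using vV by blast
qed

section \<open>The semigroup tested against quasimodes\<close>

lemma laplacian_add:
  "open \<Omega> \<Longrightarrow> u \<in> sobolev 2 \<Omega> \<Longrightarrow> v \<in> sobolev 2 \<Omega> \<Longrightarrow>
    laplacian \<Omega> (u + v) = laplacian \<Omega> u + laplacian \<Omega> v"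
  by (simp add: laplacian_def weak_deriv_add[where k = 2] sum.distrib)

lemma laplacian_scaleR:
  "open \<Omega> \<Longrightarrow> u \<in> sobolev 2 \<Omega> \<Longrightarrow> laplacian \<Omega> (r *\<^sub>R u) = r *\<^sub>R laplacian \<Omega> u"
  by (simp add: laplacian_def weak_deriv_scaleR[where k = 2] scaleR_sum_right)

lemma laplacian_diff:
  assumes "open \<Omega>" "u \<in> sobolev 2 \<Omega>" "v \<in> sobolev 2 \<Omega>"
  shows "laplacian \<Omega> (u - v) = laplacian \<Omega> u - laplacian \<Omega> v"
  using laplacian_add[OF assms(1,2) subspace_scale[OF subspace_sobolev[OF assms(1)] assms(3), of "- 1"]]
    laplacian_scaleR[OF assms(1,3), of "- 1"] by simp

lemma laplacian_0: "open \<Omega> \<Longrightarrow> laplacian \<Omega> 0 = 0"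
  using laplacian_scaleR[OF _ subspace_0[OF subspace_sobolev], of \<Omega> 0] by simp

lemma laplacian_in_sobolev:
  "open \<Omega> \<Longrightarrow> u \<in> sobolev 4 \<Omega> \<Longrightarrow> laplacian \<Omega> u \<in> sobolev 2 \<Omega>"
  unfolding laplacian_def
  by (intro subspace_sum subspace_sobolev weak_deriv_in_sobolev) auto

lemma zero_in_H10:
  assumes "open \<Omega>" shows "0 \<in> H10 \<Omega>"
proof -
  have s: "0 \<in> sobolev 1 \<Omega>" by (rule subspace_0[OF subspace_sobolev[OF assms]])
  have "weak_deriv \<Omega> [b] 0 = 0" if "b \<in> Basis" for b
    using weak_deriv_scaleR[OF assms s, of "[b]" 0] that by simp
  then have "H1_norm \<Omega> (0 - abs_L2 (\<lambda>_. 0)) = 0"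
    by (simp add: H1_norm_def flip: zero_L2_def)
  moreover have "(\<lambda>_. 0) \<in> test_functions \<Omega>"
    unfolding test_functions_def by (auto intro!: exI[of _ "{}"])
  ultimately show ?thesis using s unfolding H10_def by force
qed

text \<open>Replacing u by its Laplacian turns convergence in the energy norm into ordinary
  convergence in a product of three L2 spaces, where the calculus of vector derivatives is
  available.\<close>

definition energy_coords :: "'a::euclidean_space set \<Rightarrow> 'a plate_state \<Rightarrow> 'a L2 \<times> 'a L2 \<times> 'a L2"
  where "energy_coords \<Omega> = (\<lambda>(u, v, \<theta>). (laplacian \<Omega> u, v, \<theta>))"

lemma norm_energy_coords_le:
  assumes "\<rho> > 0" "a > 0" "c > 0"
  shows "norm (energy_coords \<Omega> w) \<le> energy_norm \<Omega> \<rho> a c w / sqrt (min c (min \<rho> a))"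
proof (cases w)
  case (fields u v \<theta>)
  let ?m = "min c (min \<rho> a)"
  have m: "?m > 0" using assms by simp
  have "?m * (norm (energy_coords \<Omega> w))\<^sup>2
      = ?m * (norm (laplacian \<Omega> u))\<^sup>2 + ?m * (norm v)\<^sup>2 + ?m * (norm \<theta>)\<^sup>2"
    by (simp add: fields energy_coords_def norm_Pair algebra_simps)
  also have "\<dots> \<le> c * (norm (laplacian \<Omega> u))\<^sup>2 + \<rho> * (norm v)\<^sup>2 + a * (norm \<theta>)\<^sup>2"
    by (intro add_mono mult_right_mono) auto
  finally have "sqrt (?m * (norm (energy_coords \<Omega> w))\<^sup>2) \<le> energy_norm \<Omega> \<rho> a c w"
    by (simp add: fields energy_norm_def)
  then show ?thesis using m by (simp add: real_sqrt_mult pos_le_divide_eq mult.commute)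
qed

lemma energy_coords_tendsto:
  assumes "\<rho> > 0" "a > 0" "c > 0" "norm_tendsto (energy_norm \<Omega> \<rho> a c) f l F"
  shows "((\<lambda>h. energy_coords \<Omega> (f h - l)) \<longlongrightarrow> 0) F"
proof (rule Lim_null_comparison)
  show "\<forall>\<^sub>F h in F. norm (energy_coords \<Omega> (f h - l))
      \<le> energy_norm \<Omega> \<rho> a c (f h - l) / sqrt (min c (min \<rho> a))"
    using norm_energy_coords_le[OF assms(1-3)] by (intro always_eventually) blast
  have "((\<lambda>h. energy_norm \<Omega> \<rho> a c (f h - l) / sqrt (min c (min \<rho> a))) \<longlongrightarrow> 0 / sqrt (min c (min \<rho> a))) F"
    using assms unfolding norm_tendsto_def by (intro tendsto_divide tendsto_const) auto
  then show "((\<lambda>h. energy_norm \<Omega> \<rho> a c (f h - l) / sqrt (min c (min \<rho> a))) \<longlongrightarrow> 0) F" by simp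
qed

text \<open>\<open>weak_deriv\<close> is a definite description, so \<open>laplacian\<close> is
  additive only where the derivatives exist; hence the membership hypotheses here and in the next
  lemma.\<close>

lemma energy_coords_diff:
  assumes "open \<Omega>" "x \<in> energy_space \<Omega>" "y \<in> energy_space \<Omega>"
  shows "energy_coords \<Omega> (x - y) = energy_coords \<Omega> x - energy_coords \<Omega> y"
  using assms by (auto simp: energy_space_def energy_coords_def laplacian_diff)

lemma energy_coords_difference_quotient:
  assumes "open \<Omega>" "x \<in> energy_space \<Omega>" "y \<in> energy_space \<Omega>" "z \<in> energy_space \<Omega>"
  shows "energy_coords \<Omega> ((x - y) /\<^sub>R h - z) = (energy_coords \<Omega> x - energy_coords \<Omega> y) /\<^sub>R h - energy_coords \<Omega> z"
proof -
  note s = subspace_sobolev[OF assms(1), of 2]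
  show ?thesis
    using assms
    by (auto simp: energy_space_def energy_coords_def laplacian_diff laplacian_scaleR
        subspace_diff[OF s] subspace_scale[OF s])
qed

text \<open>By S (t + h) = S h S t, the right-hand half of the two-sided limit is the generator's
  limit at \<open>S t x\<close>; this puts the orbit into the domain and identifies the derivative.
  Strong continuity covers t = 0.\<close>

lemma orbit_energy_coords:
  assumes \<Omega>: "open \<Omega>" and pos: "\<rho> > 0" "a > 0" "c > 0"
    and C0: "C0_semigroup (energy_space \<Omega>) (energy_norm \<Omega> \<rho> a c) S"
    and gen: "is_generator (energy_space \<Omega>) (energy_norm \<Omega> \<rho> a c) S D A"
    and diff: "differentiable_semigroup (energy_space \<Omega>) (energy_norm \<Omega> \<rho> a c) S"
    and x: "x \<in> energy_space \<Omega>"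
  shows "t > 0 \<Longrightarrow> S t x \<in> D"
    and "t > 0 \<Longrightarrow> ((\<lambda>t. energy_coords \<Omega> (S t x)) has_vector_derivative
      energy_coords \<Omega> (A (S t x))) (at t)"
    and "continuous_on {0..1} (\<lambda>t. energy_coords \<Omega> (S t x))"
proof -
  let ?N = "energy_norm \<Omega> \<rho> a c" and ?X = "energy_space \<Omega>"
  define Y where "Y t = energy_coords \<Omega> (S t x)" for t
  have SX: "S t x \<in> ?X" if "t \<ge> 0" for t
    using C0 that x by (auto simp: C0_semigroup_def bounded_operator_def)
  have S0: "S 0 x = x" using C0 x by (auto simp: C0_semigroup_def)
  have main: "S t x \<in> D \<and> (Y has_vector_derivative energy_coords \<Omega> (A (S t x))) (at t)" if t: "t > 0" for t
  proof -
    obtain y where y: "y \<in> ?X" "norm_tendsto ?N (\<lambda>h. (S (t + h) x - S t x) /\<^sub>R h) y (at 0)"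
      using diff x t unfolding differentiable_semigroup_def by blast
    have "norm_tendsto ?N (\<lambda>h. (S h (S t x) - S t x) /\<^sub>R h) y (at_right 0)"
      unfolding norm_tendsto_def
    proof (rule Lim_transform_eventually)
      show "((\<lambda>h. ?N ((S (t + h) x - S t x) /\<^sub>R h - y)) \<longlongrightarrow> 0) (at_right 0)"
        using y(2) unfolding norm_tendsto_def by (rule tendsto_within_subset[OF _ subset_UNIV])
      show "\<forall>\<^sub>F h in at_right 0. ?N ((S (t + h) x - S t x) /\<^sub>R h - y) = ?N ((S h (S t x) - S t x) /\<^sub>R h - y)"
        using eventually_at_right_less[of 0]
      proof eventually_elim
        case (elim h)
        then have "S (h + t) x = S h (S t x)"
          using C0 x t by (auto simp: C0_semigroup_def)
        then show ?case by (simp add: add.commute)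
      qed
    qed
    then have D: "S t x \<in> D" "y = A (S t x)"
      using gen SX[OF less_imp_le[OF t]] y(1) unfolding is_generator_def by blast+
    have lim: "((\<lambda>h. energy_coords \<Omega> ((S (t + h) x - S t x) /\<^sub>R h - y)) \<longlongrightarrow> 0) (at 0)"
      by (rule energy_coords_tendsto[OF pos y(2)])
    \<comment> \<open>For h > -t the time t + h is positive; at negative times the values of
      \<open>S\<close> are arbitrary and may lie outside the energy space.\<close>
    have ev: "\<forall>\<^sub>F h in at 0. - t < h \<and> h \<noteq> 0"
    proof (intro eventually_conj)
      have "\<forall>\<^sub>F h in nhds 0. h \<in> {- t<..}"
        by (rule eventually_nhds_in_open) (use t in auto)
      then show "\<forall>\<^sub>F h in at 0. - t < h"
        by (simp add: eventually_at_filter eventually_mono)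
      show "\<forall>\<^sub>F h in at (0::real). h \<noteq> 0" by (simp add: eventually_at_filter)
    qed
    have "((\<lambda>h. norm (Y (t + h) - Y t - h *\<^sub>R energy_coords \<Omega> y) / norm h) \<longlongrightarrow> 0) (at 0)"
    proof (rule Lim_transform_eventually[OF tendsto_norm_zero[OF lim]])
      show "\<forall>\<^sub>F h in at 0. norm (energy_coords \<Omega> ((S (t + h) x - S t x) /\<^sub>R h - y))
          = norm (Y (t + h) - Y t - h *\<^sub>R energy_coords \<Omega> y) / norm h"
        using ev
      proof eventually_elim
        case (elim h)
        then have "energy_coords \<Omega> ((S (t + h) x - S t x) /\<^sub>R h - y) = (Y (t + h) - Y t) /\<^sub>R h - energy_coords \<Omega> y"
          unfolding Y_def using t by (intro energy_coords_difference_quotient \<Omega> SX y(1)) auto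
        also have "\<dots> = (Y (t + h) - Y t - h *\<^sub>R energy_coords \<Omega> y) /\<^sub>R h"
          using elim by (simp add: scaleR_diff_right)
        finally show ?case by (simp add: divide_inverse mult.commute)
      qed
    qed
    then have "(Y has_vector_derivative energy_coords \<Omega> y) (at t)"
      by (simp add: has_vector_derivative_def has_derivative_at bounded_linear_scaleR_left)
    with D show ?thesis by simp
  qed
  then show "t > 0 \<Longrightarrow> S t x \<in> D"
    and "t > 0 \<Longrightarrow> ((\<lambda>t. energy_coords \<Omega> (S t x)) has_vector_derivative
      energy_coords \<Omega> (A (S t x))) (at t)"
    by (auto simp: Y_def[abs_def])
  have "norm_tendsto ?N (\<lambda>t. S t x) x (at_right 0)" using C0 x by (auto simp: C0_semigroup_def)
  then have "((\<lambda>t. energy_coords \<Omega> (S t x - x)) \<longlongrightarrow> 0) (at_right 0)"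
    by (rule energy_coords_tendsto[OF pos])
  then have "((\<lambda>t. Y t - Y 0) \<longlongrightarrow> 0) (at_right 0)"
  proof (rule Lim_transform_eventually)
    show "\<forall>\<^sub>F t in at_right 0. energy_coords \<Omega> (S t x - x) = Y t - Y 0"
      using eventually_at_right_less[of 0]
    proof eventually_elim
      case (elim t)
      then show ?case
        unfolding Y_def S0 by (intro energy_coords_diff \<Omega> SX x) auto
    qed
  qed
  then have "(Y \<longlongrightarrow> Y 0) (at_right 0)" by (simp add: LIM_zero_iff)
  then have c0: "continuous (at 0 within {0..1}) Y"
    by (simp add: continuous_within at_within_Icc_at_right)
  have "continuous (at t within {0..1}) Y" if "t \<in> {0..1}" for t
  proof (cases "t = 0")
    case False
    then have "t > 0" using that by simp
    then show ?thesis
      using main has_vector_derivative_continuous continuous_at_imp_continuous_within by blast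
  qed (use c0 in simp)
  then have "continuous_on {0..1} Y" by (simp add: continuous_on_eq_continuous_within)
  then show "continuous_on {0..1} (\<lambda>t. energy_coords \<Omega> (S t x))" by (simp add: Y_def[abs_def])
qed

text \<open>The generator is only applied inside the pairing with \<open>\<phi>\<close>, where each Laplacian is moved to
  the other side.\<close>

lemma plate_operator_tested:
  fixes \<Omega> :: "(real ^ 'n) set"
  assumes \<Omega>: "open \<Omega>" and pos: "\<rho> > 0" "a > 0" "b > 0" "c > 0" "d > 0"
    and dom: "(u, v, \<theta>) \<in> plate_domain \<Omega>"
    and \<phi>: "norm (\<psi>1 - \<mu> *\<^sub>R \<phi>) \<le> \<delta>" "norm (\<psi>2 - \<mu>\<^sup>2 *\<^sub>R \<phi>) \<le> \<delta>"
      "\<And>u. u \<in> sobolev 2 \<Omega> \<Longrightarrow> u \<in> H10 \<Omega> \<Longrightarrow> - laplacian \<Omega> u \<bullet> \<phi> = u \<bullet> \<psi>1"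
      "\<And>u. u \<in> sobolev 2 \<Omega> \<Longrightarrow> u \<in> H10 \<Omega> \<Longrightarrow> - laplacian \<Omega> u \<bullet> \<psi>1 = u \<bullet> \<psi>2"
    and B: "norm (laplacian \<Omega> u) \<le> B" "norm v \<le> B" "norm \<theta> \<le> B"
    and A: "plate_operator \<Omega> \<rho> a b c d \<eta> (u, v, \<theta>) = (u', v', \<theta>')"
  shows "\<bar>- laplacian \<Omega> u' \<bullet> \<phi> - \<mu> * (v \<bullet> \<phi>)\<bar> \<le> (1 + b + c + d + \<bar>\<eta>\<bar>) * (B * \<delta>)"
    and "\<bar>\<rho> * (v' \<bullet> \<phi>) + c * \<mu> * (- laplacian \<Omega> u \<bullet> \<phi>) + \<eta> * \<mu> * (\<theta> \<bullet> \<phi>)\<bar>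
      \<le> (1 + b + c + d + \<bar>\<eta>\<bar>) * (B * \<delta>)"
    and "\<bar>a * (\<theta>' \<bullet> \<phi>) + (b * \<mu> + d * \<mu>\<^sup>2) * (\<theta> \<bullet> \<phi>) - \<eta> * \<mu> * (v \<bullet> \<phi>)\<bar>
      \<le> (1 + b + c + d + \<bar>\<eta>\<bar>) * (B * \<delta>)"
proof -
  define e1 where "e1 = \<psi>1 - \<mu> *\<^sub>R \<phi>"
  define e2 where "e2 = \<psi>2 - \<mu>\<^sup>2 *\<^sub>R \<phi>"
  have \<psi>: "\<psi>1 = \<mu> *\<^sub>R \<phi> + e1" "\<psi>2 = \<mu>\<^sup>2 *\<^sub>R \<phi> + e2" by (simp_all add: e1_def e2_def)
  \<comment> \<open>\<open>w\<close> is treated as an unknown of its own: the energy bounds it in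
    L2, so \<Delta>^2 u costs only one transfer of a Laplacian.\<close>
  define w where "w = laplacian \<Omega> u"
  have u: "u \<in> sobolev 4 \<Omega>" and w: "w \<in> sobolev 2 \<Omega>" "w \<in> H10 \<Omega>"
    and v: "v \<in> sobolev 2 \<Omega>" "v \<in> H10 \<Omega>"
    and \<theta>4: "\<theta> \<in> sobolev 4 \<Omega>" and \<theta>: "\<theta> \<in> H10 \<Omega>" "laplacian \<Omega> \<theta> \<in> H10 \<Omega>"
    using dom by (auto simp: plate_domain_def H4_star_def w_def laplacian_in_sobolev[OF \<Omega>])
  have \<theta>2: "\<theta> \<in> sobolev 2 \<Omega>" using \<theta>4 sobolev_mono[of 2 4] by auto
  have A': "u' = v" "v' = (1 / \<rho>) *\<^sub>R (- c *\<^sub>R laplacian \<Omega> w + \<eta> *\<^sub>R laplacian \<Omega> \<theta>)"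
    "\<theta>' = (1 / a) *\<^sub>R (b *\<^sub>R laplacian \<Omega> \<theta> - d *\<^sub>R laplacian \<Omega> (laplacian \<Omega> \<theta>) - \<eta> *\<^sub>R laplacian \<Omega> v)"
    using A by (auto simp: plate_operator_def w_def)
  have Lv: "laplacian \<Omega> v \<bullet> \<phi> = - (\<mu> * (v \<bullet> \<phi>) + v \<bullet> e1)"
    using \<phi>(3)[OF v] by (simp add: \<psi> inner_add_right)
  have Lw: "laplacian \<Omega> w \<bullet> \<phi> = - (\<mu> * (w \<bullet> \<phi>) + w \<bullet> e1)"
    using \<phi>(3)[OF w] by (simp add: \<psi> inner_add_right)
  have L\<theta>: "laplacian \<Omega> \<theta> \<bullet> \<phi> = - (\<mu> * (\<theta> \<bullet> \<phi>) + \<theta> \<bullet> e1)"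
    using \<phi>(3)[OF \<theta>2 \<theta>(1)] by (simp add: \<psi> inner_add_right)
  \<comment> \<open>Two transfers: the first uses the boundary condition on \<Delta> \<theta>, the
    second that on \<theta> itself.\<close>
  have LL\<theta>: "laplacian \<Omega> (laplacian \<Omega> \<theta>) \<bullet> \<phi> = \<mu>\<^sup>2 * (\<theta> \<bullet> \<phi>) + \<theta> \<bullet> e2"
    using \<phi>(3)[OF laplacian_in_sobolev[OF \<Omega> \<theta>4] \<theta>(2)] \<phi>(4)[OF \<theta>2 \<theta>(1)]
    by (simp add: \<psi>(2) inner_add_right)
  have B0: "B \<ge> 0" using B(2) norm_ge_zero order_trans by blast
  have \<delta>0: "\<delta> \<ge> 0" using \<phi>(1) norm_ge_zero order_trans by blast
  have le: "\<bar>z \<bullet> e\<bar> \<le> B * \<delta>" if "norm z \<le> B" "norm e \<le> \<delta>" for z e :: "(real ^ 'n) L2"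
    using Cauchy_Schwarz_ineq2[of z e] mult_mono[OF that B0] by (auto intro: order_trans)
  have e: "\<bar>v \<bullet> e1\<bar> \<le> B * \<delta>" "\<bar>w \<bullet> e1\<bar> \<le> B * \<delta>" "\<bar>\<theta> \<bullet> e1\<bar> \<le> B * \<delta>" "\<bar>\<theta> \<bullet> e2\<bar> \<le> B * \<delta>"
    using B \<phi>(1,2) by (auto intro!: le simp: e1_def e2_def w_def)
  have sc: "\<bar>k * z\<bar> \<le> \<bar>k\<bar> * (B * \<delta>)" if "\<bar>z\<bar> \<le> B * \<delta>" for k z :: real
    using that by (simp add: abs_mult mult_left_mono)
  have expand: "(1 + b + c + d + \<bar>\<eta>\<bar>) * (B * \<delta>)
      = B * \<delta> + b * (B * \<delta>) + c * (B * \<delta>) + d * (B * \<delta>) + \<bar>\<eta>\<bar> * (B * \<delta>)"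
    by (simp add: algebra_simps)
  have nn: "0 \<le> B * \<delta>" "0 \<le> b * (B * \<delta>)" "0 \<le> c * (B * \<delta>)" "0 \<le> d * (B * \<delta>)" "0 \<le> \<bar>\<eta>\<bar> * (B * \<delta>)"
    using B0 \<delta>0 pos by auto
  have "- laplacian \<Omega> u' \<bullet> \<phi> - \<mu> * (v \<bullet> \<phi>) = v \<bullet> e1" by (simp add: A' Lv)
  then show "\<bar>- laplacian \<Omega> u' \<bullet> \<phi> - \<mu> * (v \<bullet> \<phi>)\<bar> \<le> (1 + b + c + d + \<bar>\<eta>\<bar>) * (B * \<delta>)"
    unfolding expand using e(1) nn by linarith
  have "\<rho> * (v' \<bullet> \<phi>) = - c * (laplacian \<Omega> w \<bullet> \<phi>) + \<eta> * (laplacian \<Omega> \<theta> \<bullet> \<phi>)"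
    using pos by (simp add: A' inner_add_left inner_diff_left)
  then have "\<rho> * (v' \<bullet> \<phi>) + c * \<mu> * (- laplacian \<Omega> u \<bullet> \<phi>) + \<eta> * \<mu> * (\<theta> \<bullet> \<phi>)
      = c * (w \<bullet> e1) - \<eta> * (\<theta> \<bullet> e1)"
    unfolding Lw L\<theta> by (simp add: w_def algebra_simps)
  then show "\<bar>\<rho> * (v' \<bullet> \<phi>) + c * \<mu> * (- laplacian \<Omega> u \<bullet> \<phi>) + \<eta> * \<mu> * (\<theta> \<bullet> \<phi>)\<bar>
      \<le> (1 + b + c + d + \<bar>\<eta>\<bar>) * (B * \<delta>)"
    unfolding expand using sc[OF e(2), of c] sc[OF e(3), of \<eta>] nn pos by linarith
  have "a * (\<theta>' \<bullet> \<phi>) = b * (laplacian \<Omega> \<theta> \<bullet> \<phi>) - d * (laplacian \<Omega> (laplacian \<Omega> \<theta>) \<bullet> \<phi>)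
      - \<eta> * (laplacian \<Omega> v \<bullet> \<phi>)"
    using pos by (simp add: A' inner_diff_left)
  then have "a * (\<theta>' \<bullet> \<phi>) + (b * \<mu> + d * \<mu>\<^sup>2) * (\<theta> \<bullet> \<phi>) - \<eta> * \<mu> * (v \<bullet> \<phi>)
      = - b * (\<theta> \<bullet> e1) - d * (\<theta> \<bullet> e2) + \<eta> * (v \<bullet> e1)"
    unfolding Lv L\<theta> LL\<theta> by (simp add: algebra_simps)
  then show "\<bar>a * (\<theta>' \<bullet> \<phi>) + (b * \<mu> + d * \<mu>\<^sup>2) * (\<theta> \<bullet> \<phi>) - \<eta> * \<mu> * (v \<bullet> \<phi>)\<bar>
      \<le> (1 + b + c + d + \<bar>\<eta>\<bar>) * (B * \<delta>)"
    unfolding expand using sc[OF e(3), of "- b"] sc[OF e(4), of d] sc[OF e(1), of \<eta>] nn pos by linarith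
qed

theorem theorem4p3:
  fixes \<Omega> :: "(real ^ 'n) set" and \<rho> a b c d \<eta> :: real
    and S :: "real \<Rightarrow> (real ^ 'n) plate_state \<Rightarrow> (real ^ 'n) plate_state"
  assumes "is_domain \<Omega>" and "bounded \<Omega>" and "smooth_boundary \<Omega>"
    and "\<rho> > 0" and "a > 0" and "b > 0" and "c > 0" and "d > 0" and "\<eta> \<noteq> 0"
    and "C0_semigroup (energy_space \<Omega>) (energy_norm \<Omega> \<rho> a c) S"
    and "is_generator (energy_space \<Omega>) (energy_norm \<Omega> \<rho> a c) S
           (plate_domain \<Omega>) (plate_operator \<Omega> \<rho> a b c d \<eta>)"
  shows "\<not> differentiable_semigroup (energy_space \<Omega>) (energy_norm \<Omega> \<rho> a c) S"
proof
  assume diff: "differentiable_semigroup (energy_space \<Omega>) (energy_norm \<Omega> \<rho> a c) S"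
  note pos = \<open>\<rho> > 0\<close> \<open>a > 0\<close> \<open>b > 0\<close> \<open>c > 0\<close> \<open>d > 0\<close>
  have \<Omega>: "open \<Omega>" "\<Omega> \<noteq> {}" using assms(1) by (auto simp: is_domain_def)
  note orbit = orbit_energy_coords[OF \<Omega>(1) pos(1,2,4) assms(10,11) diff]
  obtain C M where M: "M \<ge> 1" and est: "\<And>\<mu> B p q r p' q' r'. \<mu> \<ge> M \<Longrightarrow>
      nearly_solves \<rho> a b c d \<eta> \<mu> B p q r p' q' r' \<Longrightarrow> (\<mu> * q 0)\<^sup>2 \<le> C * B\<^sup>2"
    using nearly_solves_bound[OF pos \<open>\<eta> \<noteq> 0\<close>] by blast
  define k where "k = 1 + b + c + d + \<bar>\<eta>\<bar>"
  have k: "k > 0" using pos by (simp add: k_def)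
  \<comment> \<open>\<open>k\<close> is the constant of \<open>plate_operator_tested\<close>; this
    accuracy turns its error into exactly B / \<mu>^2, as \<open>nearly_solves\<close>
    demands.\<close>
  define quasi where "quasi \<mu> = dirichlet_quasimode \<Omega> (1 / (k * \<mu>\<^sup>2)) \<mu>" for \<mu>
  \<comment> \<open>The bound depends on \<open>v\<close> but not on \<mu>: the constant for one
    orbit is fixed before any quasimode is chosen.\<close>
  have bound: "\<exists>B. \<forall>\<mu> \<phi>. M \<le> \<mu> \<longrightarrow> quasi \<mu> \<phi> \<longrightarrow> (\<mu> * (v \<bullet> \<phi>))\<^sup>2 \<le> B" if v: "v \<in> L2_on \<Omega>" for v
  proof -
    have "(0, v, 0) \<in> energy_space \<Omega>"
      using v zero_in_H10[OF \<Omega>(1)] subspace_0[OF subspace_sobolev[OF \<Omega>(1)]]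
        subspace_0[OF subspace_L2_on, of \<Omega>] \<Omega>(1) by (simp add: energy_space_def)
    note orb = orbit[OF this]
    define x where "x = (0 :: (real ^ 'n) L2, v, 0 :: (real ^ 'n) L2)"
    define U where "U t = fst (S t x)" for t
    define V where "V t = fst (snd (S t x))" for t
    define \<Theta> where "\<Theta> t = snd (snd (S t x))" for t
    have Seq: "S t x = (U t, V t, \<Theta> t)" for t by (simp add: U_def V_def \<Theta>_def)
    define AS where "AS t = plate_operator \<Omega> \<rho> a b c d \<eta> (S t x)" for t
    define Y where "Y t = energy_coords \<Omega> (S t x)" for t
    define Y' where "Y' t = energy_coords \<Omega> (AS t)" for t
    have Y: "Y t = (laplacian \<Omega> (U t), V t, \<Theta> t)" for t by (simp add: Y_def Seq energy_coords_def)
    have dom: "(U t, V t, \<Theta> t) \<in> plate_domain \<Omega>" if "t > 0" for t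
      using orb(1)[OF that] by (simp add: Seq flip: x_def)
    have dY: "(Y has_vector_derivative Y' t) (at t)" if "t > 0" for t
      using orb(2)[OF that] by (simp add: Y_def[abs_def] Y'_def AS_def x_def)
    have cY: "continuous_on {0..1} Y" using orb(3) by (simp add: Y_def[abs_def] x_def)
    have "bounded (Y ` {0..1})"
      by (intro compact_imp_bounded compact_continuous_image cY) auto
    then have "\<exists>B0. \<forall>y\<in>Y ` {0..1}. norm y \<le> B0" by (simp only: bounded_iff)
    then obtain B0 where B0: "\<forall>y\<in>Y ` {0..1}. norm y \<le> B0" ..
    define B where "B = max B0 (norm (Y' 1))"
    have B: "norm (Y t) \<le> B" if "0 \<le> t" "t \<le> 1" for t
      using bspec[OF B0 imageI, of t] that by (simp add: B_def)
    have Y'1: "norm (Y' 1) \<le> B" by (simp add: B_def)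
    have S0: "S 0 x = x"
      using assms(10) \<open>(0, v, 0) \<in> energy_space \<Omega>\<close> by (auto simp: C0_semigroup_def x_def)
    have Y0: "Y 0 = (0, v, 0)"
      unfolding Y_def S0 by (simp add: x_def energy_coords_def laplacian_0[OF \<Omega>(1)])
    have "(\<mu> * (v \<bullet> \<phi>))\<^sup>2 \<le> C * B\<^sup>2" if \<mu>: "M \<le> \<mu>" and q: "quasi \<mu> \<phi>" for \<mu> \<phi>
    proof -
      obtain \<psi>1 \<psi>2 where \<phi>: "norm \<phi> = 1"
        "norm (\<psi>1 - \<mu> *\<^sub>R \<phi>) \<le> 1 / (k * \<mu>\<^sup>2)" "norm (\<psi>2 - \<mu>\<^sup>2 *\<^sub>R \<phi>) \<le> 1 / (k * \<mu>\<^sup>2)"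
        "\<And>u. u \<in> sobolev 2 \<Omega> \<Longrightarrow> u \<in> H10 \<Omega> \<Longrightarrow> - laplacian \<Omega> u \<bullet> \<phi> = u \<bullet> \<psi>1"
        "\<And>u. u \<in> sobolev 2 \<Omega> \<Longrightarrow> u \<in> H10 \<Omega> \<Longrightarrow> - laplacian \<Omega> u \<bullet> \<psi>1 = u \<bullet> \<psi>2"
        using q unfolding quasi_def dirichlet_quasimode_def by blast
      have kB: "(1 + b + c + d + \<bar>\<eta>\<bar>) * (B * (1 / (k * \<mu>\<^sup>2))) = B / \<mu>\<^sup>2"
        using k unfolding k_def[symmetric] by simp
      have coord: "\<bar>f \<bullet> \<phi>\<bar> \<le> norm f" for f
        using Cauchy_Schwarz_ineq2[of f \<phi>] \<phi>(1) by simp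
      have coords: "norm (fst y) \<le> norm y" "norm (fst (snd y)) \<le> norm y" "norm (snd (snd y)) \<le> norm y"
        for y :: "(real ^ 'n) L2 \<times> (real ^ 'n) L2 \<times> (real ^ 'n) L2"
        by (metis norm_fst_le norm_snd_le prod.collapse order_trans)+
      have UB: "norm (laplacian \<Omega> (U t)) \<le> B" "norm (V t) \<le> B" "norm (\<Theta> t) \<le> B" if "0 \<le> t" "t \<le> 1" for t
        using B[OF that] coords[of "Y t"] unfolding Y by auto
      have tested:
        "\<bar>- fst (Y' t) \<bullet> \<phi> - \<mu> * (fst (snd (Y t)) \<bullet> \<phi>)\<bar> \<le> B / \<mu>\<^sup>2"
        "\<bar>\<rho> * (fst (snd (Y' t)) \<bullet> \<phi>) + c * \<mu> * (- fst (Y t) \<bullet> \<phi>) + \<eta> * \<mu> * (snd (snd (Y t)) \<bullet> \<phi>)\<bar> \<le> B / \<mu>\<^sup>2"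
        "\<bar>a * (snd (snd (Y' t)) \<bullet> \<phi>) + (b * \<mu> + d * \<mu>\<^sup>2) * (snd (snd (Y t)) \<bullet> \<phi>)
          - \<eta> * \<mu> * (fst (snd (Y t)) \<bullet> \<phi>)\<bar> \<le> B / \<mu>\<^sup>2" if t: "0 < t" "t \<le> 1" for t
      proof -
        obtain u' v' \<theta>' where A: "AS t = (u', v', \<theta>')" by (cases "AS t")
        have Y': "Y' t = (laplacian \<Omega> u', v', \<theta>')" by (simp add: Y'_def A energy_coords_def)
        note op = plate_operator_tested[OF \<Omega>(1) pos dom[OF t(1)] \<phi>(2-5) UB[OF less_imp_le[OF t(1)] t(2)]
            A[unfolded AS_def Seq], unfolded kB]
        show "\<bar>- fst (Y' t) \<bullet> \<phi> - \<mu> * (fst (snd (Y t)) \<bullet> \<phi>)\<bar> \<le> B / \<mu>\<^sup>2"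
          "\<bar>\<rho> * (fst (snd (Y' t)) \<bullet> \<phi>) + c * \<mu> * (- fst (Y t) \<bullet> \<phi>) + \<eta> * \<mu> * (snd (snd (Y t)) \<bullet> \<phi>)\<bar> \<le> B / \<mu>\<^sup>2"
          "\<bar>a * (snd (snd (Y' t)) \<bullet> \<phi>) + (b * \<mu> + d * \<mu>\<^sup>2) * (snd (snd (Y t)) \<bullet> \<phi>)
            - \<eta> * \<mu> * (fst (snd (Y t)) \<bullet> \<phi>)\<bar> \<le> B / \<mu>\<^sup>2"
          using op unfolding Y Y' fst_conv snd_conv by blast+
      qed
      have der: "((\<lambda>t. l (Y t)) has_real_derivative l (Y' t)) (at t)"
        if "bounded_linear l" "0 < t" for l :: "_ \<Rightarrow> real" and t
        using bounded_linear.has_vector_derivative[OF that(1) dY[OF that(2)]]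
        by (simp add: has_real_derivative_iff_has_vector_derivative)
      have bl: "bounded_linear (\<lambda>y. - fst y \<bullet> \<phi>)" "bounded_linear (\<lambda>y. fst (snd y) \<bullet> \<phi>)"
        "bounded_linear (\<lambda>y. snd (snd y) \<bullet> \<phi>)"
        by (intro bounded_linear_inner_left_comp bounded_linear_minus bounded_linear_fst_comp
            bounded_linear_snd_comp bounded_linear_ident)+
      have "(\<mu> * (fst (snd (Y 0)) \<bullet> \<phi>))\<^sup>2 \<le> C * B\<^sup>2"
      proof (rule est[OF \<mu>])
        have "continuous_on {0..1} (\<lambda>t. - fst (Y t) \<bullet> \<phi>)"
          "continuous_on {0..1} (\<lambda>t. fst (snd (Y t)) \<bullet> \<phi>)"
          "continuous_on {0..1} (\<lambda>t. snd (snd (Y t)) \<bullet> \<phi>)"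
          by (intro continuous_intros cY)+
        moreover have "\<bar>- fst (Y t) \<bullet> \<phi>\<bar> \<le> B" "\<bar>fst (snd (Y t)) \<bullet> \<phi>\<bar> \<le> B" "\<bar>snd (snd (Y t)) \<bullet> \<phi>\<bar> \<le> B"
          if "t \<in> {0<..1}" for t
          using B[of t] that coord[of "fst (Y t)"] coord[of "fst (snd (Y t))"] coord[of "snd (snd (Y t))"]
            coords[of "Y t"] by auto
        moreover have "\<bar>- fst (Y' 1) \<bullet> \<phi>\<bar> \<le> B" "\<bar>fst (snd (Y' 1)) \<bullet> \<phi>\<bar> \<le> B" "\<bar>snd (snd (Y' 1)) \<bullet> \<phi>\<bar> \<le> B"
          using Y'1 coord[of "fst (Y' 1)"] coord[of "fst (snd (Y' 1))"] coord[of "snd (snd (Y' 1))"]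
            coords[of "Y' 1"] by auto
        moreover have "- fst (Y 0) \<bullet> \<phi> = 0" "snd (snd (Y 0)) \<bullet> \<phi> = 0"
          by (simp_all add: Y0)
        ultimately show "nearly_solves \<rho> a b c d \<eta> \<mu> B (\<lambda>t. - fst (Y t) \<bullet> \<phi>)
            (\<lambda>t. fst (snd (Y t)) \<bullet> \<phi>) (\<lambda>t. snd (snd (Y t)) \<bullet> \<phi>) (\<lambda>t. - fst (Y' t) \<bullet> \<phi>)
            (\<lambda>t. fst (snd (Y' t)) \<bullet> \<phi>) (\<lambda>t. snd (snd (Y' t)) \<bullet> \<phi>)"
          unfolding nearly_solves_def using der[OF bl(1)] der[OF bl(2)] der[OF bl(3)] tested
          by (intro conjI ballI) auto
      qed
      then show ?thesis by (simp add: Y0)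
    qed
    then show ?thesis by blast
  qed
  have "\<exists>\<mu> \<phi>. max M (9 ^ n) \<le> \<mu> \<and> quasi \<mu> \<phi>" for n :: nat
  proof -
    obtain \<mu> where \<mu>: "\<mu> > max M (9 ^ n)"
      and ex: "\<And>\<delta>. \<delta> > 0 \<Longrightarrow> \<exists>\<phi>. dirichlet_quasimode \<Omega> \<delta> \<mu> \<phi>"
      using dirichlet_quasimodes[OF \<Omega>] by blast
    have "1 / (k * \<mu>\<^sup>2) > 0" using k \<mu> M by simp
    from ex[OF this] obtain \<phi> where "quasi \<mu> \<phi>" unfolding quasi_def by blast
    with \<mu> show ?thesis by (intro exI[of _ \<mu>] exI[of _ \<phi>]) simp
  qed
  then obtain \<mu> \<phi> where \<mu>\<phi>: "\<And>n. max M (9 ^ n) \<le> \<mu> n" "\<And>n. quasi (\<mu> n) (\<phi> n)" by metis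
  have "\<exists>v\<in>L2_on \<Omega>. \<forall>B. \<exists>n. B < \<mu> n * \<bar>v \<bullet> \<phi> n\<bar>"
    using \<mu>\<phi> \<Omega>(1)
    by (intro unbounded_functionals subspace_L2_on closed_L2_on) (auto simp: quasi_def dirichlet_quasimode_def)
  then obtain v where v: "v \<in> L2_on \<Omega>" "\<And>B. \<exists>n. B < \<mu> n * \<bar>v \<bullet> \<phi> n\<bar>" by blast
  obtain B where B: "\<And>n. (\<mu> n * (v \<bullet> \<phi> n))\<^sup>2 \<le> B"
    using bound[OF v(1)] \<mu>\<phi> by (meson max.boundedE)
  \<comment> \<open>\<open>1 + \<bar>B\<bar>\<close> exceeds \<open>B\<close> and is at least 1, so
    it does not decrease on squaring.\<close>
  obtain n where n: "1 + \<bar>B\<bar> < \<mu> n * \<bar>v \<bullet> \<phi> n\<bar>" using v(2) by blast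
  have "1 + \<bar>B\<bar> \<le> (1 + \<bar>B\<bar>)\<^sup>2" by (simp add: power2_eq_square algebra_simps)
  also have "\<dots> \<le> (\<mu> n * \<bar>v \<bullet> \<phi> n\<bar>)\<^sup>2" using n by (intro power_mono) auto
  also have "\<dots> = (\<mu> n * (v \<bullet> \<phi> n))\<^sup>2" by (simp add: power_mult_distrib)
  also have "\<dots> \<le> B" by (rule B)
  finally show False by simp
qed

end
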